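(* Let $\mathscr H$ be a Hilbert space and let $f$ be an operator convex function on an interval $J\subseteq\mathbb R$. Let $C_i$ $(1\le i\le n)$ be arbitrary bounded operators on $\mathscr H$ and let $B$ and $A_i$ $(1\le i\le n)$ be self-adjoint bounded operators on $\mathscr H$ such that the spectra of $B-\sum_{i=1}^nC_i^*A_iC_i$ and of each $A_i$ are contained in $J$. Then $$f\Big(B-\sum_{i=1}^nC_i^*A_iC_i\Big)+\sum_{i=1}^nC_i^*f(A_i)C_i\ \ge\ D^{-1}f(DBD)D^{-1},$$ where $D=\left(I+\sum_{i=1}^nC_i^*C_i\right)^{-1/2}$.
   Context: A continuous function $f:J\to\mathbb R$ on an interval $J$ is operator convex if $f((1-\lambda)A+\lambda B)\le(1-\lambda)f(A)+\lambda f(B)$ for all $\lambda\in[0,1]$ and all self-adjoint bounded operators $A,B$ on a Hilbert space with spectra contained in $J$. Here $\le$ is the positive semidefinite (Loewner) order, $I$ is the identity operator, and $f$ is applied to self-adjoint operators by continuous functional calculus. *)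

theory Defs
  imports
    "HOL-Analysis.Analysis"
    "HOL-Computational_Algebra.Polynomial"
    "HOL-Algebra.Module"
begin

(* Hilbert spaces are structures with an explicit carrier set, not a type class: the definition of
   operator convexity quantifies over all Hilbert spaces, and HOL has no quantifier over types
   inside a formula. *)

definition complex_ring :: "complex ring" where
  "complex_ring = \<lparr>carrier = UNIV, mult = (*), one = 1, zero = 0, add = (+)\<rparr>"

(* The fields mult and one inherited from the module record play no role in a Hilbert space. *)
record 'a inner_product_space = "(complex, 'a) module" +
  hinner :: "'a \<Rightarrow> 'a \<Rightarrow> complex"

definition hnorm :: "'a inner_product_space \<Rightarrow> 'a \<Rightarrow> real" where
  "hnorm H x = sqrt (Re (hinner H x x))"

(* The inner product is linear in its first argument. *)
locale hilbert_space =
  Module.module complex_ring H for H :: "'a inner_product_space" (structure) +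
  assumes hinner_add_left:
      "\<lbrakk>x \<in> carrier H; y \<in> carrier H; z \<in> carrier H\<rbrakk> \<Longrightarrow>
        hinner H (x \<oplus> y) z = hinner H x z + hinner H y z"
    and hinner_smult_left:
      "\<lbrakk>x \<in> carrier H; y \<in> carrier H\<rbrakk> \<Longrightarrow> hinner H (c \<odot> x) y = c * hinner H x y"
    and hinner_commute:
      "\<lbrakk>x \<in> carrier H; y \<in> carrier H\<rbrakk> \<Longrightarrow> hinner H x y = cnj (hinner H y x)"
    and hinner_nonneg: "x \<in> carrier H \<Longrightarrow> hinner H x x \<in> \<real>\<^sub>\<ge>\<^sub>0"
    and hinner_definite: "\<lbrakk>x \<in> carrier H; hinner H x x = 0\<rbrakk> \<Longrightarrow> x = \<zero>"
    and complete:
      "\<lbrakk>range s \<subseteq> carrier H;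
        \<And>e. e > 0 \<Longrightarrow> \<exists>N::nat. \<forall>m\<ge>N. \<forall>k\<ge>N. hnorm H (s m \<ominus> s k) < e\<rbrakk> \<Longrightarrow>
        \<exists>l\<in>carrier H. (\<lambda>k. hnorm H (s k \<ominus> l)) \<longlonglongrightarrow> 0"

(* The algebra of bounded linear operators. Operators are extensional functions (undefined outside
   the carrier), so that operators agreeing on the Hilbert space are equal. *)
definition bounded_ops :: "'a inner_product_space \<Rightarrow> (complex, 'a \<Rightarrow> 'a) module" where
  "bounded_ops H =
    \<lparr>carrier = {T \<in> carrier H \<rightarrow>\<^sub>E carrier H.
        (\<forall>x\<in>carrier H. \<forall>y\<in>carrier H. T (x \<oplus>\<^bsub>H\<^esub> y) = T x \<oplus>\<^bsub>H\<^esub> T y) \<and>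
        (\<forall>c. \<forall>x\<in>carrier H. T (c \<odot>\<^bsub>H\<^esub> x) = c \<odot>\<^bsub>H\<^esub> T x) \<and>
        (\<exists>K. \<forall>x\<in>carrier H. hnorm H (T x) \<le> K * hnorm H x)},
     mult = compose (carrier H),
     one = (\<lambda>x\<in>carrier H. x),
     zero = (\<lambda>x\<in>carrier H. \<zero>\<^bsub>H\<^esub>),
     add = (\<lambda>S T. \<lambda>x\<in>carrier H. S x \<oplus>\<^bsub>H\<^esub> T x),
     smult = (\<lambda>c T. \<lambda>x\<in>carrier H. c \<odot>\<^bsub>H\<^esub> T x)\<rparr>"

definition op_norm :: "'a inner_product_space \<Rightarrow> ('a \<Rightarrow> 'a) \<Rightarrow> real" where
  "op_norm H T = (SUP x \<in> {x \<in> carrier H. hnorm H x \<le> 1}. hnorm H (T x))"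

definition adj :: "'a inner_product_space \<Rightarrow> ('a \<Rightarrow> 'a) \<Rightarrow> ('a \<Rightarrow> 'a)" where
  "adj H T = (THE S. S \<in> carrier (bounded_ops H) \<and>
     (\<forall>x\<in>carrier H. \<forall>y\<in>carrier H. hinner H (T x) y = hinner H x (S y)))"

definition self_adjoint :: "'a inner_product_space \<Rightarrow> ('a \<Rightarrow> 'a) \<Rightarrow> bool" where
  "self_adjoint H T \<longleftrightarrow> T \<in> carrier (bounded_ops H) \<and> adj H T = T"

definition op_spectrum :: "'a inner_product_space \<Rightarrow> ('a \<Rightarrow> 'a) \<Rightarrow> complex set" where
  "op_spectrum H T =
    {z. z \<odot>\<^bsub>bounded_ops H\<^esub> \<one>\<^bsub>bounded_ops H\<^esub> \<ominus>\<^bsub>bounded_ops H\<^esub> T \<notin> Units (bounded_ops H)}"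

definition loewner_le :: "'a inner_product_space \<Rightarrow> ('a \<Rightarrow> 'a) \<Rightarrow> ('a \<Rightarrow> 'a) \<Rightarrow> bool" where
  "loewner_le H S T \<longleftrightarrow>
    (\<forall>x\<in>carrier H. hinner H ((T \<ominus>\<^bsub>bounded_ops H\<^esub> S) x) x \<in> \<real>\<^sub>\<ge>\<^sub>0)"

definition op_poly :: "'a inner_product_space \<Rightarrow> real poly \<Rightarrow> ('a \<Rightarrow> 'a) \<Rightarrow> ('a \<Rightarrow> 'a)" where
  "op_poly H p T = (\<Oplus>\<^bsub>bounded_ops H\<^esub>k\<in>{..degree p}.
     complex_of_real (coeff p k) \<odot>\<^bsub>bounded_ops H\<^esub> (T [^]\<^bsub>bounded_ops H\<^esub> k))"

(* Continuous functional calculus: f(T) is the norm limit of p_k(T) for every sequence of real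
   polynomials p_k converging to f uniformly on the spectrum of T. It is meaningful for
   self-adjoint T (whose spectrum is real and compact) and f continuous on the spectrum; such
   sequences then exist by the Weierstrass theorem. *)
definition cfc :: "'a inner_product_space \<Rightarrow> (real \<Rightarrow> real) \<Rightarrow> ('a \<Rightarrow> 'a) \<Rightarrow> ('a \<Rightarrow> 'a)" where
  "cfc H f T = (THE S. S \<in> carrier (bounded_ops H) \<and>
     (\<forall>p. uniform_limit {x. complex_of_real x \<in> op_spectrum H T}
             (\<lambda>k::nat. poly (p k)) f sequentially \<longrightarrow>
           (\<lambda>k. op_norm H (op_poly H (p k) T \<ominus>\<^bsub>bounded_ops H\<^esub> S)) \<longlonglongrightarrow> 0))"

(* The type 'a is the universe of points: H ranges over all Hilbert spaces, of any dimension, whose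
   carrier is a subset of 'a. If 'a carries a nonzero Hilbert space K, then up to isomorphism these
   include all finite powers of K, which have the same cardinality as K. *)
definition operator_convex :: "'a itself \<Rightarrow> real set \<Rightarrow> (real \<Rightarrow> real) \<Rightarrow> bool" where
  "operator_convex _ J f \<longleftrightarrow> continuous_on J f \<and>
    (\<forall>H :: 'a inner_product_space. hilbert_space H \<longrightarrow>
      (\<forall>A B. \<forall>t\<in>{0..1::real}.
        self_adjoint H A \<longrightarrow> self_adjoint H B \<longrightarrow>
        op_spectrum H A \<subseteq> complex_of_real ` J \<longrightarrow>
        op_spectrum H B \<subseteq> complex_of_real ` J \<longrightarrow>
        loewner_le H
          (cfc H f (complex_of_real (1 - t) \<odot>\<^bsub>bounded_ops H\<^esub> A \<oplus>\<^bsub>bounded_ops H\<^esub>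
                    complex_of_real t \<odot>\<^bsub>bounded_ops H\<^esub> B))
          (complex_of_real (1 - t) \<odot>\<^bsub>bounded_ops H\<^esub> cfc H f A \<oplus>\<^bsub>bounded_ops H\<^esub>
           complex_of_real t \<odot>\<^bsub>bounded_ops H\<^esub> cfc H f B)))"

end

theory Submission
  imports Defs "HOL-Computational_Algebra.Fundamental_Theorem_Algebra"
begin

text \<open>
  Put \<open>A\<^sub>0 = B - \<Sum>C\<^sub>i\<^sup>*A\<^sub>iC\<^sub>i\<close>, \<open>C\<^sub>0 = 1\<close> and \<open>W\<^sub>i = C\<^sub>iD\<close>. Then \<open>\<Sum>W\<^sub>i\<^sup>*W\<^sub>i = 1\<close> and \<open>DBD = \<Sum>W\<^sub>i\<^sup>*A\<^sub>iW\<^sub>i\<close>,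
  so the claim is the operator Jensen inequality \<open>f (\<Sum>W\<^sub>i\<^sup>*A\<^sub>iW\<^sub>i) \<le> \<Sum>W\<^sub>i\<^sup>*f(A\<^sub>i)W\<^sub>i\<close>, conjugated by \<open>D\<^sup>-\<^sup>1\<close>.
  Jensen's inequality follows by applying operator convexity, on the space of families indexed by \<open>i\<close>,
  to \<open>A = diag (A\<^sub>i)\<close> and \<open>UAU\<close>, where \<open>U = 2VV\<^sup>* - 1\<close> and \<open>V x = (W\<^sub>i x)\<^sub>i\<close>. The values
  of \<open>f\<close> on these operators are compared by the fact that \<open>XT = T'X\<close> implies \<open>X f(T) = f(T') X\<close>.
\<close>

section \<open>Hilbert spaces\<close>

text \<open>Spectra are awkward to carry along, since the spectrum of a compression or of a mean is
  hard to locate. They are traded for form bounds \<open>a \<le> T \<le> b\<close>, which pass at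
  once to diagonal operators, compressions, conjugates by \<open>U\<close> and means;
  \<open>form_bounded_spectrum\<close> and \<open>spectrum_form_bounded\<close> translate in both
  directions. As \<open>J\<close> need not be closed, the endpoints must themselves lie in
  \<open>J\<close>; the least and greatest points of the closed spectrum do. The functional calculus
  rests on one estimate: the norm of \<open>p(T)\<close> is at most the maximum of
  \<open>\<bar>p\<bar>\<close> on the spectrum. Behind it is the fact that plus or minus the norm of
  a self-adjoint operator belongs to its spectrum. Adjoints and inverses both come from minimising a
  quadratic functional. The reflection \<open>U\<close> needs nothing but \<open>V\<close> and its
  adjoint, and it fixes the range of \<open>V\<close>. There \<open>f(UAU)\<close> and
  \<open>f(A)\<close> have the same quadratic form, so the right side of the convexity inequality
  collapses to the form of \<open>f(A)\<close>, and the mean of \<open>A\<close> and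
  \<open>UAU\<close> acts there as the compression.\<close>

context hilbert_space
begin

lemma complex_ring_simps [simp]:
  "carrier complex_ring = UNIV" "x \<otimes>\<^bsub>complex_ring\<^esub> y = x * y" "\<one>\<^bsub>complex_ring\<^esub> = 1"
  "\<zero>\<^bsub>complex_ring\<^esub> = 0" "x \<oplus>\<^bsub>complex_ring\<^esub> y = x + y"
  by (simp_all add: complex_ring_def)

lemma scale_closed [simp]: "x \<in> carrier H \<Longrightarrow> c \<odot> x \<in> carrier H"
  by simp

lemma scale_one [simp]: "x \<in> carrier H \<Longrightarrow> 1 \<odot> x = x"
  using smult_one by simp

lemma hinner_zero_left [simp]: "y \<in> carrier H \<Longrightarrow> hinner H \<zero> y = 0"
  using hinner_add_left[of "\<zero>" "\<zero>" y] by simp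

lemma hinner_zero_right [simp]: "y \<in> carrier H \<Longrightarrow> hinner H y \<zero> = 0"
  using hinner_commute[of y "\<zero>"] by simp

lemma hinner_minus_left: "x \<in> carrier H \<Longrightarrow> y \<in> carrier H \<Longrightarrow> hinner H (\<ominus> x) y = - hinner H x y"
  using hinner_add_left[of "\<ominus> x" x y] by (simp add: M.l_neg add_eq_0_iff2)

lemma hinner_diff_left:
  "x \<in> carrier H \<Longrightarrow> y \<in> carrier H \<Longrightarrow> z \<in> carrier H \<Longrightarrow>
    hinner H (x \<ominus> y) z = hinner H x z - hinner H y z"
  by (simp add: M.minus_eq hinner_add_left hinner_minus_left)

lemma hinner_add_right:
  "x \<in> carrier H \<Longrightarrow> y \<in> carrier H \<Longrightarrow> z \<in> carrier H \<Longrightarrow>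
    hinner H x (y \<oplus> z) = hinner H x y + hinner H x z"
  by (metis M.add.m_closed complex_cnj_add hinner_add_left hinner_commute)

lemma hinner_smult_right:
  "x \<in> carrier H \<Longrightarrow> y \<in> carrier H \<Longrightarrow> hinner H x (c \<odot> y) = cnj c * hinner H x y"
  by (metis complex_cnj_mult hinner_commute hinner_smult_left scale_closed)

lemma hinner_diff_right:
  "x \<in> carrier H \<Longrightarrow> y \<in> carrier H \<Longrightarrow> z \<in> carrier H \<Longrightarrow>
    hinner H x (y \<ominus> z) = hinner H x y - hinner H x z"
  by (metis M.minus_closed complex_cnj_diff hinner_commute hinner_diff_left)

lemmas hinner_simps = hinner_add_left hinner_smult_left hinner_diff_left
  hinner_add_right hinner_smult_right hinner_diff_right

text \<open>Lets identities between vectors be checked as identities of complex numbers, where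
  \<open>hinner_simps\<close> and field arithmetic apply. Most vector and operator identities below
  are settled in this way.\<close>

lemma vec_eqI:
  assumes "x \<in> carrier H" "y \<in> carrier H" "\<And>z. z \<in> carrier H \<Longrightarrow> hinner H x z = hinner H y z"
  shows "x = y"
proof -
  have "hinner H (x \<ominus> y) (x \<ominus> y) = 0"
    using assms by (simp add: hinner_diff_left)
  then have "x \<ominus> y = \<zero>"
    using assms hinner_definite by blast
  then have "x \<oplus> \<ominus> y = \<zero>"
    by (simp add: M.minus_eq)
  then have "\<ominus> (\<ominus> y) = x"
    using assms by (intro M.minus_equality) auto
  then show ?thesis
    using assms by simp
qed

lemma hinner_self_eq: "x \<in> carrier H \<Longrightarrow> hinner H x x = complex_of_real ((hnorm H x)\<^sup>2)"
  using hinner_nonneg[of x]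
  by (auto simp: hnorm_def complex_nonneg_Reals_iff complex_eq_iff)

lemma hnorm_nonneg [simp]: "x \<in> carrier H \<Longrightarrow> 0 \<le> hnorm H x"
  using hinner_nonneg[of x] by (auto simp: hnorm_def complex_nonneg_Reals_iff)

lemma hnorm_power2: "x \<in> carrier H \<Longrightarrow> (hnorm H x)\<^sup>2 = Re (hinner H x x)"
  using hinner_self_eq[of x] by simp

lemma hnorm_zero [simp]: "hnorm H \<zero> = 0"
  by (simp add: hnorm_def)

lemma hnorm_eq_0_iff: "x \<in> carrier H \<Longrightarrow> hnorm H x = 0 \<longleftrightarrow> x = \<zero>"
  using hinner_self_eq[of x] hinner_definite[of x] by auto

lemma hnorm_smult: "x \<in> carrier H \<Longrightarrow> hnorm H (c \<odot> x) = cmod c * hnorm H x"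
proof -
  assume x: "x \<in> carrier H"
  have "hinner H (c \<odot> x) (c \<odot> x) = (c * cnj c) * hinner H x x"
    using x by (simp add: hinner_simps)
  also have "\<dots> = complex_of_real ((cmod c)\<^sup>2 * (hnorm H x)\<^sup>2)"
    by (simp only: hinner_self_eq[OF x] complex_norm_square[symmetric] of_real_mult)
  finally have "Re (hinner H (c \<odot> x) (c \<odot> x)) = (cmod c)\<^sup>2 * (hnorm H x)\<^sup>2"
    by (simp only: Re_complex_of_real)
  then have "(hnorm H (c \<odot> x))\<^sup>2 = (cmod c * hnorm H x)\<^sup>2"
    using x by (simp only: hnorm_power2[of "c \<odot> x"] scale_closed power_mult_distrib)
  then show ?thesis
    by (rule power2_eq_imp_eq) (simp_all add: x)
qed

lemma hnorm_minus_commute: "x \<in> carrier H \<Longrightarrow> y \<in> carrier H \<Longrightarrow> hnorm H (x \<ominus> y) = hnorm H (y \<ominus> x)"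
  by (simp add: hnorm_def hinner_simps)

lemma Cauchy_Schwarz:
  assumes x: "x \<in> carrier H" and y: "y \<in> carrier H"
  shows "cmod (hinner H x y) \<le> hnorm H x * hnorm H y"
proof (cases "hnorm H y = 0")
  case True
  then show ?thesis using assms hnorm_eq_0_iff[of y] by simp
next
  case False
  define n where "n = hnorm H y"
  define b where "b = hinner H x y"
  have n: "n > 0" using False hnorm_nonneg[OF y] by (simp add: n_def)
  \<comment> \<open>\<open>n\<^sup>2\<close> times the component of \<open>x\<close> orthogonal to
    \<open>y\<close>; the scaling avoids a division.\<close>
  define z where "z = complex_of_real (n\<^sup>2) \<odot> x \<ominus> b \<odot> y"
  have z: "z \<in> carrier H" by (simp add: z_def x y)
  have yx: "hinner H y x = cnj b" using hinner_commute[OF y x] by (simp add: b_def)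
  have "hinner H z z = of_real (n\<^sup>2) * (of_real (n\<^sup>2) * hinner H x x - b * cnj b)
      - b * of_real (n\<^sup>2) * cnj b + b * cnj b * hinner H y y"
    unfolding z_def using x y
    by (simp add: hinner_simps yx b_def[symmetric] algebra_simps)
  also have "\<dots> = of_real (n\<^sup>2) * (of_real (n\<^sup>2) * hinner H x x - b * cnj b)"
    using hinner_self_eq[OF y] by (simp add: n_def)
  also have "\<dots> = complex_of_real (n\<^sup>2 * (n\<^sup>2 * (hnorm H x)\<^sup>2 - (cmod b)\<^sup>2))"
    by (simp only: hinner_self_eq[OF x] complex_norm_square[symmetric] of_real_mult of_real_diff)
  finally have "Re (hinner H z z) = n\<^sup>2 * (n\<^sup>2 * (hnorm H x)\<^sup>2 - (cmod b)\<^sup>2)"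
    by (simp only: Re_complex_of_real)
  then have "0 \<le> n\<^sup>2 * (n\<^sup>2 * (hnorm H x)\<^sup>2 - (cmod b)\<^sup>2)"
    using hnorm_power2[OF z] zero_le_power2[of "hnorm H z"] by simp
  then have "(cmod b)\<^sup>2 \<le> (n * hnorm H x)\<^sup>2"
    using n by (simp add: zero_le_mult_iff power_mult_distrib)
  then have "cmod b \<le> n * hnorm H x"
    by (rule power2_le_imp_le) (use n x in simp)
  then show ?thesis
    by (simp add: b_def n_def mult.commute)
qed

lemma hnorm_triangle:
  assumes x: "x \<in> carrier H" and y: "y \<in> carrier H"
  shows "hnorm H (x \<oplus> y) \<le> hnorm H x + hnorm H y"
proof -
  have "(hnorm H (x \<oplus> y))\<^sup>2 = (hnorm H x)\<^sup>2 + (hnorm H y)\<^sup>2 + 2 * Re (hinner H x y)"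
    using x y hinner_commute[OF y x] by (simp add: hnorm_power2 hinner_simps)
  also have "\<dots> \<le> (hnorm H x)\<^sup>2 + (hnorm H y)\<^sup>2 + 2 * (hnorm H x * hnorm H y)"
    using Cauchy_Schwarz[OF x y] complex_Re_le_cmod[of "hinner H x y"] by linarith
  also have "\<dots> = (hnorm H x + hnorm H y)\<^sup>2"
    by (simp add: power2_eq_square algebra_simps)
  finally show ?thesis
    by (rule power2_le_imp_le) (simp add: x y)
qed

lemma hnorm_diff_triangle:
  assumes "x \<in> carrier H" "y \<in> carrier H" "z \<in> carrier H"
  shows "hnorm H (x \<ominus> z) \<le> hnorm H (x \<ominus> y) + hnorm H (y \<ominus> z)"
proof -
  have "x \<ominus> z = (x \<ominus> y) \<oplus> (y \<ominus> z)"
    using assms by (intro vec_eqI) (auto simp: hinner_simps)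
  then show ?thesis
    using assms hnorm_triangle[of "x \<ominus> y" "y \<ominus> z"] by simp
qed

lemma hnorm_triangle_sub:
  assumes "x \<in> carrier H" "y \<in> carrier H"
  shows "hnorm H x \<le> hnorm H y + hnorm H (x \<ominus> y)"
proof -
  have "x = y \<oplus> (x \<ominus> y)"
    using assms by (intro vec_eqI) (auto simp: hinner_simps)
  then show ?thesis
    using assms hnorm_triangle[of y "x \<ominus> y"] by simp
qed

lemma tendsto_hinner:
  assumes "\<And>k. a k \<in> carrier H" "\<And>k. b k \<in> carrier H" "x \<in> carrier H" "y \<in> carrier H"
    and a: "(\<lambda>k. hnorm H (a k \<ominus> x)) \<longlonglongrightarrow> 0" and b: "(\<lambda>k. hnorm H (b k \<ominus> y)) \<longlonglongrightarrow> 0"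
  shows "(\<lambda>k. hinner H (a k) (b k)) \<longlonglongrightarrow> hinner H x y"
proof (rule LIM_zero_cancel, rule Lim_null_comparison)
  let ?g = "\<lambda>k. hnorm H (a k \<ominus> x) * (hnorm H y + hnorm H (b k \<ominus> y)) + hnorm H x * hnorm H (b k \<ominus> y)"
  show "\<forall>\<^sub>F k in sequentially. norm (hinner H (a k) (b k) - hinner H x y) \<le> ?g k"
  proof (rule always_eventually, rule allI)
    fix k
    have "hinner H (a k) (b k) - hinner H x y = hinner H (a k \<ominus> x) (b k) + hinner H x (b k \<ominus> y)"
      using assms by (simp add: hinner_simps)
    then have "norm (hinner H (a k) (b k) - hinner H x y)
        \<le> hnorm H (a k \<ominus> x) * hnorm H (b k) + hnorm H x * hnorm H (b k \<ominus> y)"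
      using assms Cauchy_Schwarz[of "a k \<ominus> x" "b k"] Cauchy_Schwarz[of x "b k \<ominus> y"]
      by (smt (verit) M.minus_closed norm_triangle_ineq)
    also have "\<dots> \<le> ?g k"
      using assms by (intro add_mono mult_left_mono hnorm_triangle_sub) auto
    finally show "norm (hinner H (a k) (b k) - hinner H x y) \<le> ?g k" .
  qed
  have "?g \<longlonglongrightarrow> 0 * (hnorm H y + 0) + hnorm H x * 0"
    by (intro tendsto_intros a b)
  then show "?g \<longlonglongrightarrow> 0" by simp
qed

end

section \<open>Bounded operators\<close>

context hilbert_space
begin

abbreviation L where "L \<equiv> bounded_ops H"

lemma op_carrier_iff:
  "T \<in> carrier L \<longleftrightarrow> T \<in> extensional (carrier H) \<and> (\<forall>x\<in>carrier H. T x \<in> carrier H) \<and>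
    (\<forall>x\<in>carrier H. \<forall>y\<in>carrier H. T (x \<oplus> y) = T x \<oplus> T y) \<and>
    (\<forall>c. \<forall>x\<in>carrier H. T (c \<odot> x) = c \<odot> T x) \<and>
    (\<exists>K. \<forall>x\<in>carrier H. hnorm H (T x) \<le> K * hnorm H x)"
  by (auto simp: bounded_ops_def PiE_iff)

lemma op_closed [simp]: "T \<in> carrier L \<Longrightarrow> x \<in> carrier H \<Longrightarrow> T x \<in> carrier H"
  by (simp add: op_carrier_iff)

lemma op_add: "T \<in> carrier L \<Longrightarrow> x \<in> carrier H \<Longrightarrow> y \<in> carrier H \<Longrightarrow> T (x \<oplus> y) = T x \<oplus> T y"
  by (simp add: op_carrier_iff)

lemma op_smult: "T \<in> carrier L \<Longrightarrow> x \<in> carrier H \<Longrightarrow> T (c \<odot> x) = c \<odot> T x"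
  by (simp add: op_carrier_iff)

lemma op_bound:
  assumes "T \<in> carrier L"
  obtains K where "K > 0" "\<And>x. x \<in> carrier H \<Longrightarrow> hnorm H (T x) \<le> K * hnorm H x"
proof -
  obtain K where K: "\<forall>x\<in>carrier H. hnorm H (T x) \<le> K * hnorm H x"
    using assms by (auto simp: op_carrier_iff)
  show ?thesis
  \<comment> \<open>The bound obtained from \<open>bounded_ops\<close> may be zero or negative; a
    positive one can be divided by.\<close>
  proof (rule that[of "\<bar>K\<bar> + 1"])
    fix x assume "x \<in> carrier H"
    then show "hnorm H (T x) \<le> (\<bar>K\<bar> + 1) * hnorm H x"
      using K by (smt (verit) hnorm_nonneg mult_right_mono)
  qed simp
qed

lemma op_eqI:
  assumes "S \<in> carrier L" "T \<in> carrier L" "\<And>x. x \<in> carrier H \<Longrightarrow> S x = T x"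
  shows "S = T"
  using assms by (intro extensionalityI[of S "carrier H"]) (auto simp: op_carrier_iff)

lemma op_eq_hinnerI:
  assumes "S \<in> carrier L" "T \<in> carrier L"
    "\<And>x y. x \<in> carrier H \<Longrightarrow> y \<in> carrier H \<Longrightarrow> hinner H (S x) y = hinner H (T x) y"
  shows "S = T"
  using assms by (intro op_eqI vec_eqI) auto

lemma L_simps [simp]:
  assumes "x \<in> carrier H"
  shows "(S \<otimes>\<^bsub>L\<^esub> T) x = S (T x)" "\<one>\<^bsub>L\<^esub> x = x" "\<zero>\<^bsub>L\<^esub> x = \<zero>"
    "(S \<oplus>\<^bsub>L\<^esub> T) x = S x \<oplus> T x" "(c \<odot>\<^bsub>L\<^esub> T) x = c \<odot> T x"
  using assms by (simp_all add: bounded_ops_def compose_def)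

lemma L_ext:
  "S \<otimes>\<^bsub>L\<^esub> T \<in> extensional (carrier H)" "\<one>\<^bsub>L\<^esub> \<in> extensional (carrier H)"
  "\<zero>\<^bsub>L\<^esub> \<in> extensional (carrier H)" "S \<oplus>\<^bsub>L\<^esub> T \<in> extensional (carrier H)"
  "c \<odot>\<^bsub>L\<^esub> T \<in> extensional (carrier H)"
  by (simp_all add: bounded_ops_def)

lemma L_one_closed: "\<one>\<^bsub>L\<^esub> \<in> carrier L"
  unfolding op_carrier_iff by (auto simp: L_ext intro!: exI[of _ 1])

lemma L_zero_closed: "\<zero>\<^bsub>L\<^esub> \<in> carrier L"
  unfolding op_carrier_iff by (auto simp: L_ext intro!: exI[of _ 0])

lemma L_mult_closed:
  assumes S: "S \<in> carrier L" and T: "T \<in> carrier L"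
  shows "S \<otimes>\<^bsub>L\<^esub> T \<in> carrier L"
proof -
  obtain K where K: "K > 0" "\<And>x. x \<in> carrier H \<Longrightarrow> hnorm H (S x) \<le> K * hnorm H x"
    using op_bound[OF S] by blast
  obtain K' where K': "K' > 0" "\<And>x. x \<in> carrier H \<Longrightarrow> hnorm H (T x) \<le> K' * hnorm H x"
    using op_bound[OF T] by blast
  have "hnorm H (S (T x)) \<le> (K * K') * hnorm H x" if "x \<in> carrier H" for x
    using order_trans[OF K(2)[of "T x"] mult_left_mono[OF K'(2)[OF that], of K]] K(1) T that
    by (simp add: mult.assoc)
  then have "\<exists>K. \<forall>x\<in>carrier H. hnorm H (S (T x)) \<le> K * hnorm H x"
    by blast
  then show ?thesis
    unfolding op_carrier_iff using S T
    by (simp add: L_ext op_add op_smult)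
qed

lemma L_add_closed:
  assumes S: "S \<in> carrier L" and T: "T \<in> carrier L"
  shows "S \<oplus>\<^bsub>L\<^esub> T \<in> carrier L"
proof -
  obtain K where K: "K > 0" "\<And>x. x \<in> carrier H \<Longrightarrow> hnorm H (S x) \<le> K * hnorm H x"
    using op_bound[OF S] by blast
  obtain K' where K': "K' > 0" "\<And>x. x \<in> carrier H \<Longrightarrow> hnorm H (T x) \<le> K' * hnorm H x"
    using op_bound[OF T] by blast
  have "hnorm H (S x \<oplus> T x) \<le> (K + K') * hnorm H x" if "x \<in> carrier H" for x
    using K(2)[OF that] K'(2)[OF that] hnorm_triangle[of "S x" "T x"] S T that
    by (simp add: distrib_right)
  then have "\<exists>K. \<forall>x\<in>carrier H. hnorm H (S x \<oplus> T x) \<le> K * hnorm H x"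
    by blast
  then show ?thesis
    unfolding op_carrier_iff using S T
    by (auto simp: L_ext op_add op_smult hinner_simps distrib_left intro!: vec_eqI)
qed

lemma L_smult_closed:
  assumes T: "T \<in> carrier L"
  shows "c \<odot>\<^bsub>L\<^esub> T \<in> carrier L"
proof -
  obtain K' where K': "K' > 0" "\<And>x. x \<in> carrier H \<Longrightarrow> hnorm H (T x) \<le> K' * hnorm H x"
    using op_bound[OF T] by blast
  have "hnorm H (c \<odot> T x) \<le> (cmod c * K') * hnorm H x" if "x \<in> carrier H" for x
    using mult_left_mono[OF K'(2)[OF that], of "cmod c"] T that by (simp add: hnorm_smult mult.assoc)
  then have "\<exists>K. \<forall>x\<in>carrier H. hnorm H (c \<odot> T x) \<le> K * hnorm H x"
    by blast
  then show ?thesis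
    unfolding op_carrier_iff using T
    by (auto simp: L_ext op_add op_smult hinner_simps distrib_left intro!: vec_eqI)
qed

lemmas L_closed = L_one_closed L_zero_closed L_mult_closed L_add_closed L_smult_closed

sublocale Ops: ring L
proof (intro ringI abelian_groupI monoidI)
  fix S assume "S \<in> carrier L"
  then have "((-1) \<odot>\<^bsub>L\<^esub> S) \<oplus>\<^bsub>L\<^esub> S = \<zero>\<^bsub>L\<^esub>"
    by (intro op_eq_hinnerI) (auto simp: L_closed hinner_simps)
  then show "\<exists>y\<in>carrier L. y \<oplus>\<^bsub>L\<^esub> S = \<zero>\<^bsub>L\<^esub>"
    using \<open>S \<in> carrier L\<close> L_smult_closed by blast
qed (auto simp: L_closed hinner_simps op_add intro!: op_eq_hinnerI)

text \<open>Subtraction in the ring goes through an abstract additive inverse. Identifying that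
  inverse with the multiple by \<open>-1\<close> makes subtraction pointwise.\<close>

lemma L_minus_apply [simp]:
  assumes "S \<in> carrier L" "T \<in> carrier L" "x \<in> carrier H"
  shows "(S \<ominus>\<^bsub>L\<^esub> T) x = S x \<ominus> T x"
proof -
  have "((-1) \<odot>\<^bsub>L\<^esub> T) \<oplus>\<^bsub>L\<^esub> T = \<zero>\<^bsub>L\<^esub>"
    using assms by (intro op_eq_hinnerI) (auto simp: L_closed hinner_simps)
  then have "\<ominus>\<^bsub>L\<^esub> T = (-1) \<odot>\<^bsub>L\<^esub> T"
    using assms by (intro Ops.minus_equality) (auto simp: L_smult_closed)
  then show ?thesis
    using assms by (intro vec_eqI) (auto simp: Ops.minus_eq hinner_simps)
qed

lemma op_diff: "T \<in> carrier L \<Longrightarrow> x \<in> carrier H \<Longrightarrow> y \<in> carrier H \<Longrightarrow> T (x \<ominus> y) = T x \<ominus> T y"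
proof -
  assume *: "T \<in> carrier L" "x \<in> carrier H" "y \<in> carrier H"
  then have "x \<ominus> y = x \<oplus> (-1) \<odot> y" "T x \<ominus> T y = T x \<oplus> (-1) \<odot> T y"
    by (auto intro!: vec_eqI simp: hinner_simps)
  then show ?thesis
    using * by (simp add: op_add op_smult)
qed

lemma scale_zero [simp]: "x \<in> carrier H \<Longrightarrow> 0 \<odot> x = \<zero>"
  using smult_l_null by simp

lemma op_zero: "T \<in> carrier L \<Longrightarrow> T \<zero> = \<zero>"
  using op_smult[of T "\<zero>" 0] by simp

lemma hinner_L_finsum:
  assumes "finite I" "\<And>i. i \<in> I \<Longrightarrow> T i \<in> carrier L" "x \<in> carrier H" "y \<in> carrier H"
  shows "hinner H ((\<Oplus>\<^bsub>L\<^esub>i\<in>I. T i) x) y = (\<Sum>i\<in>I. hinner H (T i x) y)"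
  using assms
proof (induction I)
  case (insert i I)
  then have "(\<Oplus>\<^bsub>L\<^esub>i\<in>I. T i) \<in> carrier L"
    by (intro Ops.finsum_closed) auto
  with insert show ?case
    by (subst Ops.finsum_insert) (auto simp: hinner_simps)
qed simp

lemma hinner_finsum_left:
  assumes "finite I" "\<And>i. i \<in> I \<Longrightarrow> v i \<in> carrier H" "x \<in> carrier H"
  shows "hinner H (\<Oplus>i\<in>I. v i) x = (\<Sum>i\<in>I. hinner H (v i) x)"
  using assms
proof (induction I)
  case (insert i I)
  then have "(\<Oplus>i\<in>I. v i) \<in> carrier H"
    by (intro M.finsum_closed) auto
  with insert show ?case
    by (subst M.finsum_insert) (auto simp: hinner_simps)
qed simp

section \<open>The operator norm\<close>

lemma op_norm_upper:
  assumes "T \<in> carrier L" "x \<in> carrier H" "hnorm H x \<le> 1"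
  shows "hnorm H (T x) \<le> op_norm H T"
proof -
  obtain K where K: "K > 0" "\<And>x. x \<in> carrier H \<Longrightarrow> hnorm H (T x) \<le> K * hnorm H x"
    using op_bound[OF assms(1)] by blast
  have "bdd_above ((\<lambda>x. hnorm H (T x)) ` {x \<in> carrier H. hnorm H x \<le> 1})"
  proof (rule bdd_aboveI2)
    fix x assume "x \<in> {x \<in> carrier H. hnorm H x \<le> 1}"
    then have "x \<in> carrier H" "K * hnorm H x \<le> K * 1"
      using K(1) by auto
    then show "hnorm H (T x) \<le> K"
      using K(2)[of x] by simp
  qed
  then show ?thesis
    unfolding op_norm_def using assms by (intro cSUP_upper) auto
qed

lemma op_norm_le:
  assumes "T \<in> carrier L" "x \<in> carrier H"
  shows "hnorm H (T x) \<le> op_norm H T * hnorm H x"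
proof (cases "hnorm H x = 0")
  case True
  then show ?thesis using assms by (simp add: hnorm_eq_0_iff op_zero)
next
  case False
  then have pos: "hnorm H x > 0" using assms hnorm_nonneg[of x] by linarith
  define y where "y = complex_of_real (1 / hnorm H x) \<odot> x"
  have y: "y \<in> carrier H" "hnorm H y \<le> 1"
    using assms pos by (auto simp: y_def hnorm_smult norm_divide)
  have "hnorm H (T y) \<le> op_norm H T"
    using assms y by (intro op_norm_upper)
  moreover have "hnorm H (T y) = hnorm H (T x) / hnorm H x"
    using assms pos by (simp add: y_def op_smult hnorm_smult norm_divide)
  ultimately show ?thesis
    using pos by (simp add: divide_le_eq)
qed

lemma op_norm_leI:
  assumes "0 \<le> e" "\<And>x. x \<in> carrier H \<Longrightarrow> hnorm H (T x) \<le> e * hnorm H x"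
  shows "op_norm H T \<le> e"
  unfolding op_norm_def
proof (rule cSUP_least)
  show "{x \<in> carrier H. hnorm H x \<le> 1} \<noteq> {}"
    by (auto intro: exI[of _ "\<zero>"])
  fix x assume "x \<in> {x \<in> carrier H. hnorm H x \<le> 1}"
  then show "hnorm H (T x) \<le> e"
    using assms(2)[of x] assms(1) mult_left_mono[of "hnorm H x" 1 e] by simp
qed

lemma op_norm_nonneg: "T \<in> carrier L \<Longrightarrow> 0 \<le> op_norm H T"
  using op_norm_upper[of T "\<zero>"] by (simp add: op_zero)

end

section \<open>Adjoints\<close>

text \<open>The first-order condition at a minimum: for small \<open>t\<close> of sign opposite to
  \<open>b\<close> the linear term would dominate and make the expression negative.\<close>

lemma quadratic_nonneg_imp_linear_zero:
  fixes a b :: real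
  assumes "\<And>t. 0 \<le> a * t\<^sup>2 + 2 * b * t"
  shows "b = 0"
proof (rule ccontr)
  assume b: "b \<noteq> 0"
  \<comment> \<open>Small enough for \<open>a * s \<le> 1\<close>, so that the quadratic term cannot
    make up for the linear one.\<close>
  define s where "s = 1 / (\<bar>a\<bar> + 1)"
  have s: "s > 0" "a * s \<le> 1"
    by (auto simp: s_def divide_simps)
  have "0 \<le> a * (- b * s)\<^sup>2 + 2 * b * (- b * s)"
    by (rule assms)
  also have "\<dots> = (a * s - 2) * (s * b\<^sup>2)"
    by (simp add: power2_eq_square algebra_simps)
  also have "\<dots> < 0"
    using s b by (intro mult_neg_pos) auto
  finally show False by simp
qed

context hilbert_space
begin

text \<open>The representing vector minimises \<open>\<langle>P x, x\<rangle> - 2 Re (\<phi> x)\<close>.\<close>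

lemma coercive_representation:
  fixes \<phi> :: "'a \<Rightarrow> complex"
  assumes P: "P \<in> carrier L"
    and sym: "\<And>x y. x \<in> carrier H \<Longrightarrow> y \<in> carrier H \<Longrightarrow> hinner H (P x) y = hinner H x (P y)"
    and c: "c > 0"
    and coercive: "\<And>x. x \<in> carrier H \<Longrightarrow> c * (hnorm H x)\<^sup>2 \<le> Re (hinner H (P x) x)"
    and add: "\<And>x y. x \<in> carrier H \<Longrightarrow> y \<in> carrier H \<Longrightarrow> \<phi> (x \<oplus> y) = \<phi> x + \<phi> y"
    and scale: "\<And>a x. x \<in> carrier H \<Longrightarrow> \<phi> (a \<odot> x) = a * \<phi> x"
    and bound: "\<And>x. x \<in> carrier H \<Longrightarrow> cmod (\<phi> x) \<le> K * hnorm H x"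
  shows "\<exists>y\<in>carrier H. \<forall>x\<in>carrier H. \<phi> x = hinner H x (P y)"
proof -
  define q where "q x = Re (hinner H (P x) x) - 2 * Re (\<phi> x)" for x
  have "q x \<ge> - (K\<^sup>2 / c)" if x: "x \<in> carrier H" for x
  proof -
    \<comment> \<open>Completing the square: \<open>q x\<close> is at least
      \<open>c * t\<^sup>2 - 2 * K * t\<close> for \<open>t = hnorm H x\<close>.\<close>
    have "0 \<le> (c * hnorm H x - K)\<^sup>2 / c"
      using c by simp
    also have "\<dots> = c * (hnorm H x)\<^sup>2 - 2 * (K * hnorm H x) + K\<^sup>2 / c"
      using c by (simp add: power2_eq_square field_simps)
    finally show ?thesis
      unfolding q_def using coercive[OF x] bound[OF x] complex_Re_le_cmod[of "\<phi> x"] by linarith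
  qed
  then have bdd: "bdd_below (q ` carrier H)"
    by (auto intro!: bdd_belowI2)
  define m where "m = Inf (q ` carrier H)"
  have m_le: "m \<le> q x" if "x \<in> carrier H" for x
    unfolding m_def using that by (intro cINF_lower bdd)
  have "\<exists>x\<in>carrier H. q x < m + 1 / real (Suc k)" for k
  proof (rule ccontr)
    assume "\<not> ?thesis"
    then have "m + 1 / real (Suc k) \<le> m"
      unfolding m_def by (intro cINF_greatest) (auto simp: not_less intro: M.zero_closed)
    then show False by simp
  qed
  then obtain s where s: "\<And>k. s k \<in> carrier H" "\<And>k. q (s k) < m + 1 / real (Suc k)"
    by metis
  \<comment> \<open>The parallelogram identity for the form of \<open>P\<close>. As \<open>q\<close>
    is at least \<open>m\<close> at the midpoint too, two near-minimisers are close to each other,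
    which makes the minimising sequence Cauchy.\<close>
  have midpoint: "c * (hnorm H (x \<ominus> y))\<^sup>2 \<le> 2 * (q x - m) + 2 * (q y - m)"
    if x: "x \<in> carrier H" and y: "y \<in> carrier H" for x y
  proof -
    define z where "z = (1/2) \<odot> (x \<oplus> y)"
    have z: "z \<in> carrier H" using x y by (simp add: z_def)
    have \<phi>z: "\<phi> z = (\<phi> x + \<phi> y) / 2"
      using x y by (simp add: z_def scale add)
    have Pz: "hinner H (P z) z = (hinner H (P x) x + hinner H (P x) y + hinner H (P y) x + hinner H (P y) y) / 4"
      using x y P by (simp add: z_def op_smult op_add hinner_simps add_divide_distrib)
    have Pd: "hinner H (P (x \<ominus> y)) (x \<ominus> y)
        = hinner H (P x) x - hinner H (P x) y - hinner H (P y) x + hinner H (P y) y"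
      using x y P by (simp add: op_diff hinner_simps)
    have "Re (hinner H (P (x \<ominus> y)) (x \<ominus> y)) = 2 * q x + 2 * q y - 4 * q z"
      unfolding q_def Pd Pz \<phi>z by (simp add: field_simps)
    then show ?thesis
      using coercive[of "x \<ominus> y"] m_le[OF z] x y by simp
  qed
  have "\<exists>l\<in>carrier H. (\<lambda>k. hnorm H (s k \<ominus> l)) \<longlonglongrightarrow> 0"
  proof (rule complete)
    show "range s \<subseteq> carrier H" using s by auto
    fix e :: real assume e: "e > 0"
    \<comment> \<open>If both values of \<open>q\<close> exceed \<open>m\<close> by less than
      \<open>1 / real (Suc N)\<close>, then \<open>midpoint\<close> bounds the squared distance by
      \<open>4 / (c * real (Suc N))\<close>.\<close>
    obtain N :: nat where N: "4 / (c * e\<^sup>2) < real N"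
      using reals_Archimedean2 by blast
    have "hnorm H (s i \<ominus> s j) < e" if "i \<ge> N" "j \<ge> N" for i j
    proof -
      have "1 / real (Suc i) \<le> 1 / real (Suc N)" "1 / real (Suc j) \<le> 1 / real (Suc N)"
        using that by (auto simp: field_simps)
      then have "c * (hnorm H (s i \<ominus> s j))\<^sup>2 < 4 / real (Suc N)"
        using midpoint[of "s i" "s j"] s(1) s(2)[of i] s(2)[of j] by simp
      also have "4 / real (Suc N) < c * e\<^sup>2"
        using N c e mult_pos_pos[of c "e\<^sup>2"] by (simp add: field_simps add_strict_increasing)
      finally have "(hnorm H (s i \<ominus> s j))\<^sup>2 < e\<^sup>2"
        using c by simp
      then show ?thesis
        using e by (simp add: power2_less_imp_less)
    qed
    then show "\<exists>N::nat. \<forall>m\<ge>N. \<forall>k\<ge>N. hnorm H (s m \<ominus> s k) < e" by blast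
  qed
  then obtain l where l: "l \<in> carrier H" and sl: "(\<lambda>k. hnorm H (s k \<ominus> l)) \<longlonglongrightarrow> 0"
    by blast
  obtain B where B: "B > 0" "\<And>x. x \<in> carrier H \<Longrightarrow> hnorm H (P x) \<le> B * hnorm H x"
    using op_bound[OF P] by blast
  have "(\<lambda>k. hnorm H (P (s k) \<ominus> P l)) \<longlonglongrightarrow> 0"
  proof (rule Lim_null_comparison)
    show "\<forall>\<^sub>F k in sequentially. norm (hnorm H (P (s k) \<ominus> P l)) \<le> B * hnorm H (s k \<ominus> l)"
      using B(2)[of "s _ \<ominus> l"] s(1) l P by (auto simp: op_diff)
    show "(\<lambda>k. B * hnorm H (s k \<ominus> l)) \<longlonglongrightarrow> 0"
      using tendsto_mult[OF tendsto_const[of B] sl] by simp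
  qed
  then have lim1: "(\<lambda>k. hinner H (P (s k)) (s k)) \<longlonglongrightarrow> hinner H (P l) l"
    using s(1) l P sl by (intro tendsto_hinner) auto
  have lim2: "(\<lambda>k. \<phi> (s k)) \<longlonglongrightarrow> \<phi> l"
  proof (rule LIM_zero_cancel, rule Lim_null_comparison)
    have "s k = (s k \<ominus> l) \<oplus> l" for k
      using s(1) l by (intro vec_eqI) (auto simp: hinner_simps)
    then have "\<phi> (s k) - \<phi> l = \<phi> (s k \<ominus> l)" for k
      using add[of "s k \<ominus> l" l] s(1) l by (metis M.minus_closed add_diff_cancel_right')
    then show "\<forall>\<^sub>F k in sequentially. norm (\<phi> (s k) - \<phi> l) \<le> K * hnorm H (s k \<ominus> l)"
      using bound[of "s _ \<ominus> l"] s(1) l by auto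
    show "(\<lambda>k. K * hnorm H (s k \<ominus> l)) \<longlonglongrightarrow> 0"
      using tendsto_mult[OF tendsto_const[of K] sl] by simp
  qed
  have "(\<lambda>k. q (s k)) \<longlonglongrightarrow> q l"
    unfolding q_def by (intro tendsto_intros lim1 lim2)
  moreover have "(\<lambda>k. m + 1 / real (Suc k)) \<longlonglongrightarrow> m + 0"
    by (intro tendsto_add tendsto_const LIMSEQ_inverse_real_of_nat[unfolded inverse_eq_divide])
  ultimately have "q l \<le> m + 0"
    by (rule LIMSEQ_le) (use s(2) in \<open>auto intro: less_imp_le\<close>)
  then have ql: "q l \<le> q x" if "x \<in> carrier H" for x
    using m_le[OF that] by simp
  \<comment> \<open>The first variation of \<open>q\<close> at its minimiser \<open>l\<close> in the
    direction \<open>x\<close> vanishes. As \<open>q\<close> is real, this compares only real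
    parts.\<close>
  have Re_eq: "Re (\<phi> x) = Re (hinner H x (P l))" if x: "x \<in> carrier H" for x
  proof -
    have "Re (hinner H (P l) x) - Re (\<phi> x) = 0"
    proof (rule quadratic_nonneg_imp_linear_zero)
      fix t :: real
      have lx: "Re (hinner H (P x) l) = Re (hinner H (P l) x)"
        using sym[OF x l] hinner_commute[of x "P l"] x l P by simp
      have "q (l \<oplus> complex_of_real t \<odot> x) = q l + (Re (hinner H (P x) x) * t\<^sup>2 +
          2 * (Re (hinner H (P l) x) - Re (\<phi> x)) * t)"
        unfolding q_def using x l P lx
        by (simp add: op_add op_smult hinner_simps add scale power2_eq_square algebra_simps)
      then show "0 \<le> Re (hinner H (P x) x) * t\<^sup>2 + 2 * (Re (hinner H (P l) x) - Re (\<phi> x)) * t"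
        using ql[of "l \<oplus> complex_of_real t \<odot> x"] x l by simp
    qed
    then show ?thesis
      using hinner_commute[of x "P l"] x l P by simp
  qed
  \<comment> \<open>Applying \<open>Re_eq\<close> to \<open>\<i> \<odot> x\<close> recovers the
    imaginary parts.\<close>
  have "\<phi> x = hinner H x (P l)" if x: "x \<in> carrier H" for x
    using Re_eq[OF x] Re_eq[of "\<i> \<odot> x"] x l P
    by (simp add: scale hinner_simps complex_eq_iff)
  then show ?thesis
    using l by blast
qed

text \<open>Linearity comes from the adjoint relation: \<open>S (x \<oplus> y)\<close> and
  \<open>S x \<oplus> S y\<close> have the same inner product with every vector once
  \<open>S\<close> is moved to the other side as \<open>T\<close>. Maps obtained by choice or as
  pointwise limits are recognised as operators in this way.\<close>

lemma adjoint_opI: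
  assumes "S \<in> extensional (carrier H)"
    and S: "\<And>x. x \<in> carrier H \<Longrightarrow> S x \<in> carrier H" and T: "\<And>x. x \<in> carrier H \<Longrightarrow> T x \<in> carrier H"
    and adj: "\<And>x y. x \<in> carrier H \<Longrightarrow> y \<in> carrier H \<Longrightarrow> hinner H (S x) y = hinner H x (T y)"
    and bound: "\<And>x. x \<in> carrier H \<Longrightarrow> hnorm H (S x) \<le> K * hnorm H x"
  shows "S \<in> carrier L"
  unfolding op_carrier_iff using assms
  by (auto intro!: vec_eqI exI[of _ K] simp: hinner_add_left hinner_smult_left)

text \<open>With the identity for \<open>P\<close> and \<open>c = 1\<close>,
  \<open>coercive_representation\<close> is the Riesz theorem. It is applied to the functional
  \<open>hinner H (T x) y\<close> of \<open>x\<close>, one \<open>y\<close> at a time.\<close>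

lemma adjoint_exists:
  assumes T: "T \<in> carrier L"
  shows "\<exists>S\<in>carrier L. \<forall>x\<in>carrier H. \<forall>y\<in>carrier H. hinner H (T x) y = hinner H x (S y)"
proof -
  obtain K where K: "K > 0" "\<And>x. x \<in> carrier H \<Longrightarrow> hnorm H (T x) \<le> K * hnorm H x"
    using op_bound[OF T] by blast
  have "\<exists>z\<in>carrier H. \<forall>x\<in>carrier H. hinner H (T x) y = hinner H x (\<one>\<^bsub>L\<^esub> z)"
    if y: "y \<in> carrier H" for y
  proof (rule coercive_representation[where c = 1 and K = "K * hnorm H y"])
    show "cmod (hinner H (T x) y) \<le> K * hnorm H y * hnorm H x" if x: "x \<in> carrier H" for x
      using Cauchy_Schwarz[of "T x" y] mult_right_mono[OF K(2)[OF x], of "hnorm H y"] x y T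
      by (simp add: algebra_simps)
  qed (use T y in \<open>auto simp: L_closed op_add op_smult hinner_simps hnorm_power2\<close>)
  then have "\<exists>z. z \<in> carrier H \<and> (\<forall>x\<in>carrier H. hinner H (T x) y = hinner H x z)"
    if "y \<in> carrier H" for y
    using that by fastforce
  then obtain S where S: "\<And>y. y \<in> carrier H \<Longrightarrow> S y \<in> carrier H"
    "\<And>x y. x \<in> carrier H \<Longrightarrow> y \<in> carrier H \<Longrightarrow> hinner H (T x) y = hinner H x (S y)"
    by metis
  have bound: "hnorm H (S y) \<le> K * hnorm H y" if y: "y \<in> carrier H" for y
  proof (cases "hnorm H (S y) = 0")
    case True
    then show ?thesis using K(1) y by simp
  next
    case False
    then have pos: "0 < hnorm H (S y)" using hnorm_nonneg[OF S(1)[OF y]] by linarith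
    have "hnorm H (S y) * hnorm H (S y) = Re (hinner H (T (S y)) y)"
      using S y by (simp add: hnorm_power2 flip: power2_eq_square)
    also have "\<dots> \<le> hnorm H (T (S y)) * hnorm H y"
      using Cauchy_Schwarz[of "T (S y)" y] complex_Re_le_cmod[of "hinner H (T (S y)) y"] S y T by simp
    also have "\<dots> \<le> (K * hnorm H (S y)) * hnorm H y"
      using S y K by (intro mult_right_mono) auto
    finally have "hnorm H (S y) * hnorm H (S y) \<le> (K * hnorm H y) * hnorm H (S y)"
      by (simp add: mult_ac)
    then show ?thesis
      using pos by simp
  qed
  have rev: "hinner H (S x) y = hinner H x (T y)" if "x \<in> carrier H" "y \<in> carrier H" for x y
    by (metis S T hinner_commute op_closed that)
  have "restrict S (carrier H) \<in> carrier L"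
    by (rule adjoint_opI[where T = T and K = K]) (use S(1) T rev bound in auto)
  then show ?thesis
    using S by (auto intro!: bexI[of _ "restrict S (carrier H)"])
qed

lemma adjoint_unique:
  assumes "S \<in> carrier L" "S' \<in> carrier L"
    and "\<And>x y. x \<in> carrier H \<Longrightarrow> y \<in> carrier H \<Longrightarrow> hinner H x (S y) = hinner H x (S' y)"
  shows "S = S'"
  using assms by (intro op_eq_hinnerI) (metis hinner_commute op_closed)+

lemma adj_props:
  assumes T: "T \<in> carrier L"
  shows "adj H T \<in> carrier L \<and> (\<forall>x\<in>carrier H. \<forall>y\<in>carrier H. hinner H (T x) y = hinner H x (adj H T y))"
proof -
  have "\<exists>!S. S \<in> carrier L \<and> (\<forall>x\<in>carrier H. \<forall>y\<in>carrier H. hinner H (T x) y = hinner H x (S y))"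
    using adjoint_exists[OF T] by (auto intro!: adjoint_unique)
  from theI'[OF this] show ?thesis
    unfolding adj_def .
qed

lemma adj_closed [simp]: "T \<in> carrier L \<Longrightarrow> adj H T \<in> carrier L"
  using adj_props by blast

lemma hinner_adj_right:
  "T \<in> carrier L \<Longrightarrow> x \<in> carrier H \<Longrightarrow> y \<in> carrier H \<Longrightarrow> hinner H x (adj H T y) = hinner H (T x) y"
  using adj_props by simp

lemma hinner_adj_left:
  "T \<in> carrier L \<Longrightarrow> x \<in> carrier H \<Longrightarrow> y \<in> carrier H \<Longrightarrow> hinner H (adj H T x) y = hinner H x (T y)"
  by (metis adj_closed hinner_adj_right hinner_commute op_closed)

lemma adj_eqI:
  assumes "T \<in> carrier L" "S \<in> carrier L"
    and "\<And>x y. x \<in> carrier H \<Longrightarrow> y \<in> carrier H \<Longrightarrow> hinner H (T x) y = hinner H x (S y)"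
  shows "adj H T = S"
  using assms by (intro adjoint_unique) (auto simp: hinner_adj_right)

lemma self_adjoint_iff:
  "self_adjoint H T \<longleftrightarrow> T \<in> carrier L \<and>
    (\<forall>x\<in>carrier H. \<forall>y\<in>carrier H. hinner H (T x) y = hinner H x (T y))"
  unfolding self_adjoint_def by (metis adj_eqI hinner_adj_right)

lemma self_adjoint_closed [simp]: "self_adjoint H T \<Longrightarrow> T \<in> carrier L"
  by (simp add: self_adjoint_def)

lemma self_adjointD:
  "self_adjoint H T \<Longrightarrow> x \<in> carrier H \<Longrightarrow> y \<in> carrier H \<Longrightarrow> hinner H (T x) y = hinner H x (T y)"
  by (simp add: self_adjoint_iff)

lemma self_adjoint_Im: "self_adjoint H T \<Longrightarrow> x \<in> carrier H \<Longrightarrow> Im (hinner H (T x) x) = 0"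
  using self_adjointD[of T x x] hinner_commute[of "T x" x] by (auto simp: complex_eq_iff)

end

section \<open>The spectrum of a self-adjoint operator\<close>

context hilbert_space
begin

text \<open>The left and the right inverse may come from different constructions; associativity
  forces them to agree.\<close>

lemma UnitsI:
  assumes "S \<in> carrier L" "R \<in> carrier L" "R' \<in> carrier L"
    and "\<And>x. x \<in> carrier H \<Longrightarrow> R (S x) = x" "\<And>x. x \<in> carrier H \<Longrightarrow> S (R' x) = x"
  shows "S \<in> Units L"
proof -
  have RS: "R \<otimes>\<^bsub>L\<^esub> S = \<one>\<^bsub>L\<^esub>" and SR: "S \<otimes>\<^bsub>L\<^esub> R' = \<one>\<^bsub>L\<^esub>"
    using assms by (auto intro!: op_eqI simp: L_closed)
  then have "R = R'"
    using assms Ops.inv_unique' by (metis Ops.m_assoc Ops.l_one Ops.r_one)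
  then show ?thesis
    using RS SR assms by (auto simp: Units_def)
qed

text \<open>The Lax-Milgram argument: \<open>R y\<close> is the vector that represents the
  functional \<open>hinner H z y\<close> of \<open>z\<close> through the form of \<open>P\<close>.
  Coercivity bounds \<open>R\<close> by \<open>1 / c\<close>, and the symmetry of \<open>P\<close>
  makes \<open>R\<close> symmetric, hence linear and also a left inverse.\<close>

lemma coercive_inverse:
  assumes P: "self_adjoint H P" and c: "c > 0"
    and coercive: "\<And>x. x \<in> carrier H \<Longrightarrow> c * (hnorm H x)\<^sup>2 \<le> Re (hinner H (P x) x)"
  obtains R where "R \<in> carrier L" "\<And>x. x \<in> carrier H \<Longrightarrow> P (R x) = x" "\<And>x. x \<in> carrier H \<Longrightarrow> R (P x) = x"
proof -
  have PL: "P \<in> carrier L" using P by simp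
  have "\<exists>x\<in>carrier H. \<forall>z\<in>carrier H. hinner H z y = hinner H z (P x)" if y: "y \<in> carrier H" for y
    by (rule coercive_representation[OF PL _ c coercive, where K = "hnorm H y"])
      (use P y Cauchy_Schwarz[of _ y] in \<open>auto simp: self_adjointD hinner_simps mult.commute\<close>)
  then obtain R where R: "\<And>y. y \<in> carrier H \<Longrightarrow> R y \<in> carrier H"
    and zR: "\<And>y z. y \<in> carrier H \<Longrightarrow> z \<in> carrier H \<Longrightarrow> hinner H z y = hinner H z (P (R y))"
    by metis
  have PR: "P (R y) = y" if y: "y \<in> carrier H" for y
  proof (rule vec_eqI)
    show "hinner H (P (R y)) z = hinner H y z" if z: "z \<in> carrier H" for z
      using hinner_commute[of "P (R y)" z] hinner_commute[of y z] zR[OF y z] y z R PL by simp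
  qed (use y R PL in auto)
  have sym: "hinner H (R x) y = hinner H x (R y)" if "x \<in> carrier H" "y \<in> carrier H" for x y
    using that PR R P by (metis self_adjointD)
  have bound: "hnorm H (R y) \<le> (1 / c) * hnorm H y" if y: "y \<in> carrier H" for y
  proof (cases "hnorm H (R y) = 0")
    case True
    then show ?thesis using c y by simp
  next
    case False
    then have pos: "0 < hnorm H (R y)" using hnorm_nonneg[OF R[OF y]] by linarith
    have "c * (hnorm H (R y))\<^sup>2 \<le> Re (hinner H y (R y))"
      using coercive[OF R[OF y]] PR[OF y] by simp
    also have "\<dots> \<le> hnorm H y * hnorm H (R y)"
      using Cauchy_Schwarz[OF y R[OF y]] complex_Re_le_cmod[of "hinner H y (R y)"] by linarith
    finally have "(c * hnorm H (R y)) * hnorm H (R y) \<le> hnorm H y * hnorm H (R y)"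
      by (simp add: power2_eq_square mult.assoc)
    then show ?thesis
      using pos c by (simp add: field_simps)
  qed
  show ?thesis
  proof (rule that[of "restrict R (carrier H)"])
    show "restrict R (carrier H) \<in> carrier L"
      by (rule adjoint_opI[where T = R and K = "1 / c"]) (use R sym bound in auto)
    fix x assume x: "x \<in> carrier H"
    show "P (restrict R (carrier H) x) = x"
      using x PR by simp
    have "R (P x) = x"
    proof (rule vec_eqI)
      show "hinner H (R (P x)) z = hinner H x z" if z: "z \<in> carrier H" for z
        using sym[of "P x" z] self_adjointD[OF P x R[OF z]] PR[OF z] x z PL by simp
    qed (use x R PL in auto)
    then show "restrict R (carrier H) (P x) = x"
      using x PL by simp
  qed
qed

text \<open>The adjoint enters as a given map \<open>S'\<close>, because for a shift
  \<open>z - T\<close> it is explicitly the shift \<open>cnj z - T\<close>.\<close>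

lemma self_adjoint_square:
  assumes "S \<in> carrier L" "S' \<in> carrier L"
    and "\<And>x y. x \<in> carrier H \<Longrightarrow> y \<in> carrier H \<Longrightarrow> hinner H (S x) y = hinner H x (S' y)"
  shows "self_adjoint H (S' \<otimes>\<^bsub>L\<^esub> S)"
  unfolding self_adjoint_iff
proof (intro conjI ballI)
  have swap: "hinner H (S' x) y = hinner H x (S y)" if "x \<in> carrier H" "y \<in> carrier H" for x y
    using assms that by (metis hinner_commute op_closed)
  fix x y assume "x \<in> carrier H" "y \<in> carrier H"
  then show "hinner H ((S' \<otimes>\<^bsub>L\<^esub> S) x) y = hinner H x ((S' \<otimes>\<^bsub>L\<^esub> S) y)"
    using assms by (simp add: swap)
qed (use assms L_closed in auto)

text \<open>The lower bounds make \<open>S' S\<close> and \<open>S S'\<close> coercive with constant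
  \<open>c\<^sup>2\<close>, hence invertible. Then \<open>(S' S)\<^sup>-\<^sup>1 S'\<close> is a
  left inverse of \<open>S\<close> and \<open>S' (S S')\<^sup>-\<^sup>1\<close> a right
  inverse.\<close>

lemma bounded_below_Units:
  assumes S: "S \<in> carrier L" and S': "S' \<in> carrier L"
    and adj: "\<And>x y. x \<in> carrier H \<Longrightarrow> y \<in> carrier H \<Longrightarrow> hinner H (S x) y = hinner H x (S' y)"
    and c: "c > 0"
    and below: "\<And>x. x \<in> carrier H \<Longrightarrow> c * hnorm H x \<le> hnorm H (S x)"
    and below': "\<And>x. x \<in> carrier H \<Longrightarrow> c * hnorm H x \<le> hnorm H (S' x)"
  shows "S \<in> Units L"
proof -
  have swap: "hinner H (S' x) y = hinner H x (S y)" if "x \<in> carrier H" "y \<in> carrier H" for x y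
    using assms that by (metis hinner_commute op_closed)
  have square: "c\<^sup>2 * (hnorm H x)\<^sup>2 \<le> Re (hinner H (T x) (T x))"
    if "x \<in> carrier H" "T \<in> carrier L" "c * hnorm H x \<le> hnorm H (T x)" for x T
  proof -
    have "c\<^sup>2 * (hnorm H x)\<^sup>2 \<le> (hnorm H (T x))\<^sup>2"
      using that c power_mono[OF that(3), of 2] by (simp add: power_mult_distrib)
    then show ?thesis
      using that by (simp only: hnorm_power2[OF op_closed])
  qed
  have c2: "c\<^sup>2 > 0" using c by simp
  obtain R where R: "R \<in> carrier L" "\<And>x. x \<in> carrier H \<Longrightarrow> R ((S' \<otimes>\<^bsub>L\<^esub> S) x) = x"
    by (rule coercive_inverse[OF self_adjoint_square[OF S S' adj] c2])
      (use S S' swap square below in auto)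
  obtain R' where R': "R' \<in> carrier L" "\<And>x. x \<in> carrier H \<Longrightarrow> (S \<otimes>\<^bsub>L\<^esub> S') (R' x) = x"
    by (rule coercive_inverse[OF self_adjoint_square[OF S' S swap] c2])
      (use S S' adj square below' in auto)
  show ?thesis
    by (rule UnitsI[of S "R \<otimes>\<^bsub>L\<^esub> S'" "S' \<otimes>\<^bsub>L\<^esub> R'"]) (use S S' R R' in \<open>auto simp: L_closed\<close>)
qed

lemma Units_bounded_below:
  assumes "S \<in> Units L"
  obtains c where "c > 0" "\<And>x. x \<in> carrier H \<Longrightarrow> c * hnorm H x \<le> hnorm H (S x)"
proof -
  obtain R where R: "R \<in> carrier L" "R \<otimes>\<^bsub>L\<^esub> S = \<one>\<^bsub>L\<^esub>" and S: "S \<in> carrier L"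
    using assms by (auto simp: Units_def)
  obtain K where K: "K > 0" "\<And>x. x \<in> carrier H \<Longrightarrow> hnorm H (R x) \<le> K * hnorm H x"
    using op_bound[OF R(1)] by blast
  show ?thesis
  proof (rule that[of "1 / K"])
    fix x assume x: "x \<in> carrier H"
    have "R (S x) = x"
      using R(2) x L_simps(1)[OF x, of R S] by simp
    then show "1 / K * hnorm H x \<le> hnorm H (S x)"
      using K(1) K(2)[of "S x"] x S by (simp add: field_simps)
  qed (use K in simp)
qed

lemma shift_closed: "T \<in> carrier L \<Longrightarrow> z \<odot>\<^bsub>L\<^esub> \<one>\<^bsub>L\<^esub> \<ominus>\<^bsub>L\<^esub> T \<in> carrier L"
  by (simp add: L_closed)

lemma shift_apply [simp]:
  "T \<in> carrier L \<Longrightarrow> x \<in> carrier H \<Longrightarrow> (z \<odot>\<^bsub>L\<^esub> \<one>\<^bsub>L\<^esub> \<ominus>\<^bsub>L\<^esub> T) x = z \<odot> x \<ominus> T x"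
  by (simp add: L_closed)

lemma shift_adjoint:
  assumes "self_adjoint H T" "x \<in> carrier H" "y \<in> carrier H"
  shows "hinner H ((z \<odot>\<^bsub>L\<^esub> \<one>\<^bsub>L\<^esub> \<ominus>\<^bsub>L\<^esub> T) x) y = hinner H x ((cnj z \<odot>\<^bsub>L\<^esub> \<one>\<^bsub>L\<^esub> \<ominus>\<^bsub>L\<^esub> T) y)"
  using assms by (simp add: hinner_simps self_adjointD)

text \<open>For real \<open>r\<close> the shift is its own adjoint, so a single lower bound serves
  both sides of \<open>bounded_below_Units\<close>.\<close>

lemma not_in_spectrumI:
  assumes T: "self_adjoint H T" and c: "c > 0"
    and below: "\<And>x. x \<in> carrier H \<Longrightarrow> c * hnorm H x \<le> hnorm H (complex_of_real r \<odot> x \<ominus> T x)"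
  shows "complex_of_real r \<notin> op_spectrum H T"
proof -
  have "complex_of_real r \<odot>\<^bsub>L\<^esub> \<one>\<^bsub>L\<^esub> \<ominus>\<^bsub>L\<^esub> T \<in> Units L"
    by (rule bounded_below_Units[OF shift_closed shift_closed shift_adjoint[OF T] c])
      (use T below in auto)
  then show ?thesis
    by (simp add: op_spectrum_def)
qed

text \<open>The inner product of \<open>T x\<close> and \<open>x\<close> is real, so the cross term
  between the shift by \<open>Re z\<close> and the imaginary multiple of \<open>x\<close> has real
  part zero.\<close>

lemma hnorm_shift_power2:
  assumes T: "self_adjoint H T" and x: "x \<in> carrier H"
  shows "(hnorm H (z \<odot> x \<ominus> T x))\<^sup>2 =
    (hnorm H (complex_of_real (Re z) \<odot> x \<ominus> T x))\<^sup>2 + (Im z)\<^sup>2 * (hnorm H x)\<^sup>2"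
proof -
  have xT: "hinner H x (T x) = hinner H (T x) x"
    using self_adjointD[OF T x x] by simp
  have Im: "Im (hinner H (T x) x) = 0" "Im (hinner H x x) = 0"
    using self_adjoint_Im[OF T x] hinner_self_eq[OF x] by simp_all
  show ?thesis
    using T x by (simp add: hnorm_power2 hinner_simps xT Im) (simp add: power2_eq_square algebra_simps)
qed

text \<open>For nonreal \<open>z\<close> both \<open>z - T\<close> and its adjoint
  \<open>cnj z - T\<close> are bounded below by \<open>\<bar>Im z\<bar>\<close>.\<close>

lemma spectrum_real:
  assumes T: "self_adjoint H T" and z: "z \<in> op_spectrum H T"
  shows "z = complex_of_real (Re z)"
proof (rule ccontr)
  assume "z \<noteq> complex_of_real (Re z)"
  then have Im: "\<bar>Im z\<bar> > 0" by (auto simp: complex_eq_iff)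
  have below: "\<bar>Im z\<bar> * hnorm H x \<le> hnorm H (w \<odot> x \<ominus> T x)"
    if x: "x \<in> carrier H" and w: "\<bar>Im w\<bar> = \<bar>Im z\<bar>" for x w
  proof (rule power2_le_imp_le)
    have "(\<bar>Im z\<bar> * hnorm H x)\<^sup>2 = (Im w)\<^sup>2 * (hnorm H x)\<^sup>2"
      using w by (metis power2_abs power_mult_distrib)
    then show "(\<bar>Im z\<bar> * hnorm H x)\<^sup>2 \<le> (hnorm H (w \<odot> x \<ominus> T x))\<^sup>2"
      using hnorm_shift_power2[OF T x, of w] by simp
  qed (use x T in simp)
  have "z \<odot>\<^bsub>L\<^esub> \<one>\<^bsub>L\<^esub> \<ominus>\<^bsub>L\<^esub> T \<in> Units L"
    by (rule bounded_below_Units[OF shift_closed shift_closed shift_adjoint[OF T] Im])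
      (use T below in auto)
  then show False
    using z by (simp add: op_spectrum_def)
qed

text \<open>The Loewner bounds \<open>a \<le> T \<le> b\<close>. They make sense for
  \<open>a > b\<close> as well, where they hold only on the trivial space.\<close>

definition form_bounded :: "real \<Rightarrow> real \<Rightarrow> ('a \<Rightarrow> 'a) \<Rightarrow> bool" where
  "form_bounded a b T \<longleftrightarrow> (\<forall>x\<in>carrier H.
    a * (hnorm H x)\<^sup>2 \<le> Re (hinner H (T x) x) \<and> Re (hinner H (T x) x) \<le> b * (hnorm H x)\<^sup>2)"

text \<open>If \<open>r\<close> lies outside \<open>{a..b}\<close>, the form of \<open>r - T\<close>
  at \<open>x\<close> is in absolute value at least a positive multiple of
  \<open>(hnorm H x)\<^sup>2\<close>. By Cauchy-Schwarz \<open>r - T\<close> is then bounded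
  below.\<close>

lemma form_bounded_spectrum:
  assumes T: "self_adjoint H T" and fb: "form_bounded a b T"
  shows "op_spectrum H T \<subseteq> complex_of_real ` {a..b}"
proof
  fix z assume z: "z \<in> op_spectrum H T"
  define r where "r = Re z"
  have zr: "z = complex_of_real r"
    using spectrum_real[OF T z] by (simp add: r_def)
  have key: False if c: "c > 0" and
    le: "\<And>x. x \<in> carrier H \<Longrightarrow> c * (hnorm H x)\<^sup>2 \<le> \<bar>Re (hinner H (complex_of_real r \<odot> x \<ominus> T x) x)\<bar>" for c
  proof -
    have "c * hnorm H x \<le> hnorm H (complex_of_real r \<odot> x \<ominus> T x)" if x: "x \<in> carrier H" for x
    proof (cases "hnorm H x = 0")
      case True
      then show ?thesis using x T by simp
    next
      case False
      then have pos: "0 < hnorm H x" using hnorm_nonneg[OF x] by linarith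
      have "c * (hnorm H x)\<^sup>2 \<le> hnorm H (complex_of_real r \<odot> x \<ominus> T x) * hnorm H x"
        using le[OF x] Cauchy_Schwarz[of "complex_of_real r \<odot> x \<ominus> T x" x] x T
          abs_Re_le_cmod[of "hinner H (complex_of_real r \<odot> x \<ominus> T x) x"] by simp
      then show ?thesis
        using pos by (simp add: power2_eq_square flip: mult.assoc)
    qed
    then show False
      using not_in_spectrumI[OF T c] z zr by blast
  qed
  have eq: "Re (hinner H (complex_of_real r \<odot> x \<ominus> T x) x) = r * (hnorm H x)\<^sup>2 - Re (hinner H (T x) x)"
    if "x \<in> carrier H" for x
    using that T by (simp add: hinner_simps hnorm_power2)
  have "r \<le> b"
  proof (rule ccontr)
    assume "\<not> r \<le> b"
    moreover have "(r - b) * (hnorm H x)\<^sup>2 \<le> \<bar>Re (hinner H (complex_of_real r \<odot> x \<ominus> T x) x)\<bar>"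
      if "x \<in> carrier H" for x
      using fb that eq[OF that] unfolding form_bounded_def by (fastforce simp: left_diff_distrib)
    ultimately show False
      using key[of "r - b"] by simp
  qed
  moreover have "a \<le> r"
  proof (rule ccontr)
    assume "\<not> a \<le> r"
    moreover have "(a - r) * (hnorm H x)\<^sup>2 \<le> \<bar>Re (hinner H (complex_of_real r \<odot> x \<ominus> T x) x)\<bar>"
      if "x \<in> carrier H" for x
      using fb that eq[OF that] unfolding form_bounded_def by (fastforce simp: left_diff_distrib)
    ultimately show False
      using key[of "a - r"] by simp
  qed
  ultimately show "z \<in> complex_of_real ` {a..b}"
    using zr by auto
qed

text \<open>
  If \<open>m = \<parallel>S\<parallel>\<close> and both \<open>m - S\<close> and \<open>-m - S\<close> are invertible, then \<open>S\<^sup>2 - m\<^sup>2\<close> is bounded below, which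
  keeps \<open>\<parallel>S x\<parallel> / \<parallel>x\<parallel>\<close> away from \<open>m\<close>.
\<close>

lemma op_norm_in_spectrum:
  assumes S: "self_adjoint H S" and pos: "op_norm H S > 0"
  shows "complex_of_real (op_norm H S) \<in> op_spectrum H S \<or>
    complex_of_real (- op_norm H S) \<in> op_spectrum H S"
proof (rule ccontr)
  define m where "m = op_norm H S"
  have m: "m > 0" using pos by (simp add: m_def)
  have SL: "S \<in> carrier L" using S by simp
  assume "\<not> ?thesis"
  then have U1: "complex_of_real m \<odot>\<^bsub>L\<^esub> \<one>\<^bsub>L\<^esub> \<ominus>\<^bsub>L\<^esub> S \<in> Units L"
    and U2: "complex_of_real (- m) \<odot>\<^bsub>L\<^esub> \<one>\<^bsub>L\<^esub> \<ominus>\<^bsub>L\<^esub> S \<in> Units L"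
    by (auto simp: op_spectrum_def m_def)
  obtain c1 where c1: "c1 > 0"
    "\<And>x. x \<in> carrier H \<Longrightarrow> c1 * hnorm H x \<le> hnorm H ((complex_of_real m \<odot>\<^bsub>L\<^esub> \<one>\<^bsub>L\<^esub> \<ominus>\<^bsub>L\<^esub> S) x)"
    using Units_bounded_below[OF U1] by blast
  obtain c2 where c2: "c2 > 0"
    "\<And>x. x \<in> carrier H \<Longrightarrow> c2 * hnorm H x \<le> hnorm H ((complex_of_real (- m) \<odot>\<^bsub>L\<^esub> \<one>\<^bsub>L\<^esub> \<ominus>\<^bsub>L\<^esub> S) x)"
    using Units_bounded_below[OF U2] by blast
  \<comment> \<open>A lower bound for the product of \<open>m - S\<close> and
    \<open>- m - S\<close>, which is \<open>S\<^sup>2 - m\<^sup>2\<close>.\<close>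
  define c where "c = c1 * c2"
  have c: "c > 0" using c1 c2 by (simp add: c_def)
  have main: "(hnorm H (S x))\<^sup>2 \<le> (m\<^sup>2 - (c / m)\<^sup>2) * (hnorm H x)\<^sup>2" if x: "x \<in> carrier H" for x
  proof -
    define w where "w = complex_of_real (- m) \<odot> x \<ominus> S x"
    have w: "w \<in> carrier H" using x SL by (simp add: w_def)
    have "c * hnorm H x \<le> c1 * hnorm H w"
      using c2(2)[OF x] c1(1) x SL by (simp add: c_def w_def)
    also have "\<dots> \<le> hnorm H (complex_of_real m \<odot> w \<ominus> S w)"
      using c1(2)[OF w] w SL by simp
    also have "complex_of_real m \<odot> w \<ominus> S w = S (S x) \<ominus> complex_of_real (m\<^sup>2) \<odot> x"
      unfolding w_def using x SL
      by (intro vec_eqI) (simp_all add: op_diff op_smult hinner_simps power2_eq_square algebra_simps)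
    finally have "(c * hnorm H x)\<^sup>2 \<le> (hnorm H (S (S x) \<ominus> complex_of_real (m\<^sup>2) \<odot> x))\<^sup>2"
      using c x by (intro power_mono) auto
    also have "\<dots> = (hnorm H (S (S x)))\<^sup>2 - 2 * m\<^sup>2 * (hnorm H (S x))\<^sup>2 + m\<^sup>2 * m\<^sup>2 * (hnorm H x)\<^sup>2"
    proof -
      have 1: "hinner H (S (S x)) x = hinner H (S x) (S x)" "hinner H x (S (S x)) = hinner H (S x) (S x)"
        using S x SL by (auto simp: self_adjointD)
      show ?thesis
        using x SL by (simp add: hnorm_power2 hinner_simps 1 algebra_simps)
    qed
    \<comment> \<open>This absorbs the term with \<open>S (S x)\<close>. What remains bounds
      \<open>(hnorm H (S x))\<^sup>2\<close> with a gain of \<open>(c / m)\<^sup>2\<close> over the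
      trivial constant \<open>m\<^sup>2\<close>.\<close>
    also have "(hnorm H (S (S x)))\<^sup>2 \<le> (m * hnorm H (S x))\<^sup>2"
      using op_norm_le[OF SL, of "S x"] x SL by (intro power_mono) (auto simp: m_def)
    finally have "c\<^sup>2 * (hnorm H x)\<^sup>2 + m\<^sup>2 * (hnorm H (S x))\<^sup>2 \<le> m\<^sup>2 * m\<^sup>2 * (hnorm H x)\<^sup>2"
      by (simp add: power_mult_distrib)
    then have "m\<^sup>2 * (hnorm H (S x))\<^sup>2 \<le> m\<^sup>2 * ((m\<^sup>2 - (c / m)\<^sup>2) * (hnorm H x)\<^sup>2)"
      using m by (simp add: algebra_simps power_divide)
    then show ?thesis
      using m by simp
  qed
  \<comment> \<open>By \<open>main\<close>, \<open>e\<close> is a bound for the norm of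
    \<open>S\<close>, and it is smaller than \<open>m\<close>. The \<open>max\<close> keeps the
    radicand nonnegative.\<close>
  define e where "e = sqrt (max 0 (m\<^sup>2 - (c / m)\<^sup>2))"
  have "hnorm H (S x) \<le> e * hnorm H x" if x: "x \<in> carrier H" for x
  proof (rule power2_le_imp_le)
    have "(hnorm H (S x))\<^sup>2 \<le> max 0 (m\<^sup>2 - (c / m)\<^sup>2) * (hnorm H x)\<^sup>2"
      using main[OF x] by (smt (verit) mult_right_mono zero_le_power2)
    then show "(hnorm H (S x))\<^sup>2 \<le> (e * hnorm H x)\<^sup>2"
      by (simp add: e_def power_mult_distrib)
  qed (use x in \<open>simp add: e_def\<close>)
  then have "m \<le> e"
    unfolding m_def by (intro op_norm_leI) (auto simp: e_def)
  moreover have "e < m"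
    unfolding e_def using m c by (intro real_less_lsqrt) auto
  ultimately show False by simp
qed

text \<open>If the norm is positive, \<open>op_norm_in_spectrum\<close> supplies a point. If it is
  zero, \<open>T\<close> kills \<open>x\<close>, so \<open>0\<close> is in the spectrum.\<close>

lemma spectrum_nonempty:
  assumes T: "self_adjoint H T" and nontriv: "x \<in> carrier H" "x \<noteq> \<zero>"
  obtains r where "complex_of_real r \<in> op_spectrum H T"
proof (cases "op_norm H T > 0")
  case True
  then show ?thesis using op_norm_in_spectrum[OF T] that by blast
next
  case False
  then have "op_norm H T = 0" using op_norm_nonneg[of T] T by simp
  then have "hnorm H (T x) \<le> 0" using op_norm_le[of T x] T nontriv by simp
  moreover have "0 \<le> hnorm H (T x)" using T nontriv by simp
  ultimately have "T x = \<zero>" using hnorm_eq_0_iff[of "T x"] T nontriv by simp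
  have "complex_of_real 0 \<odot>\<^bsub>L\<^esub> \<one>\<^bsub>L\<^esub> \<ominus>\<^bsub>L\<^esub> T \<notin> Units L"
  proof
    assume "complex_of_real 0 \<odot>\<^bsub>L\<^esub> \<one>\<^bsub>L\<^esub> \<ominus>\<^bsub>L\<^esub> T \<in> Units L"
    then obtain c where c: "c > 0"
      "\<And>x. x \<in> carrier H \<Longrightarrow> c * hnorm H x \<le> hnorm H ((complex_of_real 0 \<odot>\<^bsub>L\<^esub> \<one>\<^bsub>L\<^esub> \<ominus>\<^bsub>L\<^esub> T) x)"
      using Units_bounded_below by blast
    have "\<zero> \<ominus> \<zero> = \<zero>" by (intro vec_eqI) (auto simp: hinner_simps)
    then have "c * hnorm H x \<le> 0"
      using c(2)[of x] nontriv T \<open>T x = \<zero>\<close> by simp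
    moreover have "0 < hnorm H x"
      using nontriv hnorm_eq_0_iff[of x] hnorm_nonneg[of x] by linarith
    ultimately show False
      using c(1) by (simp add: mult_le_0_iff)
  qed
  then show ?thesis
    using that[of 0] by (simp add: op_spectrum_def)
qed

end

section \<open>Polynomials in an operator\<close>

lemma map_poly_of_real_mult:
  "map_poly complex_of_real (p * q) = map_poly complex_of_real p * map_poly complex_of_real q"
  by (intro poly_eqI) (simp add: coeff_map_poly coeff_mult)

lemma map_poly_of_real_diff:
  "map_poly complex_of_real (p - q) = map_poly complex_of_real p - map_poly complex_of_real q"
  by (intro poly_eqI) (simp add: coeff_map_poly)

lemma poly_map_poly_of_real: "poly (map_poly complex_of_real p) (complex_of_real x) = complex_of_real (poly p x)"
  by (induction p) (auto simp: map_poly_pCons)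

context hilbert_space
begin

text \<open>Complex coefficients allow a polynomial to be split into linear factors, as
  \<open>cpoly_Units\<close> does.\<close>

definition cpoly :: "complex poly \<Rightarrow> ('a \<Rightarrow> 'a) \<Rightarrow> 'a \<Rightarrow> 'a" where
  "cpoly q T = (\<Oplus>\<^bsub>L\<^esub>k\<in>{..degree q}. coeff q k \<odot>\<^bsub>L\<^esub> (T [^]\<^bsub>L\<^esub> k))"

lemma cpoly_closed [simp]: "T \<in> carrier L \<Longrightarrow> cpoly q T \<in> carrier L"
  unfolding cpoly_def by (intro Ops.finsum_closed) (auto simp: L_smult_closed)

lemma op_poly_eq_cpoly: "op_poly H p T = cpoly (map_poly complex_of_real p) T"
  unfolding op_poly_def cpoly_def by (simp add: degree_map_poly coeff_map_poly)

lemma op_poly_closed [simp]: "T \<in> carrier L \<Longrightarrow> op_poly H p T \<in> carrier L"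
  by (simp add: op_poly_eq_cpoly)

text \<open>The range of summation may exceed the degree, so that polynomials of different degrees
  can be expanded over a common range.\<close>

lemma hinner_cpoly:
  assumes T: "T \<in> carrier L" and x: "x \<in> carrier H" "y \<in> carrier H" and n: "degree q \<le> n"
  shows "hinner H (cpoly q T x) y = (\<Sum>k\<le>n. coeff q k * hinner H ((T [^]\<^bsub>L\<^esub> k) x) y)"
proof -
  have "hinner H (cpoly q T x) y = (\<Sum>k\<le>degree q. coeff q k * hinner H ((T [^]\<^bsub>L\<^esub> k) x) y)"
    unfolding cpoly_def using assms
    by (subst hinner_L_finsum) (auto simp: L_smult_closed hinner_simps)
  also have "\<dots> = (\<Sum>k\<le>n. coeff q k * hinner H ((T [^]\<^bsub>L\<^esub> k) x) y)"
    using n by (intro sum.mono_neutral_left) (auto simp: coeff_eq_0)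
  finally show ?thesis .
qed

lemma cpoly_0: "T \<in> carrier L \<Longrightarrow> x \<in> carrier H \<Longrightarrow> cpoly 0 T x = \<zero>"
  by (intro vec_eqI) (auto simp: hinner_cpoly[where n = 0])

text \<open>Horner's rule, the recursion behind the inductions over polynomials below.\<close>

lemma cpoly_pCons:
  assumes T: "T \<in> carrier L" and x: "x \<in> carrier H"
  shows "cpoly (pCons a q) T x = a \<odot> x \<oplus> cpoly q T (T x)"
proof (rule vec_eqI)
  fix y assume y: "y \<in> carrier H"
  show "hinner H (cpoly (pCons a q) T x) y = hinner H (a \<odot> x \<oplus> cpoly q T (T x)) y"
    using T x y
    by (simp add: hinner_simps hinner_cpoly[where n = "Suc (degree q)" and q = "pCons a q"]
        hinner_cpoly[where n = "degree q" and q = q] sum.atMost_Suc_shift degree_pCons_le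
        del: sum.atMost_Suc)
qed (use T x in auto)

lemma cpoly_add:
  assumes T: "T \<in> carrier L" and x: "x \<in> carrier H"
  shows "cpoly (p + q) T x = cpoly p T x \<oplus> cpoly q T x"
proof (rule vec_eqI)
  define n where "n = max (degree p) (degree q)"
  fix y assume y: "y \<in> carrier H"
  have "degree (p + q) \<le> n" "degree p \<le> n" "degree q \<le> n"
    by (auto simp: n_def degree_add_le_max)
  then show "hinner H (cpoly (p + q) T x) y = hinner H (cpoly p T x \<oplus> cpoly q T x) y"
    using T x y by (simp add: hinner_simps hinner_cpoly[where n = n] distrib_right sum.distrib)
qed (use T x in auto)

lemma cpoly_smult:
  assumes T: "T \<in> carrier L" and x: "x \<in> carrier H"
  shows "cpoly (Polynomial.smult c p) T x = c \<odot> cpoly p T x"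
proof (rule vec_eqI)
  fix y assume y: "y \<in> carrier H"
  show "hinner H (cpoly (Polynomial.smult c p) T x) y = hinner H (c \<odot> cpoly p T x) y"
    using T x y
    by (simp add: hinner_simps hinner_cpoly[where n = "degree p"] degree_smult_le sum_distrib_left mult.assoc)
qed (use T x in auto)

lemma cpoly_diff:
  assumes T: "T \<in> carrier L" and x: "x \<in> carrier H"
  shows "cpoly (p - q) T x = cpoly p T x \<ominus> cpoly q T x"
proof (rule vec_eqI)
  fix y assume y: "y \<in> carrier H"
  have "cpoly (p - q) T x = cpoly p T x \<oplus> (-1) \<odot> cpoly q T x"
    using cpoly_add[OF T x, of p "Polynomial.smult (-1) q"] cpoly_smult[OF T x, of "-1" q] by simp
  then show "hinner H (cpoly (p - q) T x) y = hinner H (cpoly p T x \<ominus> cpoly q T x) y"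
    using T x y by (simp add: hinner_simps)
qed (use T x in auto)

lemma cpoly_commute:
  assumes T: "T \<in> carrier L" and x: "x \<in> carrier H"
  shows "T (cpoly q T x) = cpoly q T (T x)"
  using x
proof (induction q arbitrary: x)
  case 0
  then show ?case using T by (simp add: cpoly_0 op_zero)
next
  case (pCons a q)
  then show ?case using T by (simp add: cpoly_pCons op_add op_smult)
qed

lemma cpoly_mult:
  assumes T: "T \<in> carrier L" and x: "x \<in> carrier H"
  shows "cpoly (p * q) T x = cpoly p T (cpoly q T x)"
  using x
proof (induction p arbitrary: x)
  case 0
  then show ?case using T by (simp add: cpoly_0)
next
  case (pCons a p)
  then show ?case using T
    by (simp add: mult_pCons_left cpoly_add cpoly_smult cpoly_pCons cpoly_commute)
qed

lemma op_poly_mult: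
  "T \<in> carrier L \<Longrightarrow> x \<in> carrier H \<Longrightarrow> op_poly H (p * q) T x = op_poly H p T (op_poly H q T x)"
  by (simp add: op_poly_eq_cpoly map_poly_of_real_mult cpoly_mult)

lemma op_poly_diff:
  "T \<in> carrier L \<Longrightarrow> x \<in> carrier H \<Longrightarrow> op_poly H (p - q) T x = op_poly H p T x \<ominus> op_poly H q T x"
  by (simp add: op_poly_eq_cpoly map_poly_of_real_diff cpoly_diff)

lemma self_adjoint_op_poly:
  assumes T: "self_adjoint H T"
  shows "self_adjoint H (op_poly H p T)"
  unfolding self_adjoint_iff
proof (intro conjI ballI)
  have TL: "T \<in> carrier L" using T by simp
  fix x y assume xy: "x \<in> carrier H" "y \<in> carrier H"
  then show "hinner H (op_poly H p T x) y = hinner H x (op_poly H p T y)"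
  proof (induction p arbitrary: x y)
    case 0
    then show ?case using TL by (simp add: op_poly_eq_cpoly cpoly_0)
  next
    case (pCons a p)
    then show ?case using TL
      by (simp add: op_poly_eq_cpoly map_poly_pCons cpoly_pCons hinner_simps self_adjointD[OF T]
          flip: cpoly_commute)
  qed
qed (use T in simp)

text \<open>Split off a linear factor at a complex root and recurse; a product of units is a unit.
  This yields one half of spectral mapping: every spectral value of \<open>q(T)\<close> is a value
  of \<open>q\<close> on the spectrum of \<open>T\<close>.\<close>

lemma cpoly_Units:
  assumes T: "T \<in> carrier L" and "q \<noteq> 0" and "\<And>z. poly q z = 0 \<Longrightarrow> z \<notin> op_spectrum H T"
  shows "cpoly q T \<in> Units L"
  using assms(2-)
proof (induction "degree q" arbitrary: q)
  case 0
  then obtain a where q: "q = [:a:]" by (metis degree_eq_zeroE)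
  with 0 have "a \<noteq> 0" by simp
  show ?case
  proof (rule UnitsI)
    show "cpoly q T (cpoly [:1/a:] T x) = x" "cpoly [:1/a:] T (cpoly q T x) = x" if "x \<in> carrier H" for x
      using that T \<open>a \<noteq> 0\<close>
      by (auto simp: q cpoly_pCons cpoly_0 hinner_simps intro!: vec_eqI)
  qed (use T in auto)
next
  case (Suc n)
  have "\<not> constant (poly q)"
    using Suc.hyps by (simp add: constant_degree)
  then obtain z where z: "poly q z = 0"
    using fundamental_theorem_of_algebra by blast
  then obtain r where "q = [:- z, 1:] * r"
    by (auto simp: poly_eq_0_iff_dvd)
  \<comment> \<open>The sign is moved so that the linear factor becomes \<open>z - T\<close>, the
    form in which the spectrum is defined.\<close>
  then have r: "q = [:z, -1:] * (- r)"
    by simp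
  have "r \<noteq> 0" using r Suc.prems by auto
  then have "degree q = Suc (degree r)"
    unfolding r by (subst degree_mult_eq) auto
  then have "cpoly (- r) T \<in> Units L"
    using Suc \<open>r \<noteq> 0\<close> r by (intro Suc.hyps) auto
  moreover have "z \<odot>\<^bsub>L\<^esub> \<one>\<^bsub>L\<^esub> \<ominus>\<^bsub>L\<^esub> T \<in> Units L"
    using Suc.prems z by (auto simp: op_spectrum_def)
  moreover have "cpoly q T = (z \<odot>\<^bsub>L\<^esub> \<one>\<^bsub>L\<^esub> \<ominus>\<^bsub>L\<^esub> T) \<otimes>\<^bsub>L\<^esub> cpoly (- r) T"
  proof (rule op_eq_hinnerI)
    fix x y assume "x \<in> carrier H" "y \<in> carrier H"
    then show "hinner H (cpoly q T x) y = hinner H (((z \<odot>\<^bsub>L\<^esub> \<one>\<^bsub>L\<^esub> \<ominus>\<^bsub>L\<^esub> T) \<otimes>\<^bsub>L\<^esub> cpoly (- r) T) x) y"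
      unfolding r using T
      by (simp add: cpoly_mult cpoly_pCons cpoly_0 hinner_simps del: mult_minus_right mult_pCons_left)
  qed (use T in \<open>auto simp: L_closed\<close>)
  ultimately show ?case
    by simp
qed

text \<open>
  One of \<open>\<plusminus>\<parallel>p(T)\<parallel>\<close> lies in the spectrum of \<open>p(T)\<close>, hence is a value of \<open>p\<close> on the spectrum of \<open>T\<close>.
\<close>

lemma op_norm_op_poly_le:
  assumes T: "self_adjoint H T" and e: "0 \<le> e"
    and bound: "\<And>x. complex_of_real x \<in> op_spectrum H T \<Longrightarrow> \<bar>poly p x\<bar> \<le> e"
  shows "op_norm H (op_poly H p T) \<le> e"
proof (cases "op_norm H (op_poly H p T) > 0")
  case False
  then show ?thesis using e by simp
next
  case True
  have TL: "T \<in> carrier L" using T by simp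
  define P where "P = map_poly complex_of_real p"
  obtain l where l: "\<bar>l\<bar> = op_norm H (op_poly H p T)" "complex_of_real l \<in> op_spectrum H (op_poly H p T)"
    using op_norm_in_spectrum[OF self_adjoint_op_poly[OF T] True] True
    by (metis abs_minus_cancel abs_of_pos)
  have eq: "cpoly ([:complex_of_real l:] - P) T = complex_of_real l \<odot>\<^bsub>L\<^esub> \<one>\<^bsub>L\<^esub> \<ominus>\<^bsub>L\<^esub> op_poly H p T"
    using TL by (intro op_eq_hinnerI)
      (simp_all add: L_closed cpoly_diff cpoly_pCons cpoly_0 op_poly_eq_cpoly P_def hinner_simps)
  have "\<exists>x. complex_of_real x \<in> op_spectrum H T \<and> poly p x = l"
  proof (cases "[:complex_of_real l:] = P")
    \<comment> \<open>Here \<open>l - p\<close> is the zero polynomial, which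
      \<open>cpoly_Units\<close> excludes. Any spectral point of \<open>T\<close> will do, and there
      is one because a positive norm rules out the trivial space.\<close>
    case True
    have "\<exists>v\<in>carrier H. v \<noteq> \<zero>"
    proof (rule ccontr)
      assume "\<not> ?thesis"
      then have "op_norm H (op_poly H p T) \<le> 0"
        using TL by (intro op_norm_leI) (metis hnorm_zero mult_zero_left op_closed op_poly_closed order_refl)+
      with \<open>op_norm H (op_poly H p T) > 0\<close> show False by simp
    qed
    then obtain v where v: "v \<in> carrier H" "v \<noteq> \<zero>"
      by blast
    obtain x where x: "complex_of_real x \<in> op_spectrum H T"
      by (rule spectrum_nonempty[OF T v])
    have "complex_of_real (poly p x) = complex_of_real l"
      using poly_map_poly_of_real[of p x] unfolding P_def[symmetric] True[symmetric] by simp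
    with x show ?thesis by auto
  next
    case False
    have "cpoly ([:complex_of_real l:] - P) T \<notin> Units L"
      using l(2) by (simp add: eq op_spectrum_def)
    then obtain z where z: "poly ([:complex_of_real l:] - P) z = 0" "z \<in> op_spectrum H T"
      using cpoly_Units[OF TL, of "[:complex_of_real l:] - P"] False by auto
    have "complex_of_real (poly p (Re z)) = complex_of_real l"
      using z spectrum_real[OF T z(2)] poly_map_poly_of_real[of p "Re z"] by (simp add: P_def)
    then show ?thesis
      using z spectrum_real[OF T z(2)] by (intro exI[of _ "Re z"]) (metis of_real_eq_iff)
  qed
  then show ?thesis
    using bound l(1) by metis
qed

text \<open>Centre the interval: on the spectrum \<open>t - (a + b) / 2\<close> is at most
  \<open>(b - a) / 2\<close> in absolute value, so the norm of \<open>T - (a + b) / 2\<close> is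
  too, and Cauchy-Schwarz turns this into the two form bounds.\<close>

lemma spectrum_form_bounded:
  assumes T: "self_adjoint H T" and sub: "\<And>x. complex_of_real x \<in> op_spectrum H T \<Longrightarrow> x \<in> {a..b}"
    and ab: "a \<le> b"
  shows "form_bounded a b T"
  unfolding form_bounded_def
proof
  fix x assume x: "x \<in> carrier H"
  have TL: "T \<in> carrier L" using T by simp
  define p where "p = [:- ((a + b) / 2), 1:]"
  have "op_norm H (op_poly H p T) \<le> (b - a) / 2"
    using T ab by (intro op_norm_op_poly_le) (auto simp: p_def abs_le_iff field_simps dest!: sub)
  then have "hnorm H (op_poly H p T x) \<le> (b - a) / 2 * hnorm H x"
    using op_norm_le[of "op_poly H p T" x] TL x
    by (meson hnorm_nonneg mult_right_mono op_poly_closed order_trans)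
  then have "hnorm H (op_poly H p T x) * hnorm H x \<le> (b - a) / 2 * hnorm H x * hnorm H x"
    using x by (intro mult_right_mono) auto
  then have "\<bar>Re (hinner H (op_poly H p T x) x)\<bar> \<le> (b - a) / 2 * (hnorm H x)\<^sup>2"
    using Cauchy_Schwarz[of "op_poly H p T x" x] abs_Re_le_cmod[of "hinner H (op_poly H p T x) x"] TL x
    by (simp add: power2_eq_square)
  moreover have "Re (hinner H (op_poly H p T x) x) = Re (hinner H (T x) x) - (a + b) / 2 * (hnorm H x)\<^sup>2"
    using TL x
    by (simp add: op_poly_eq_cpoly p_def map_poly_pCons cpoly_pCons cpoly_0 hinner_simps hnorm_power2)
  ultimately show "a * (hnorm H x)\<^sup>2 \<le> Re (hinner H (T x) x) \<and> Re (hinner H (T x) x) \<le> b * (hnorm H x)\<^sup>2"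
    unfolding abs_le_iff by (auto simp: field_simps)
qed

end

section \<open>Existence of the continuous functional calculus\<close>

lemma Weierstrass_poly_sequence:
  fixes f :: "real \<Rightarrow> real"
  assumes "compact S" "continuous_on S f"
  obtains p :: "nat \<Rightarrow> real poly" where "uniform_limit S (\<lambda>k. poly (p k)) f sequentially"
proof -
  have "\<exists>p. \<forall>x\<in>S. \<bar>f x - poly p x\<bar> < 1 / real (Suc k)" for k
  proof -
    obtain g where g: "real_polynomial_function g" "\<And>x. x \<in> S \<Longrightarrow> \<bar>f x - g x\<bar> < 1 / real (Suc k)"
      using Stone_Weierstrass_real_polynomial_function[OF assms, of "1 / real (Suc k)"] by auto
    obtain a n where "g = (\<lambda>x. \<Sum>i\<le>n. a i * x ^ i)"
      using g(1) by (auto simp: real_polynomial_function_iff_sum)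
    then have "poly (\<Sum>i\<le>n. monom (a i) i) = g"
      by (auto simp: poly_sum poly_monom)
    then show ?thesis
      using g(2) by metis
  qed
  then obtain p where p: "\<And>k x. x \<in> S \<Longrightarrow> \<bar>f x - poly (p k) x\<bar> < 1 / real (Suc k)"
    by metis
  have "uniform_limit S (\<lambda>k. poly (p k)) f sequentially"
  proof (rule uniform_limitI)
    fix e :: real assume "e > 0"
    then have "\<forall>\<^sub>F k in sequentially. 1 / real (Suc k) < e"
      using order_tendstoD(2)[OF LIMSEQ_inverse_real_of_nat] by (simp add: inverse_eq_divide)
    then show "\<forall>\<^sub>F k in sequentially. \<forall>x\<in>S. dist (poly (p k) x) (f x) < e"
      by eventually_elim (use p in \<open>fastforce simp: dist_real_def abs_minus_commute intro: less_trans\<close>)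
  qed
  then show ?thesis
    using that by blast
qed

context hilbert_space
begin

lemma op_norm_triangle:
  assumes "R \<in> carrier L" "S \<in> carrier L" "T \<in> carrier L"
  shows "op_norm H (R \<ominus>\<^bsub>L\<^esub> T) \<le> op_norm H (R \<ominus>\<^bsub>L\<^esub> S) + op_norm H (S \<ominus>\<^bsub>L\<^esub> T)"
proof (rule op_norm_leI)
  fix x assume x: "x \<in> carrier H"
  show "hnorm H ((R \<ominus>\<^bsub>L\<^esub> T) x) \<le> (op_norm H (R \<ominus>\<^bsub>L\<^esub> S) + op_norm H (S \<ominus>\<^bsub>L\<^esub> T)) * hnorm H x"
    using hnorm_diff_triangle[of "R x" "S x" "T x"] assms x
      op_norm_le[of "R \<ominus>\<^bsub>L\<^esub> S" x] op_norm_le[of "S \<ominus>\<^bsub>L\<^esub> T" x]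
    by (simp add: distrib_right)
qed (use assms op_norm_nonneg in simp)

text \<open>Completeness of \<open>H\<close> provides the limit vector by vector. Symmetry passes to
  the limit and, through \<open>adjoint_opI\<close>, brings linearity with it.\<close>

lemma self_adjoint_complete:
  assumes T: "\<And>k. self_adjoint H (T k)"
    and Cauchy: "\<And>e. e > 0 \<Longrightarrow> \<exists>N::nat. \<forall>m\<ge>N. \<forall>k\<ge>N. op_norm H (T m \<ominus>\<^bsub>L\<^esub> T k) < e"
  obtains S where "self_adjoint H S" "(\<lambda>k. op_norm H (T k \<ominus>\<^bsub>L\<^esub> S)) \<longlonglongrightarrow> 0"
proof -
  have TL [simp]: "T k \<in> carrier L" for k using T by simp
  have near: "\<exists>N. \<forall>m\<ge>N. \<forall>k\<ge>N. \<forall>x\<in>carrier H. hnorm H (T m x \<ominus> T k x) \<le> e * hnorm H x"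
    if e: "e > 0" for e
  proof -
    obtain N where N: "\<And>m k. m \<ge> N \<Longrightarrow> k \<ge> N \<Longrightarrow> op_norm H (T m \<ominus>\<^bsub>L\<^esub> T k) < e"
      using Cauchy[OF e] by blast
    have "hnorm H (T m x \<ominus> T k x) \<le> e * hnorm H x" if "m \<ge> N" "k \<ge> N" "x \<in> carrier H" for m k x
      using op_norm_le[of "T m \<ominus>\<^bsub>L\<^esub> T k" x] N[OF that(1,2)] that(3)
        mult_right_mono[of "op_norm H (T m \<ominus>\<^bsub>L\<^esub> T k)" e "hnorm H x"] by simp
    then show ?thesis by blast
  qed
  have "\<exists>l\<in>carrier H. (\<lambda>k. hnorm H (T k x \<ominus> l)) \<longlonglongrightarrow> 0" if x: "x \<in> carrier H" for x
  proof (rule complete)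
    fix e :: real assume e: "e > 0"
    \<comment> \<open>The \<open>+ 1\<close> avoids a division by zero at the zero vector.\<close>
    then have "e / (hnorm H x + 1) > 0"
      using x by (simp add: add_nonneg_pos)
    then obtain N where N: "\<And>m k. m \<ge> N \<Longrightarrow> k \<ge> N \<Longrightarrow>
        hnorm H (T m x \<ominus> T k x) \<le> e / (hnorm H x + 1) * hnorm H x"
      using near x by meson
    have "0 < hnorm H x + 1" using hnorm_nonneg[OF x] by linarith
    then have "e / (hnorm H x + 1) * hnorm H x < e"
      using e by (simp add: field_simps)
    then show "\<exists>N. \<forall>m\<ge>N. \<forall>k\<ge>N. hnorm H (T m x \<ominus> T k x) < e"
      using N by (meson le_less_trans)
  qed (use x in auto)
  then obtain S where S: "\<And>x. x \<in> carrier H \<Longrightarrow> S x \<in> carrier H"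
    and lim: "\<And>x. x \<in> carrier H \<Longrightarrow> (\<lambda>k. hnorm H (T k x \<ominus> S x)) \<longlonglongrightarrow> 0"
    by metis
  have close: "\<exists>N. \<forall>m\<ge>N. \<forall>x\<in>carrier H. hnorm H (T m x \<ominus> S x) \<le> e * hnorm H x" if e: "e > 0" for e
  proof -
    obtain N where N: "\<And>m k x. m \<ge> N \<Longrightarrow> k \<ge> N \<Longrightarrow> x \<in> carrier H \<Longrightarrow>
        hnorm H (T m x \<ominus> T k x) \<le> e * hnorm H x"
      using near[OF e] by blast
    \<comment> \<open>Let \<open>k\<close> tend to infinity with \<open>m\<close> fixed;
      \<open>N\<close> does not depend on \<open>x\<close>, so the estimate remains uniform.\<close>
    have "hnorm H (T m x \<ominus> S x) \<le> e * hnorm H x" if m: "m \<ge> N" and x: "x \<in> carrier H" for m x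
    proof (rule LIMSEQ_le_const)
      show "(\<lambda>k. e * hnorm H x + hnorm H (T k x \<ominus> S x)) \<longlonglongrightarrow> e * hnorm H x"
        using tendsto_add[OF tendsto_const[of "e * hnorm H x"] lim[OF x]] by simp
      show "\<exists>N. \<forall>k\<ge>N. hnorm H (T m x \<ominus> S x) \<le> e * hnorm H x + hnorm H (T k x \<ominus> S x)"
        using hnorm_diff_triangle[of "T m x" "T _ x" "S x"] N[OF m _ x] S[OF x] x
        by (intro exI[of _ N]) (smt (verit) TL op_closed)
    qed
    then show ?thesis by blast
  qed
  have sym: "hinner H (S x) y = hinner H x (S y)" if "x \<in> carrier H" "y \<in> carrier H" for x y
  proof (rule LIMSEQ_unique)
    have zero: "(\<lambda>k::nat. hnorm H (v \<ominus> v)) \<longlonglongrightarrow> 0" if "v \<in> carrier H" for v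
    proof -
      have "v \<ominus> v = \<zero>" using that by (intro vec_eqI) (auto simp: hinner_simps)
      then show ?thesis by simp
    qed
    show "(\<lambda>k. hinner H (T k x) y) \<longlonglongrightarrow> hinner H (S x) y"
      using that S by (intro tendsto_hinner lim zero) auto
    have "(\<lambda>k. hinner H x (T k y)) \<longlonglongrightarrow> hinner H x (S y)"
      using that S by (intro tendsto_hinner lim zero) auto
    then show "(\<lambda>k. hinner H (T k x) y) \<longlonglongrightarrow> hinner H x (S y)"
      using that by (simp add: self_adjointD[OF T])
  qed
  obtain N where N: "\<And>x. x \<in> carrier H \<Longrightarrow> hnorm H (T N x \<ominus> S x) \<le> 1 * hnorm H x"
    using close[of 1] by auto
  have "hnorm H (S x) \<le> (op_norm H (T N) + 1) * hnorm H x" if x: "x \<in> carrier H" for x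
    using hnorm_triangle_sub[of "S x" "T N x"] hnorm_minus_commute[of "S x" "T N x"] N[OF x]
      op_norm_le[of "T N" x] S[OF x] x by (simp add: distrib_right)
  then have "restrict S (carrier H) \<in> carrier L"
    by (intro adjoint_opI[where T = S and K = "op_norm H (T N) + 1"]) (use S sym in auto)
  then have sa: "self_adjoint H (restrict S (carrier H))"
    using sym by (simp add: self_adjoint_iff)
  have "(\<lambda>k. op_norm H (T k \<ominus>\<^bsub>L\<^esub> restrict S (carrier H))) \<longlonglongrightarrow> 0"
  proof (rule LIMSEQ_I)
    fix e :: real assume e: "e > 0"
    obtain N where N: "\<And>m x. m \<ge> N \<Longrightarrow> x \<in> carrier H \<Longrightarrow> hnorm H (T m x \<ominus> S x) \<le> e / 2 * hnorm H x"
      using close[of "e / 2"] e by auto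
    have "op_norm H (T m \<ominus>\<^bsub>L\<^esub> restrict S (carrier H)) \<le> e / 2" if "m \<ge> N" for m
      using N[OF that] e sa by (intro op_norm_leI) auto
    moreover have "0 \<le> op_norm H (T m \<ominus>\<^bsub>L\<^esub> restrict S (carrier H))" for m
      using sa by (intro op_norm_nonneg) simp
    ultimately show "\<exists>N. \<forall>m\<ge>N. norm (op_norm H (T m \<ominus>\<^bsub>L\<^esub> restrict S (carrier H)) - 0) < e"
      using e by (intro exI[of _ N]) fastforce
  qed
  with sa show ?thesis
    using that by blast
qed

text \<open>On the spectrum \<open>p - q\<close> is at most \<open>2 * e / 3\<close>; the remaining
  third keeps the final inequality strict.\<close>

lemma op_norm_poly_diff_less:
  assumes T: "self_adjoint H T" and e: "0 < e"
    and "\<And>x. complex_of_real x \<in> op_spectrum H T \<Longrightarrow> \<bar>poly p x - f x\<bar> < e / 3"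
    and "\<And>x. complex_of_real x \<in> op_spectrum H T \<Longrightarrow> \<bar>poly q x - f x\<bar> < e / 3"
  shows "op_norm H (op_poly H p T \<ominus>\<^bsub>L\<^esub> op_poly H q T) < e"
proof -
  have TL: "T \<in> carrier L" using T by simp
  have "op_norm H (op_poly H (p - q) T) \<le> 2 * e / 3"
    using assms by (intro op_norm_op_poly_le) (auto, smt (verit))
  moreover have "op_poly H (p - q) T = op_poly H p T \<ominus>\<^bsub>L\<^esub> op_poly H q T"
    using TL by (intro op_eqI) (auto simp: op_poly_diff)
  ultimately show ?thesis
    using e by simp
qed

text \<open>This resolves the definite description in \<open>cfc\<close>. One Weierstrass sequence
  on \<open>{a..b}\<close> yields the candidate, every other approximating sequence is asymptotic to
  it in norm, and a rival limit is refuted along the first sequence.\<close>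

lemma cfc_props:
  assumes T: "self_adjoint H T" and fb: "form_bounded a b T" and f: "continuous_on {a..b} f"
  shows self_adjoint_cfc: "self_adjoint H (cfc H f T)"
    and cfc_limit: "uniform_limit {x. complex_of_real x \<in> op_spectrum H T} (\<lambda>k. poly (p k)) f sequentially \<Longrightarrow>
      (\<lambda>k. op_norm H (op_poly H (p k) T \<ominus>\<^bsub>L\<^esub> cfc H f T)) \<longlonglongrightarrow> 0"
proof -
  let ?X = "{x. complex_of_real x \<in> op_spectrum H T}"
  have TL [simp]: "T \<in> carrier L" using T by simp
  have sub: "?X \<subseteq> {a..b}"
    using form_bounded_spectrum[OF T fb] by auto
  obtain q where q: "uniform_limit {a..b} (\<lambda>k. poly (q k)) f sequentially"
    using Weierstrass_poly_sequence[OF _ f] by auto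
  have q': "uniform_limit ?X (\<lambda>k. poly (q k)) f sequentially"
    using uniform_limit_on_subset[OF q sub] .
  have "\<exists>N. \<forall>m\<ge>N. \<forall>k\<ge>N. op_norm H (op_poly H (q m) T \<ominus>\<^bsub>L\<^esub> op_poly H (q k) T) < e" if e: "e > 0" for e
  proof -
    have "\<forall>\<^sub>F k in sequentially. \<forall>x\<in>?X. dist (poly (q k) x) (f x) < e / 3"
      using uniform_limitD[OF q', of "e / 3"] e by simp
    then obtain N where "\<And>k x. k \<ge> N \<Longrightarrow> x \<in> ?X \<Longrightarrow> \<bar>poly (q k) x - f x\<bar> < e / 3"
      by (auto simp: eventually_sequentially dist_real_def)
    then show ?thesis
      using op_norm_poly_diff_less[OF T e] by blast
  qed
  then obtain S where S: "self_adjoint H S" and lim: "(\<lambda>k. op_norm H (op_poly H (q k) T \<ominus>\<^bsub>L\<^esub> S)) \<longlonglongrightarrow> 0"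
    using self_adjoint_complete[of "\<lambda>k. op_poly H (q k) T"] self_adjoint_op_poly[OF T] by metis
  have SL [simp]: "S \<in> carrier L" using S by simp
  have lim_all: "(\<lambda>k. op_norm H (op_poly H (p k) T \<ominus>\<^bsub>L\<^esub> S)) \<longlonglongrightarrow> 0"
    if p: "uniform_limit ?X (\<lambda>k. poly (p k)) f sequentially" for p
  proof (rule Lim_null_comparison)
    show "\<forall>\<^sub>F k in sequentially. norm (op_norm H (op_poly H (p k) T \<ominus>\<^bsub>L\<^esub> S))
        \<le> op_norm H (op_poly H (p k) T \<ominus>\<^bsub>L\<^esub> op_poly H (q k) T) + op_norm H (op_poly H (q k) T \<ominus>\<^bsub>L\<^esub> S)"
      by (intro always_eventually allI) (simp add: op_norm_nonneg op_norm_triangle)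
    have "(\<lambda>k. op_norm H (op_poly H (p k) T \<ominus>\<^bsub>L\<^esub> op_poly H (q k) T)) \<longlonglongrightarrow> 0"
    proof (rule tendstoI)
      fix e :: real assume e: "e > 0"
      have "\<forall>\<^sub>F k in sequentially. \<forall>x\<in>?X. dist (poly (q k) x) (f x) < e / 3"
        "\<forall>\<^sub>F k in sequentially. \<forall>x\<in>?X. dist (poly (p k) x) (f x) < e / 3"
        using uniform_limitD[OF q', of "e / 3"] uniform_limitD[OF p, of "e / 3"] e by auto
      then show "\<forall>\<^sub>F k in sequentially. dist (op_norm H (op_poly H (p k) T \<ominus>\<^bsub>L\<^esub> op_poly H (q k) T)) 0 < e"
      proof eventually_elim
        case (elim k)
        then show ?case
          using op_norm_poly_diff_less[OF T e, of "p k" f "q k"] by (simp add: dist_real_def op_norm_nonneg)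
      qed
    qed
    from tendsto_add[OF this lim]
    show "(\<lambda>k. op_norm H (op_poly H (p k) T \<ominus>\<^bsub>L\<^esub> op_poly H (q k) T) + op_norm H (op_poly H (q k) T \<ominus>\<^bsub>L\<^esub> S)) \<longlonglongrightarrow> 0"
      by simp
  qed
  have uniq: "R = S" if R: "R \<in> carrier L"
    and limR: "\<And>p. uniform_limit ?X (\<lambda>k. poly (p k)) f sequentially \<Longrightarrow>
      (\<lambda>k. op_norm H (op_poly H (p k) T \<ominus>\<^bsub>L\<^esub> R)) \<longlonglongrightarrow> 0" for R
  proof -
    have "op_norm H (R \<ominus>\<^bsub>L\<^esub> S) \<le> 0"
    proof (rule LIMSEQ_le_const)
      have "op_norm H (R \<ominus>\<^bsub>L\<^esub> S) \<le> op_norm H (R \<ominus>\<^bsub>L\<^esub> op_poly H (q k) T) + op_norm H (op_poly H (q k) T \<ominus>\<^bsub>L\<^esub> S)" for k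
        using R by (intro op_norm_triangle) auto
      moreover have "op_norm H (R \<ominus>\<^bsub>L\<^esub> op_poly H (q k) T) = op_norm H (op_poly H (q k) T \<ominus>\<^bsub>L\<^esub> R)" for k
        unfolding op_norm_def using R
        by (intro SUP_cong refl) (auto simp: hnorm_minus_commute)
      ultimately show "\<exists>N. \<forall>k\<ge>N. op_norm H (R \<ominus>\<^bsub>L\<^esub> S)
          \<le> op_norm H (op_poly H (q k) T \<ominus>\<^bsub>L\<^esub> R) + op_norm H (op_poly H (q k) T \<ominus>\<^bsub>L\<^esub> S)"
        by simp
      show "(\<lambda>k. op_norm H (op_poly H (q k) T \<ominus>\<^bsub>L\<^esub> R) + op_norm H (op_poly H (q k) T \<ominus>\<^bsub>L\<^esub> S)) \<longlonglongrightarrow> 0"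
        using tendsto_add[OF limR[OF q'] lim] by simp
    qed
    show ?thesis
    proof (rule op_eqI)
      fix x assume x: "x \<in> carrier H"
      have "hnorm H ((R \<ominus>\<^bsub>L\<^esub> S) x) \<le> op_norm H (R \<ominus>\<^bsub>L\<^esub> S) * hnorm H x"
        using R x by (intro op_norm_le) auto
      also have "\<dots> \<le> 0"
        using \<open>op_norm H (R \<ominus>\<^bsub>L\<^esub> S) \<le> 0\<close> x by (simp add: mult_nonpos_nonneg)
      finally have "hnorm H (R x \<ominus> S x) = 0"
        using R x by (intro antisym) auto
      then have zero: "R x \<ominus> S x = \<zero>"
        using R x by (simp add: hnorm_eq_0_iff)
      show "R x = S x"
      proof (rule vec_eqI)
        fix z assume "z \<in> carrier H"
        then show "hinner H (R x) z = hinner H (S x) z"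
          using hinner_diff_left[of "R x" "S x" z] R x zero by simp
      qed (use R x in auto)
    qed (use R in auto)
  qed
  have "cfc H f T = S"
    unfolding cfc_def
    by (rule the_equality) (use lim_all uniq in auto)
  then show "self_adjoint H (cfc H f T)"
    and "uniform_limit ?X (\<lambda>k. poly (p k)) f sequentially \<Longrightarrow>
      (\<lambda>k. op_norm H (op_poly H (p k) T \<ominus>\<^bsub>L\<^esub> cfc H f T)) \<longlonglongrightarrow> 0"
    using S lim_all by simp_all
qed

lemma cfc_closed: "self_adjoint H T \<Longrightarrow> form_bounded a b T \<Longrightarrow> continuous_on {a..b} f \<Longrightarrow> cfc H f T \<in> carrier L"
  using self_adjoint_cfc by (simp add: self_adjoint_def)

text \<open>Approximation on all of \<open>{a..b}\<close>, not just on the spectrum, lets one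
  sequence of polynomials serve operators with different spectra. The comparison in
  \<open>cfc_intertwine\<close> depends on that.\<close>

lemma cfc_strong_limit:
  assumes T: "self_adjoint H T" and fb: "form_bounded a b T" and f: "continuous_on {a..b} f"
    and p: "uniform_limit {a..b} (\<lambda>k. poly (p k)) f sequentially" and x: "x \<in> carrier H"
  shows "(\<lambda>k. hnorm H (op_poly H (p k) T x \<ominus> cfc H f T x)) \<longlonglongrightarrow> 0"
proof (rule Lim_null_comparison)
  have TL: "T \<in> carrier L" using T by simp
  have "{x. complex_of_real x \<in> op_spectrum H T} \<subseteq> {a..b}"
    using form_bounded_spectrum[OF T fb] by auto
  then have "(\<lambda>k. op_norm H (op_poly H (p k) T \<ominus>\<^bsub>L\<^esub> cfc H f T)) \<longlonglongrightarrow> 0"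
    by (intro cfc_limit[OF T fb f] uniform_limit_on_subset[OF p])
  then show "(\<lambda>k. op_norm H (op_poly H (p k) T \<ominus>\<^bsub>L\<^esub> cfc H f T) * hnorm H x) \<longlonglongrightarrow> 0"
    using tendsto_mult_left_zero by blast
  show "\<forall>\<^sub>F k in sequentially. norm (hnorm H (op_poly H (p k) T x \<ominus> cfc H f T x))
      \<le> op_norm H (op_poly H (p k) T \<ominus>\<^bsub>L\<^esub> cfc H f T) * hnorm H x"
    using op_norm_le[of "op_poly H (p _) T \<ominus>\<^bsub>L\<^esub> cfc H f T" x] TL x cfc_closed[OF T fb f]
    by (intro always_eventually allI) simp
qed

text \<open>Both arguments vary because \<open>cfc_mult\<close> moves one of its two factors to the
  right side of the inner product.\<close>

lemma cfc_hinner_limit: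
  assumes T: "self_adjoint H T" and fb: "form_bounded a b T" and f: "continuous_on {a..b} f"
    and p: "uniform_limit {a..b} (\<lambda>k. poly (p k)) f sequentially"
    and g: "continuous_on {a..b} g" and q: "uniform_limit {a..b} (\<lambda>k. poly (q k)) g sequentially"
    and x: "x \<in> carrier H" and y: "y \<in> carrier H"
  shows "(\<lambda>k. hinner H (op_poly H (p k) T x) (op_poly H (q k) T y)) \<longlonglongrightarrow> hinner H (cfc H f T x) (cfc H g T y)"
  by (intro tendsto_hinner cfc_strong_limit[OF T fb f p x] cfc_strong_limit[OF T fb g q y])
    (use T x y cfc_closed[OF T fb f] cfc_closed[OF T fb g] in auto)

end

section \<open>Algebraic properties of the functional calculus\<close>

context hilbert_space
begin

lemma cfc_weak_limit:
  assumes "self_adjoint H T" "form_bounded a b T" "continuous_on {a..b} f"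
    and "uniform_limit {a..b} (\<lambda>k. poly (p k)) f sequentially" and x: "x \<in> carrier H" and y: "y \<in> carrier H"
  shows "(\<lambda>k. hinner H (op_poly H (p k) T x) y) \<longlonglongrightarrow> hinner H (cfc H f T x) y"
proof (rule tendsto_hinner)
  have "y \<ominus> y = \<zero>" using y by (intro vec_eqI) (auto simp: hinner_simps)
  then show "(\<lambda>k::nat. hnorm H (y \<ominus> y)) \<longlonglongrightarrow> 0" by simp
  show "(\<lambda>k. hnorm H (op_poly H (p k) T x \<ominus> cfc H f T x)) \<longlonglongrightarrow> 0"
    using assms by (intro cfc_strong_limit)
qed (use assms cfc_closed in auto)

end

text \<open>The adjoint relation already carries the linearity of \<open>X\<close>. The instances
  below are a self-adjoint operator, a coordinate map of a power space and an isometry.\<close>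

locale adjoint_pair = H: hilbert_space H + K: hilbert_space K
  for H :: "'a inner_product_space" and K :: "'b inner_product_space" +
  fixes X :: "'a \<Rightarrow> 'b" and Y :: "'b \<Rightarrow> 'a"
  assumes X_closed [simp]: "x \<in> carrier H \<Longrightarrow> X x \<in> carrier K"
    and Y_closed [simp]: "y \<in> carrier K \<Longrightarrow> Y y \<in> carrier H"
    and adjoint: "x \<in> carrier H \<Longrightarrow> y \<in> carrier K \<Longrightarrow> hinner K (X x) y = hinner H x (Y y)"
begin

text \<open>Each step of Horner's rule moves one \<open>T\<close> past \<open>X\<close>; the
  induction is therefore over all \<open>x\<close> at once.\<close>

lemma cpoly_intertwine:
  assumes T: "T \<in> carrier (bounded_ops H)" and T': "T' \<in> carrier (bounded_ops K)"
    and XT: "\<And>x. x \<in> carrier H \<Longrightarrow> X (T x) = T' (X x)"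
    and x: "x \<in> carrier H" and y: "y \<in> carrier K"
  shows "hinner H (H.cpoly q T x) (Y y) = hinner K (K.cpoly q T' (X x)) y"
  using x
proof (induction q arbitrary: x)
  case 0
  then show ?case using T T' y by (simp add: H.cpoly_0 K.cpoly_0)
next
  case (pCons a q)
  have "hinner H (H.cpoly q T (T x)) (Y y) = hinner K (K.cpoly q T' (X (T x))) y"
    using pCons T by simp
  then show ?case
    using pCons(3) T T' y
    by (simp add: H.cpoly_pCons K.cpoly_pCons H.hinner_simps K.hinner_simps adjoint XT)
qed

text \<open>Limits are taken inside the inner product, so \<open>X\<close> need not be known to be continuous.\<close>

lemma cfc_intertwine:
  assumes T: "self_adjoint H T" "H.form_bounded a b T" and T': "self_adjoint K T'" "K.form_bounded a b T'"
    and f: "continuous_on {a..b} f"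
    and XT: "\<And>x. x \<in> carrier H \<Longrightarrow> X (T x) = T' (X x)" and x: "x \<in> carrier H"
  shows "X (cfc H f T x) = cfc K f T' (X x)"
proof (rule K.vec_eqI)
  have closed: "cfc H f T \<in> carrier (bounded_ops H)" "cfc K f T' \<in> carrier (bounded_ops K)"
    using T T' f H.cfc_closed K.cfc_closed by auto
  show "X (cfc H f T x) \<in> carrier K" "cfc K f T' (X x) \<in> carrier K"
    using closed x by auto
  obtain p where p: "uniform_limit {a..b} (\<lambda>k. poly (p k)) f sequentially"
    using Weierstrass_poly_sequence[OF _ f] by auto
  fix y assume y: "y \<in> carrier K"
  show "hinner K (X (cfc H f T x)) y = hinner K (cfc K f T' (X x)) y"
  proof (rule LIMSEQ_unique)
    show "(\<lambda>k. hinner H (op_poly H (p k) T x) (Y y)) \<longlonglongrightarrow> hinner K (X (cfc H f T x)) y"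
      using H.cfc_weak_limit[OF T f p x, of "Y y"] closed x y by (simp add: adjoint)
    have "hinner H (op_poly H (p k) T x) (Y y) = hinner K (op_poly K (p k) T' (X x)) y" for k
      using cpoly_intertwine[of T T' x y] T T' XT x y by (simp add: H.op_poly_eq_cpoly K.op_poly_eq_cpoly)
    then show "(\<lambda>k. hinner H (op_poly H (p k) T x) (Y y)) \<longlonglongrightarrow> hinner K (cfc K f T' (X x)) y"
      using K.cfc_weak_limit[OF T' f p, of "X x" y] x y by simp
  qed
qed

lemma adjoint_left: "y \<in> carrier K \<Longrightarrow> x \<in> carrier H \<Longrightarrow> hinner H (Y y) x = hinner K y (X x)"
  by (metis H.hinner_commute K.hinner_commute X_closed Y_closed adjoint)

end

section \<open>Products, polynomials and the inverse square root\<close>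

context hilbert_space
begin

lemma adjoint_pair_self:
  assumes "self_adjoint H T"
  shows "adjoint_pair H H T T"
  by unfold_locales (use assms in \<open>auto simp: self_adjointD\<close>)

lemma cfc_commute:
  assumes T: "self_adjoint H T" "form_bounded a b T" "continuous_on {a..b} f" and x: "x \<in> carrier H"
  shows "T (cfc H f T x) = cfc H f T (T x)"
  by (rule adjoint_pair.cfc_intertwine[OF adjoint_pair_self[OF T(1)] T(1,2) T]) (use x in auto)

text \<open>For polynomials, self-adjointness of \<open>p(T)\<close> turns the form of
  \<open>p(T) q(T)\<close> into an inner product of \<open>q(T) x\<close> with
  \<open>p(T) y\<close>. Strong convergence of the two factors is then enough to pass to the
  limit.\<close>

lemma cfc_mult:
  assumes T: "self_adjoint H T" and fb: "form_bounded a b T"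
    and f: "continuous_on {a..b} f" and g: "continuous_on {a..b} g" and x: "x \<in> carrier H"
  shows "cfc H (\<lambda>t. f t * g t) T x = cfc H f T (cfc H g T x)"
proof (rule vec_eqI)
  have fg: "continuous_on {a..b} (\<lambda>t. f t * g t)"
    by (intro continuous_intros f g)
  note closed = cfc_closed[OF T fb]
  show "cfc H (\<lambda>t. f t * g t) T x \<in> carrier H" "cfc H f T (cfc H g T x) \<in> carrier H"
    using closed f g fg x by auto
  obtain p q where p: "uniform_limit {a..b} (\<lambda>k. poly (p k)) f sequentially"
    and q: "uniform_limit {a..b} (\<lambda>k. poly (q k)) g sequentially"
    using Weierstrass_poly_sequence[OF _ f] Weierstrass_poly_sequence[OF _ g] by (metis compact_Icc)
  have pq: "uniform_limit {a..b} (\<lambda>k. poly (p k * q k)) (\<lambda>t. f t * g t) sequentially"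
    unfolding poly_mult
    by (intro uniform_lim_mult p q compact_imp_bounded compact_continuous_image f g compact_Icc)
  fix y assume y: "y \<in> carrier H"
  show "hinner H (cfc H (\<lambda>t. f t * g t) T x) y = hinner H (cfc H f T (cfc H g T x)) y"
  proof (rule LIMSEQ_unique)
    show "(\<lambda>k. hinner H (op_poly H (p k * q k) T x) y) \<longlonglongrightarrow> hinner H (cfc H (\<lambda>t. f t * g t) T x) y"
      by (rule cfc_weak_limit[OF T fb fg pq x y])
    have "hinner H (op_poly H (p k * q k) T x) y = hinner H (op_poly H (q k) T x) (op_poly H (p k) T y)" for k
      using T x y self_adjointD[OF self_adjoint_op_poly[OF T]] by (simp add: op_poly_mult)
    moreover have "hinner H (cfc H f T (cfc H g T x)) y = hinner H (cfc H g T x) (cfc H f T y)"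
      using self_adjointD[OF self_adjoint_cfc[OF T fb f]] closed[OF g] x y by simp
    ultimately show "(\<lambda>k. hinner H (op_poly H (p k * q k) T x) y) \<longlonglongrightarrow> hinner H (cfc H f T (cfc H g T x)) y"
      using cfc_hinner_limit[OF T fb g q f p x y] by simp
  qed
qed

text \<open>The constant sequence \<open>p\<close> converges to \<open>f\<close>. Agreement is asked
  on \<open>{a..b}\<close> alone, so that identities valid for positive \<open>t\<close> only, such
  as those for \<open>powr\<close>, can be used.\<close>

lemma cfc_poly:
  assumes T: "self_adjoint H T" and fb: "form_bounded a b T"
    and f: "\<And>t. t \<in> {a..b} \<Longrightarrow> f t = poly p t" and x: "x \<in> carrier H"
  shows "cfc H f T x = op_poly H p T x"
proof (rule vec_eqI)
  have cont: "continuous_on {a..b} f"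
    using f by (subst continuous_on_cong[of _ "{a..b}" f "poly p"]) (auto intro: continuous_intros)
  have "uniform_limit {a..b} (\<lambda>k::nat. poly p) f sequentially"
    by (rule uniform_limitI) (simp add: f)
  note lim = cfc_weak_limit[OF T fb cont this x]
  show "cfc H f T x \<in> carrier H" "op_poly H p T x \<in> carrier H"
    using cfc_closed[OF T fb cont] T x by auto
  fix y assume y: "y \<in> carrier H"
  show "hinner H (cfc H f T x) y = hinner H (op_poly H p T x) y"
    using LIMSEQ_unique[OF lim[OF y] tendsto_const] .
qed

text \<open>Since \<open>a > 0\<close>, the function \<open>t powr (-1/2)\<close> is continuous on
  \<open>{a..b}\<close>, and its square times \<open>t\<close> is the polynomial \<open>1\<close>
  there. Multiplicativity transfers this identity to operators.\<close>

lemma cfc_inverse_sqrt: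
  assumes T: "self_adjoint H T" and fb: "form_bounded a b T" and a: "a > 0" and x: "x \<in> carrier H"
  defines "D \<equiv> cfc H (\<lambda>t. t powr (-1/2)) T"
  shows "self_adjoint H D" "D (D (T x)) = x" "T (D x) = D (T x)"
proof -
  have g: "continuous_on {a..b} (\<lambda>t. t powr (-1/2))"
    using a by (intro continuous_intros) auto
  show "self_adjoint H D" "T (D x) = D (T x)"
    unfolding D_def using self_adjoint_cfc[OF T fb g] cfc_commute[OF T fb g x] by auto
  have TL: "T \<in> carrier L" using T by simp
  have idc: "continuous_on {a..b} (\<lambda>t. t)" by (intro continuous_intros)
  have id: "cfc H (\<lambda>t. t) T x = T x"
    using cfc_poly[OF T fb, of "\<lambda>t. t" "[:0, 1:]"] TL x
    by (simp add: op_poly_eq_cpoly map_poly_pCons cpoly_pCons cpoly_0)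
  have "D (D (T x)) = cfc H (\<lambda>t. t powr (-1/2) * (t powr (-1/2) * t)) T x"
    using cfc_mult[OF T fb g continuous_on_mult[OF g idc] x] cfc_mult[OF T fb g idc x] id
    by (simp add: D_def)
  also have "\<dots> = op_poly H 1 T x"
  proof (rule cfc_poly[OF T fb _ x])
    fix t assume "t \<in> {a..b}"
    then have t: "t > 0" using a by simp
    have "t powr (-1/2) * (t powr (-1/2) * t) = t powr (-1/2) * (t powr (-1/2) * t powr 1)"
      using t by simp
    also have "\<dots> = 1"
      using t by (simp only: powr_add[symmetric]) simp
    finally show "t powr (-1/2) * (t powr (-1/2) * t) = poly 1 t"
      by simp
  qed
  also have "\<dots> = x"
    using TL x by (simp add: op_poly_eq_cpoly one_pCons map_poly_pCons cpoly_pCons cpoly_0)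
  finally show "D (D (T x)) = x" .
qed

end

section \<open>Finite powers of a Hilbert space\<close>

text \<open>An infinite set absorbs its own square; repeating this for each index packs a whole
  family into one element.\<close>

lemma inj_PiE_infinite:
  assumes "finite I" "infinite A"
  shows "\<exists>e :: ('i \<Rightarrow> 'a) \<Rightarrow> 'a. inj_on e (I \<rightarrow>\<^sub>E A) \<and> e ` (I \<rightarrow>\<^sub>E A) \<subseteq> A"
  using assms(1)
proof induction
  case empty
  obtain a where "a \<in> A" using assms(2) by fastforce
  then show ?case by (intro exI[of _ "\<lambda>_. a"]) auto
next
  case (insert i I)
  then obtain e :: "('i \<Rightarrow> 'a) \<Rightarrow> 'a" where e: "inj_on e (I \<rightarrow>\<^sub>E A)" "e ` (I \<rightarrow>\<^sub>E A) \<subseteq> A"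
    by blast
  obtain h where h: "inj_on h (A \<times> A)" "h ` (A \<times> A) \<subseteq> A"
    using card_of_Times_same_infinite[OF assms(2), THEN ordIso_imp_ordLeq]
    unfolding card_of_ordLeq[symmetric] by blast
  define e' where "e' f = h (f i, e (restrict f I))" for f
  have closed: "(f i, e (restrict f I)) \<in> A \<times> A" if "f \<in> insert i I \<rightarrow>\<^sub>E A" for f
  proof -
    have "restrict f I \<in> I \<rightarrow>\<^sub>E A" using that by auto
    then show ?thesis using that e(2) by auto
  qed
  have "inj_on e' (insert i I \<rightarrow>\<^sub>E A)"
  proof (rule inj_onI)
    fix f g assume f: "f \<in> insert i I \<rightarrow>\<^sub>E A" and g: "g \<in> insert i I \<rightarrow>\<^sub>E A" and "e' f = e' g"
    then have eq: "f i = g i" "e (restrict f I) = e (restrict g I)"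
      using inj_onD[OF h(1) _ closed[OF f] closed[OF g]] by (auto simp: e'_def)
    have "restrict f I = restrict g I"
      using e(1) eq(2) f g by (auto dest!: inj_onD[of e])
    then have "f j = g j" if "j \<in> insert i I" for j
      using eq(1) that by (metis insertE restrict_apply')
    then show "f = g"
      using PiE_ext[OF f g] by blast
  qed
  moreover have "e' ` (insert i I \<rightarrow>\<^sub>E A) \<subseteq> A"
    using closed h(2) by (auto simp: e'_def)
  ultimately show ?case by blast
qed

text \<open>The multiples of \<open>x\<close> by distinct scalars are distinct. This meets the
  hypothesis of \<open>inj_PiE_infinite\<close>, so the power space fits into the type of points of
  \<open>H\<close>.\<close>

lemma (in hilbert_space) infinite_carrier:
  assumes x: "x \<in> carrier H" "x \<noteq> \<zero>"
  shows "infinite (carrier H)"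
proof -
  have "hinner H x x \<noteq> 0"
    using x hinner_definite by blast
  then have "inj (\<lambda>c. c \<odot> x)"
    using x hinner_smult_left[OF x(1) x(1)] by (intro injI) (metis mult_cancel_right)
  then have "infinite (range (\<lambda>c::complex. c \<odot> x))"
    using infinite_UNIV_char_0 finite_imageD by blast
  moreover have "range (\<lambda>c. c \<odot> x) \<subseteq> carrier H"
    using scale_closed[OF x(1)] by (intro image_subsetI)
  ultimately show ?thesis
    using infinite_super by blast
qed

text \<open>
  Operator convexity only concerns Hilbert spaces with points in a given type, so the families indexed
  by \<open>I\<close> are encoded as points through an injection \<open>e\<close>.
\<close>

definition power_space :: "'a inner_product_space \<Rightarrow> 'i set \<Rightarrow> (('i \<Rightarrow> 'a) \<Rightarrow> 'b) \<Rightarrow> 'b inner_product_space" where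
  "power_space H I e = (let d = inv_into (I \<rightarrow>\<^sub>E carrier H) e in
    \<lparr>carrier = e ` (I \<rightarrow>\<^sub>E carrier H), mult = undefined, one = undefined,
     zero = e (\<lambda>i\<in>I. \<zero>\<^bsub>H\<^esub>), add = (\<lambda>x y. e (\<lambda>i\<in>I. d x i \<oplus>\<^bsub>H\<^esub> d y i)),
     smult = (\<lambda>c x. e (\<lambda>i\<in>I. c \<odot>\<^bsub>H\<^esub> d x i)),
     hinner = (\<lambda>x y. \<Sum>i\<in>I. hinner H (d x i) (d y i))\<rparr>)"

locale hilbert_power = hilbert_space H for H :: "'a inner_product_space" (structure) +
  fixes I :: "'i set" and e :: "('i \<Rightarrow> 'a) \<Rightarrow> 'b"
  assumes fin: "finite I" and inj: "inj_on e (I \<rightarrow>\<^sub>E carrier H)"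
begin

abbreviation K where "K \<equiv> power_space H I e"

definition coord :: "'i \<Rightarrow> 'b \<Rightarrow> 'a" where
  "coord i x = inv_into (I \<rightarrow>\<^sub>E carrier H) e x i"

definition tuple :: "('i \<Rightarrow> 'a) \<Rightarrow> 'b" where
  "tuple v = e (\<lambda>i\<in>I. v i)"

lemma tuple_closed [simp]: "(\<And>i. i \<in> I \<Longrightarrow> v i \<in> carrier H) \<Longrightarrow> tuple v \<in> carrier K"
  by (auto simp: power_space_def tuple_def Let_def)

lemma coord_tuple [simp]:
  assumes "\<And>i. i \<in> I \<Longrightarrow> v i \<in> carrier H" "i \<in> I"
  shows "coord i (tuple v) = v i"
proof -
  have "(\<lambda>i\<in>I. v i) \<in> I \<rightarrow>\<^sub>E carrier H" using assms(1) by auto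
  then show ?thesis
    using assms(2) inj by (simp add: coord_def tuple_def inv_into_f_f)
qed

lemma coord_closed [simp]: "x \<in> carrier K \<Longrightarrow> i \<in> I \<Longrightarrow> coord i x \<in> carrier H"
  using inv_into_into[of x e "I \<rightarrow>\<^sub>E carrier H"] by (auto simp: power_space_def coord_def Let_def)

lemma power_eqI:
  assumes x: "x \<in> carrier K" and y: "y \<in> carrier K" and eq: "\<And>i. i \<in> I \<Longrightarrow> coord i x = coord i y"
  shows "x = y"
proof -
  have *: "x \<in> e ` (I \<rightarrow>\<^sub>E carrier H)" "y \<in> e ` (I \<rightarrow>\<^sub>E carrier H)"
    using x y by (auto simp: power_space_def Let_def)
  have "inv_into (I \<rightarrow>\<^sub>E carrier H) e x = inv_into (I \<rightarrow>\<^sub>E carrier H) e y"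
    using eq by (intro PiE_ext[OF inv_into_into[OF *(1)] inv_into_into[OF *(2)]]) (simp add: coord_def)
  then show ?thesis
    using * by (metis f_inv_into_f)
qed

text \<open>With these rules computations in \<open>K\<close> go through \<open>tuple\<close> and
  \<open>coord\<close>, and the encoding \<open>e\<close> stays out of sight.\<close>

lemma power_simps:
  "\<zero>\<^bsub>K\<^esub> = tuple (\<lambda>i. \<zero>)" "x \<oplus>\<^bsub>K\<^esub> y = tuple (\<lambda>i. coord i x \<oplus> coord i y)"
  "c \<odot>\<^bsub>K\<^esub> x = tuple (\<lambda>i. c \<odot> coord i x)"
  "hinner K x y = (\<Sum>i\<in>I. hinner H (coord i x) (coord i y))"
  by (simp_all add: power_space_def Let_def tuple_def coord_def)

lemma power_abelian_group: "abelian_group K"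
proof (rule abelian_groupI)
  fix x assume x: "x \<in> carrier K"
  have "((-1) \<odot>\<^bsub>K\<^esub> x) \<oplus>\<^bsub>K\<^esub> x = \<zero>\<^bsub>K\<^esub>"
    using x by (intro power_eqI) (auto simp: power_simps hinner_simps intro!: vec_eqI)
  moreover have "(-1) \<odot>\<^bsub>K\<^esub> x \<in> carrier K"
    using x by (simp add: power_simps)
  ultimately show "\<exists>y\<in>carrier K. y \<oplus>\<^bsub>K\<^esub> x = \<zero>\<^bsub>K\<^esub>"
    by blast
qed (auto simp: power_simps M.a_ac intro!: power_eqI)

lemma power_module: "Module.module complex_ring K"
  by (rule moduleI[OF R.is_cring power_abelian_group])
    (auto simp: power_simps smult_l_distr[simplified] smult_r_distr[simplified] smult_assoc1[simplified]
      intro!: power_eqI)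

lemma coord_diff:
  assumes x: "x \<in> carrier K" and y: "y \<in> carrier K" and i: "i \<in> I"
  shows "coord i (x \<ominus>\<^bsub>K\<^esub> y) = coord i x \<ominus> coord i y"
proof -
  interpret K: abelian_group K by (rule power_abelian_group)
  have "((-1) \<odot>\<^bsub>K\<^esub> y) \<oplus>\<^bsub>K\<^esub> y = \<zero>\<^bsub>K\<^esub>"
    using y by (intro power_eqI) (auto simp: power_simps hinner_simps intro!: vec_eqI)
  then have "\<ominus>\<^bsub>K\<^esub> y = (-1) \<odot>\<^bsub>K\<^esub> y"
    using y by (intro K.minus_equality) (auto simp: power_simps)
  then show ?thesis
    using x y i by (intro vec_eqI) (auto simp: K.minus_eq power_simps hinner_simps)
qed

lemma hnorm_power: "x \<in> carrier K \<Longrightarrow> hnorm K x = sqrt (\<Sum>i\<in>I. (hnorm H (coord i x))\<^sup>2)"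
  by (simp add: hnorm_def[of K] power_simps hnorm_power2)

lemma hnorm_coord_le: "x \<in> carrier K \<Longrightarrow> i \<in> I \<Longrightarrow> hnorm H (coord i x) \<le> hnorm K x"
  unfolding hnorm_power
  by (rule real_le_rsqrt, rule member_le_sum[OF _ _ fin]) auto

lemma hilbert_space_power: "hilbert_space K"
proof (intro hilbert_space.intro power_module hilbert_space_axioms.intro)
  interpret K: abelian_group K by (rule power_abelian_group)
  fix x y z c assume "x \<in> carrier K" "y \<in> carrier K" "z \<in> carrier K"
  then show "hinner K (x \<oplus>\<^bsub>K\<^esub> y) z = hinner K x z + hinner K y z"
    by (simp add: power_simps hinner_simps sum.distrib)
next
  fix x y c assume "x \<in> carrier K" "y \<in> carrier K"
  then show "hinner K (c \<odot>\<^bsub>K\<^esub> x) y = c * hinner K x y"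
    by (simp add: power_simps hinner_simps sum_distrib_left)
next
  fix x y assume "x \<in> carrier K" "y \<in> carrier K"
  then show "hinner K x y = cnj (hinner K y x)"
    by (auto simp: power_simps intro!: sum.cong hinner_commute)
next
  fix x assume "x \<in> carrier K"
  then show "hinner K x x \<in> \<real>\<^sub>\<ge>\<^sub>0"
    using hinner_nonneg by (auto simp: power_simps complex_nonneg_Reals_iff intro!: sum_nonneg sum.neutral)
next
  fix x assume x: "x \<in> carrier K" and "hinner K x x = 0"
  then have "(\<Sum>i\<in>I. (hnorm H (coord i x))\<^sup>2) = 0"
    using hnorm_power[OF x] by (simp add: hnorm_def[of K])
  then have "\<forall>i\<in>I. coord i x = \<zero>"
    using fin x by (simp add: sum_nonneg_eq_0_iff hnorm_eq_0_iff)
  then show "x = \<zero>\<^bsub>K\<^esub>"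
    using x by (intro power_eqI) (auto simp: power_simps)
next
  interpret K: abelian_group K by (rule power_abelian_group)
  fix s :: "nat \<Rightarrow> 'b"
  assume "range s \<subseteq> carrier K"
    and Cauchy: "\<And>e. e > 0 \<Longrightarrow> \<exists>N::nat. \<forall>m\<ge>N. \<forall>k\<ge>N. hnorm K (s m \<ominus>\<^bsub>K\<^esub> s k) < e"
  then have s: "s k \<in> carrier K" for k by auto
  \<comment> \<open>Completeness is inherited coordinatewise; finitely many coordinate limits then
    give convergence in the norm of the power.\<close>
  have "\<exists>l\<in>carrier H. (\<lambda>k. hnorm H (coord i (s k) \<ominus> l)) \<longlonglongrightarrow> 0" if i: "i \<in> I" for i
  proof (rule complete)
    fix r :: real assume "r > 0"
    then obtain N where "\<And>m k. m \<ge> N \<Longrightarrow> k \<ge> N \<Longrightarrow> hnorm K (s m \<ominus>\<^bsub>K\<^esub> s k) < r"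
      using Cauchy by blast
    moreover have "hnorm H (coord i (s m) \<ominus> coord i (s k)) \<le> hnorm K (s m \<ominus>\<^bsub>K\<^esub> s k)" for m k
      using hnorm_coord_le[of "s m \<ominus>\<^bsub>K\<^esub> s k" i] s i by (simp add: coord_diff)
    ultimately show "\<exists>N. \<forall>m\<ge>N. \<forall>k\<ge>N. hnorm H (coord i (s m) \<ominus> coord i (s k)) < r"
      by (meson le_less_trans)
  qed (use s i in auto)
  then obtain l where l: "\<And>i. i \<in> I \<Longrightarrow> l i \<in> carrier H"
    and lim: "\<And>i. i \<in> I \<Longrightarrow> (\<lambda>k. hnorm H (coord i (s k) \<ominus> l i)) \<longlonglongrightarrow> 0"
    by metis
  have "(\<lambda>k. sqrt (\<Sum>i\<in>I. (hnorm H (coord i (s k) \<ominus> l i))\<^sup>2)) \<longlonglongrightarrow> sqrt (\<Sum>i\<in>I. 0\<^sup>2)"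
    by (intro tendsto_intros lim)
  moreover have "hnorm K (s k \<ominus>\<^bsub>K\<^esub> tuple l) = sqrt (\<Sum>i\<in>I. (hnorm H (coord i (s k) \<ominus> l i))\<^sup>2)" for k
    using s l by (simp add: hnorm_power coord_diff)
  ultimately show "\<exists>l\<in>carrier K. (\<lambda>k. hnorm K (s k \<ominus>\<^bsub>K\<^esub> l)) \<longlonglongrightarrow> 0"
    using l by (intro bexI[of _ "tuple l"]) auto
qed

end

section \<open>Jensen's operator inequality\<close>

context hilbert_power
begin

definition diag :: "('i \<Rightarrow> 'a \<Rightarrow> 'a) \<Rightarrow> 'b \<Rightarrow> 'b" where
  "diag A = (\<lambda>x\<in>carrier K. tuple (\<lambda>i. A i (coord i x)))"

lemma coord_diag:
  assumes "\<And>i. i \<in> I \<Longrightarrow> self_adjoint H (A i)" "x \<in> carrier K" "i \<in> I"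
  shows "coord i (diag A x) = A i (coord i x)"
  using assms by (simp add: diag_def)

lemma diag_closed:
  assumes "\<And>i. i \<in> I \<Longrightarrow> self_adjoint H (A i)" "x \<in> carrier K"
  shows "diag A x \<in> carrier K"
  using assms by (simp add: diag_def)

lemma self_adjoint_diag:
  assumes A: "\<And>i. i \<in> I \<Longrightarrow> self_adjoint H (A i)"
  shows "self_adjoint K (diag A)"
proof -
  interpret K: hilbert_space K by (rule hilbert_space_power)
  have sym: "hinner K (diag A x) y = hinner K x (diag A y)" if "x \<in> carrier K" "y \<in> carrier K" for x y
    using that A by (auto simp: power_simps coord_diag self_adjointD intro!: sum.cong)
  \<comment> \<open>A common bound for the norms; a sum, unlike a maximum, also makes sense for
    empty \<open>I\<close>.\<close>
  define M where "M = (\<Sum>i\<in>I. op_norm H (A i))"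
  have M: "0 \<le> M" "\<And>i. i \<in> I \<Longrightarrow> op_norm H (A i) \<le> M"
    unfolding M_def using A fin by (auto intro!: sum_nonneg member_le_sum op_norm_nonneg)
  have "hnorm K (diag A x) \<le> M * hnorm K x" if x: "x \<in> carrier K" for x
  proof (rule power2_le_imp_le)
    have "(hnorm H (A i (coord i x)))\<^sup>2 \<le> M\<^sup>2 * (hnorm H (coord i x))\<^sup>2" if i: "i \<in> I" for i
    proof -
      have "hnorm H (A i (coord i x)) \<le> M * hnorm H (coord i x)"
        using op_norm_le[of "A i" "coord i x"] M(2)[OF i] A i x
        by (meson coord_closed hnorm_nonneg mult_right_mono order_trans self_adjoint_closed)
      then show ?thesis
        using power_mono[of "hnorm H (A i (coord i x))" "M * hnorm H (coord i x)" 2] A i x by (simp add: power_mult_distrib)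
    qed
    then have "(\<Sum>i\<in>I. (hnorm H (A i (coord i x)))\<^sup>2) \<le> M\<^sup>2 * (\<Sum>i\<in>I. (hnorm H (coord i x))\<^sup>2)"
      unfolding sum_distrib_left by (rule sum_mono)
    then show "(hnorm K (diag A x))\<^sup>2 \<le> (M * hnorm K x)\<^sup>2"
      using x A by (simp add: hnorm_power diag_closed coord_diag power_mult_distrib sum_nonneg)
  qed (use M x in simp)
  then have "diag A \<in> carrier (bounded_ops K)"
    by (intro K.adjoint_opI[where T = "diag A" and K = M])
      (use sym diag_closed[OF A] in \<open>auto simp: diag_def\<close>)
  then show ?thesis
    using sym by (simp add: K.self_adjoint_iff)
qed

lemma form_bounded_diag:
  assumes A: "\<And>i. i \<in> I \<Longrightarrow> self_adjoint H (A i)" "\<And>i. i \<in> I \<Longrightarrow> form_bounded a b (A i)"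
  shows "hilbert_space.form_bounded K a b (diag A)"
proof -
  interpret K: hilbert_space K by (rule hilbert_space_power)
  show ?thesis
    unfolding K.form_bounded_def
  proof
    fix x assume x: "x \<in> carrier K"
    have "(hnorm K x)\<^sup>2 = (\<Sum>i\<in>I. (hnorm H (coord i x))\<^sup>2)"
      using x by (simp add: hnorm_power sum_nonneg)
    moreover have "Re (hinner K (diag A x) x) = (\<Sum>i\<in>I. Re (hinner H (A i (coord i x)) (coord i x)))"
      using x A by (simp add: power_simps coord_diag)
    ultimately show "a * (hnorm K x)\<^sup>2 \<le> Re (hinner K (diag A x) x) \<and> Re (hinner K (diag A x) x) \<le> b * (hnorm K x)\<^sup>2"
      using x A(2) by (auto simp: sum_distrib_left form_bounded_def intro!: sum_mono)
  qed
qed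

lemma adjoint_pair_coord:
  assumes "i \<in> I"
  shows "adjoint_pair K H (coord i) (\<lambda>v. tuple (\<lambda>j. if j = i then v else \<zero>))"
proof -
  interpret K: hilbert_space K by (rule hilbert_space_power)
  show ?thesis
  proof (unfold_locales, goal_cases)
    case (3 x v)
    have "hinner K x (tuple (\<lambda>j. if j = i then v else \<zero>)) = (\<Sum>j\<in>I. if j = i then hinner H (coord i x) v else 0)"
      using 3 unfolding power_simps by (intro sum.cong) auto
    then show ?case using assms fin by simp
  qed (use assms in auto)
qed

text \<open>The coordinate map intertwines \<open>diag A\<close> with \<open>A i\<close>, so the
  functional calculus acts in each coordinate separately.\<close>

lemma coord_cfc_diag:
  assumes A: "\<And>i. i \<in> I \<Longrightarrow> self_adjoint H (A i)" "\<And>i. i \<in> I \<Longrightarrow> form_bounded a b (A i)"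
    and f: "continuous_on {a..b} f" and i: "i \<in> I" and x: "x \<in> carrier K"
  shows "coord i (cfc K f (diag A) x) = cfc H f (A i) (coord i x)"
  by (rule adjoint_pair.cfc_intertwine[OF adjoint_pair_coord[OF i] self_adjoint_diag[OF A(1)]
        form_bounded_diag[OF A] A(1)[OF i] A(2)[OF i] f]) (use x i A coord_diag in auto)

end

text \<open>
  With the reflection \<open>U = 2VV\<^sup>* - 1\<close>, the average of \<open>A\<close> and \<open>UAU\<close> is the pinching of \<open>A\<close>
  by the range projection of \<open>V\<close>; it intertwines with the compression \<open>V\<^sup>*AV\<close> through \<open>V\<close>.
\<close>

locale isometry = adjoint_pair H K V V'
  for H :: "'a inner_product_space" and K :: "'b inner_product_space" and V V' +
  assumes V'_V [simp]: "x \<in> carrier H \<Longrightarrow> V' (V x) = x"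
begin

lemma hinner_V_V: "x \<in> carrier H \<Longrightarrow> y \<in> carrier H \<Longrightarrow> hinner K (V x) (V y) = hinner H x y"
  by (simp add: adjoint)

lemma hnorm_V: "x \<in> carrier H \<Longrightarrow> hnorm K (V x) = hnorm H x"
  by (simp add: hnorm_def hinner_V_V)

definition reflection :: "'b \<Rightarrow> 'b" where
  "reflection = (\<lambda>y\<in>carrier K. 2 \<odot>\<^bsub>K\<^esub> V (V' y) \<ominus>\<^bsub>K\<^esub> y)"

lemma reflection_apply: "y \<in> carrier K \<Longrightarrow> reflection y = 2 \<odot>\<^bsub>K\<^esub> V (V' y) \<ominus>\<^bsub>K\<^esub> y"
  by (simp add: reflection_def)

lemma reflection_closed [simp]: "y \<in> carrier K \<Longrightarrow> reflection y \<in> carrier K"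
  by (simp add: reflection_apply)

lemma reflection_V: "x \<in> carrier H \<Longrightarrow> reflection (V x) = V x"
  by (intro K.vec_eqI) (auto simp: reflection_apply K.hinner_simps)

lemma reflection_sym: "x \<in> carrier K \<Longrightarrow> y \<in> carrier K \<Longrightarrow> hinner K (reflection x) y = hinner K x (reflection y)"
  by (simp add: reflection_apply K.hinner_simps adjoint adjoint_left[symmetric])

lemma V'_reflection: "y \<in> carrier K \<Longrightarrow> V' (reflection y) = V' y"
  by (intro H.vec_eqI) (auto simp: reflection_apply adjoint_left K.hinner_simps hinner_V_V)

lemma reflection_reflection:
  assumes y: "y \<in> carrier K"
  shows "reflection (reflection y) = y"
proof (rule K.vec_eqI)
  fix z assume z: "z \<in> carrier K"
  have "hinner K (reflection w) z = 2 * hinner K (V (V' w)) z - hinner K w z" if "w \<in> carrier K" for w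
    using that z by (simp add: reflection_apply K.hinner_simps)
  from this[of "reflection y"] this[of y] show "hinner K (reflection (reflection y)) z = hinner K y z"
    using y by (simp add: V'_reflection)
qed (use y in auto)

lemma hnorm_reflection: "y \<in> carrier K \<Longrightarrow> hnorm K (reflection y) = hnorm K y"
  using reflection_sym[of y "reflection y"] by (simp add: hnorm_def reflection_reflection)

lemma self_adjoint_reflection: "self_adjoint K reflection"
  unfolding K.self_adjoint_iff
  by (auto simp: reflection_sym hnorm_reflection intro!: K.adjoint_opI[where T = reflection and K = 1])
    (auto simp: reflection_def)

text \<open>Convexity is used once, at \<open>t = 1/2\<close>, for \<open>A\<close> and
  \<open>B = UAU\<close>, and the resulting inequality is tested on the vector \<open>V x\<close>.
  That vector is fixed by \<open>U\<close>, so \<open>f(A)\<close> and \<open>f(B)\<close>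
  contribute equally; the mean \<open>M\<close> satisfies \<open>M V = V T\<close>, so the left side
  becomes the form of \<open>f(T)\<close> at \<open>x\<close>.\<close>

lemma Jensen_isometry:
  assumes convex: "operator_convex TYPE('b) J f" and J: "{a..b} \<subseteq> J"
    and A: "self_adjoint K A" and fb: "K.form_bounded a b A" and T: "T \<in> carrier (bounded_ops H)"
    and compress: "\<And>x. x \<in> carrier H \<Longrightarrow> T x = V' (A (V x))" and x: "x \<in> carrier H"
  shows "hinner K (cfc K f A (V x)) (V x) - hinner H (cfc H f T x) x \<in> \<real>\<^sub>\<ge>\<^sub>0"
proof -
  let ?U = reflection
  have AL: "A \<in> carrier (bounded_ops K)" and UL: "?U \<in> carrier (bounded_ops K)"
    using A self_adjoint_reflection by auto
  have f: "continuous_on {a..b} f"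
    using convex J continuous_on_subset by (auto simp: operator_convex_def)
  have Tsa: "self_adjoint H T"
    using T AL by (auto simp: H.self_adjoint_iff compress adjoint_left adjoint[symmetric] K.self_adjointD[OF A])
  have Tfb: "H.form_bounded a b T"
    using fb AL unfolding H.form_bounded_def K.form_bounded_def
    by (auto simp: compress adjoint_left hnorm_V[symmetric])
  define B where "B = ?U \<otimes>\<^bsub>bounded_ops K\<^esub> (A \<otimes>\<^bsub>bounded_ops K\<^esub> ?U)"
  have BL: "B \<in> carrier (bounded_ops K)"
    using AL UL by (simp add: B_def K.L_closed)
  have B: "B y = ?U (A (?U y))" if "y \<in> carrier K" for y
    using that by (simp add: B_def)
  have Uc: "?U y \<in> carrier K" if "y \<in> carrier K" for y
    using UL that by simp
  have Bsa: "self_adjoint K B"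
    using BL AL Uc by (auto simp: K.self_adjoint_iff B reflection_sym K.self_adjointD[OF A])
  have Bfb: "K.form_bounded a b B"
    unfolding K.form_bounded_def
  proof
    fix y assume y: "y \<in> carrier K"
    have "hinner K (B y) y = hinner K (A (?U y)) (?U y)"
      using y AL Uc by (simp add: B reflection_sym)
    then show "a * (hnorm K y)\<^sup>2 \<le> Re (hinner K (B y) y) \<and> Re (hinner K (B y) y) \<le> b * (hnorm K y)\<^sup>2"
      using fb Uc[OF y] y hnorm_reflection[OF y] unfolding K.form_bounded_def by metis
  qed
  define M where "M = complex_of_real (1 - 1/2) \<odot>\<^bsub>bounded_ops K\<^esub> A \<oplus>\<^bsub>bounded_ops K\<^esub>
    complex_of_real (1/2) \<odot>\<^bsub>bounded_ops K\<^esub> B"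
  have MC: "M \<in> carrier (bounded_ops K)"
    using AL BL by (simp add: M_def K.L_closed)
  have Msa: "self_adjoint K M"
    unfolding K.self_adjoint_iff
  proof (intro conjI ballI MC)
    fix y z assume "y \<in> carrier K" "z \<in> carrier K"
    then show "hinner K (M y) z = hinner K y (M z)"
      using AL BL K.self_adjointD[OF A, of y z] K.self_adjointD[OF Bsa, of y z]
      by (simp add: M_def K.hinner_simps)
  qed
  have Mfb: "K.form_bounded a b M"
    unfolding K.form_bounded_def
  proof
    fix y assume y: "y \<in> carrier K"
    have "Re (hinner K (M y) y) = (Re (hinner K (A y) y) + Re (hinner K (B y) y)) / 2"
      using y AL BL by (simp add: M_def K.hinner_simps)
    then show "a * (hnorm K y)\<^sup>2 \<le> Re (hinner K (M y) y) \<and> Re (hinner K (M y) y) \<le> b * (hnorm K y)\<^sup>2"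
      using fb Bfb y unfolding K.form_bounded_def by fastforce
  qed
  have spec: "op_spectrum K A \<subseteq> complex_of_real ` J" "op_spectrum K B \<subseteq> complex_of_real ` J"
    using K.form_bounded_spectrum[OF A fb] K.form_bounded_spectrum[OF Bsa Bfb] J by blast+
  have le: "loewner_le K (cfc K f M) (complex_of_real (1 - 1/2) \<odot>\<^bsub>bounded_ops K\<^esub> cfc K f A \<oplus>\<^bsub>bounded_ops K\<^esub>
      complex_of_real (1/2) \<odot>\<^bsub>bounded_ops K\<^esub> cfc K f B)"
    unfolding M_def using convex K.hilbert_space_axioms A Bsa spec
    unfolding operator_convex_def by (elim conjE allE[of _ K] allE[of _ A] allE[of _ B] impE ballE[of _ _ "1/2"]) auto
  note closed = K.cfc_closed[OF A fb f] K.cfc_closed[OF Bsa Bfb f] K.cfc_closed[OF Msa Mfb f]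
    H.cfc_closed[OF Tsa Tfb f]
  have fM: "cfc K f M (V x) = V (cfc H f T x)"
  proof (rule cfc_intertwine[symmetric, OF Tsa Tfb Msa Mfb f _ x])
    fix z assume z: "z \<in> carrier H"
    \<comment> \<open>As \<open>U\<close> fixes \<open>V z\<close>, \<open>M (V z)\<close> is the
      mean of \<open>A (V z)\<close> and \<open>U (A (V z))\<close>, that is,
      \<open>V (V' (A (V z)))\<close>.\<close>
    show "V (T z) = M (V z)"
      using z AL T BL Uc
      by (intro K.vec_eqI) (auto simp: M_def B reflection_V compress reflection_apply[of "A (V z)"] K.hinner_simps diff_divide_distrib)
  qed
  have fB: "cfc K f B (V x) = ?U (cfc K f A (V x))"
  proof -
    \<comment> \<open>\<open>U\<close> intertwines \<open>A\<close> with \<open>B\<close>: since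
      \<open>U\<close> is an involution, \<open>B (U y) = U (A y)\<close>.\<close>
    have "?U (cfc K f A (V x)) = cfc K f B (?U (V x))"
      by (rule adjoint_pair.cfc_intertwine[OF K.adjoint_pair_self[OF self_adjoint_reflection] A fb Bsa Bfb f])
        (use x AL in \<open>auto simp: B reflection_reflection\<close>)
    then show ?thesis using x by (simp add: reflection_V)
  qed
  have "hinner K (cfc K f B (V x)) (V x) = hinner K (cfc K f A (V x)) (V x)"
    using closed x by (simp add: fB reflection_sym reflection_V)
  then have "hinner K (((complex_of_real (1 - 1/2) \<odot>\<^bsub>bounded_ops K\<^esub> cfc K f A \<oplus>\<^bsub>bounded_ops K\<^esub>
      complex_of_real (1/2) \<odot>\<^bsub>bounded_ops K\<^esub> cfc K f B) \<ominus>\<^bsub>bounded_ops K\<^esub> cfc K f M) (V x)) (V x)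
      = hinner K (cfc K f A (V x)) (V x) - hinner H (cfc H f T x) x"
    using closed x by (simp add: K.L_closed K.hinner_simps fM hinner_V_V)
  then show ?thesis
    using le x unfolding loewner_le_def by (metis X_closed)
qed

end

text \<open>The last two hypotheses state \<open>\<Sum>W\<^sub>i\<^sup>*W\<^sub>i = 1\<close> and
  \<open>T = \<Sum>W\<^sub>i\<^sup>*A\<^sub>iW\<^sub>i\<close> as identities of sesquilinear forms.
  Adding up the bounds of \<open>A i\<close> at the vectors \<open>W i x\<close> then bounds
  \<open>T\<close>, so that \<open>f(T)\<close> is a genuine value of the functional
  calculus.\<close>

lemma (in hilbert_space) compression_form_bounded:
  fixes A W :: "'i \<Rightarrow> 'a \<Rightarrow> 'a"
  assumes A: "\<And>i. i \<in> I \<Longrightarrow> self_adjoint H (A i)" "\<And>i. i \<in> I \<Longrightarrow> form_bounded a b (A i)"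
    and W: "\<And>i. i \<in> I \<Longrightarrow> W i \<in> carrier L" and T: "T \<in> carrier L"
    and isometric: "\<And>x y. x \<in> carrier H \<Longrightarrow> y \<in> carrier H \<Longrightarrow>
      (\<Sum>i\<in>I. hinner H (W i x) (W i y)) = hinner H x y"
    and compress: "\<And>x y. x \<in> carrier H \<Longrightarrow> y \<in> carrier H \<Longrightarrow>
      hinner H (T x) y = (\<Sum>i\<in>I. hinner H (A i (W i x)) (W i y))"
  shows "self_adjoint H T" "form_bounded a b T"
proof -
  show "self_adjoint H T"
    unfolding self_adjoint_iff
  proof (intro conjI ballI T)
    fix x y assume xy: "x \<in> carrier H" "y \<in> carrier H"
    have "hinner H x (T y) = cnj (hinner H (T y) x)"
      using xy T hinner_commute[of x "T y"] by simp
    also have "\<dots> = (\<Sum>i\<in>I. hinner H (A i (W i x)) (W i y))"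
      unfolding compress[OF xy(2,1)] cnj_sum
    proof (intro sum.cong refl)
      fix i assume i: "i \<in> I"
      show "cnj (hinner H (A i (W i y)) (W i x)) = hinner H (A i (W i x)) (W i y)"
        using hinner_commute[of "W i x" "A i (W i y)"] self_adjointD[OF A(1)[OF i], of "W i x" "W i y"]
          xy W[OF i] A(1)[OF i] by simp
    qed
    finally show "hinner H (T x) y = hinner H x (T y)"
      using compress[OF xy] by simp
  qed
  show "form_bounded a b T"
    unfolding form_bounded_def
  proof
    fix x assume x: "x \<in> carrier H"
    have "(hnorm H x)\<^sup>2 = (\<Sum>i\<in>I. (hnorm H (W i x))\<^sup>2)"
      using isometric[OF x x, symmetric] x W by (simp add: hnorm_power2)
    then show "a * (hnorm H x)\<^sup>2 \<le> Re (hinner H (T x) x) \<and> Re (hinner H (T x) x) \<le> b * (hnorm H x)\<^sup>2"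
      using compress[OF x x] x W A(2)
      by (auto simp: sum_distrib_left form_bounded_def intro!: sum_mono)
  qed
qed

lemma (in hilbert_space) operator_Jensen:
  fixes A W :: "'i \<Rightarrow> 'a \<Rightarrow> 'a"
  assumes convex: "operator_convex TYPE('a) J f" and J: "{a..b} \<subseteq> J" and fin: "finite I"
    and A: "\<And>i. i \<in> I \<Longrightarrow> self_adjoint H (A i)" "\<And>i. i \<in> I \<Longrightarrow> form_bounded a b (A i)"
    and W: "\<And>i. i \<in> I \<Longrightarrow> W i \<in> carrier L" and T: "T \<in> carrier L"
    and isometric: "\<And>x y. x \<in> carrier H \<Longrightarrow> y \<in> carrier H \<Longrightarrow>
      (\<Sum>i\<in>I. hinner H (W i x) (W i y)) = hinner H x y"
    and compress: "\<And>x y. x \<in> carrier H \<Longrightarrow> y \<in> carrier H \<Longrightarrow>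
      hinner H (T x) y = (\<Sum>i\<in>I. hinner H (A i (W i x)) (W i y))"
    and x: "x \<in> carrier H"
  shows "(\<Sum>i\<in>I. hinner H (cfc H f (A i) (W i x)) (W i x)) - hinner H (cfc H f T x) x \<in> \<real>\<^sub>\<ge>\<^sub>0"
proof (cases "x = \<zero>")
  \<comment> \<open>The zero vector is treated apart: the encoding of families needs an infinite
    carrier, and a nonzero vector is what guarantees it.\<close>
  case True
  have f: "continuous_on {a..b} f"
    using convex J continuous_on_subset by (auto simp: operator_convex_def)
  have "hinner H (cfc H f (A i) (W i x)) (W i x) = 0" if "i \<in> I" for i
    using True op_zero[OF W[OF that]] cfc_closed[OF A(1)[OF that] A(2)[OF that] f] by simp
  moreover note compression_form_bounded[OF A W T isometric compress]
  ultimately show ?thesis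
    using True cfc_closed[OF _ _ f] by simp
next
  case False
  have f: "continuous_on {a..b} f"
    using convex J continuous_on_subset by (auto simp: operator_convex_def)
  obtain e :: "('i \<Rightarrow> 'a) \<Rightarrow> 'a" where "inj_on e (I \<rightarrow>\<^sub>E carrier H)"
    using inj_PiE_infinite[OF fin infinite_carrier[OF x False]] by blast
  then interpret P: hilbert_power H I e
    using fin by unfold_locales
  define V where "V x = P.tuple (\<lambda>i. W i x)" for x
  \<comment> \<open>The adjoint of \<open>V\<close>, assembled from the adjoints of its
    components.\<close>
  define V' where "V' y = (\<Oplus>i\<in>I. adj H (W i) (P.coord i y))" for y
  interpret K: hilbert_space P.K by (rule P.hilbert_space_power)
  have V: "V x \<in> carrier P.K" "i \<in> I \<Longrightarrow> P.coord i (V x) = W i x" if "x \<in> carrier H" for x i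
    using that W by (auto simp: V_def)
  have hinner_V: "hinner P.K y (V z) = (\<Sum>i\<in>I. hinner H (P.coord i y) (W i z))"
    if "y \<in> carrier P.K" "z \<in> carrier H" for y z
    unfolding P.power_simps using V(2)[OF that(2)] by (intro sum.cong) auto
  have V': "V' y \<in> carrier H" if "y \<in> carrier P.K" for y
    unfolding V'_def using that W by (intro M.finsum_closed) auto
  have hinner_V': "hinner H (V' y) z = hinner P.K y (V z)" if "y \<in> carrier P.K" "z \<in> carrier H" for y z
    unfolding hinner_V[OF that] V'_def using that W fin
    by (subst hinner_finsum_left) (auto simp: hinner_adj_left)
  interpret isometry H P.K V V'
  proof (unfold_locales, goal_cases)
    case (3 x y)
    then show ?case
      using hinner_V'[of y x] hinner_commute[of x "V' y"] K.hinner_commute[of "V x" y] V V' by simp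
  next
    case (4 x)
    then show ?case
      using isometric V V' by (intro vec_eqI) (auto simp: hinner_V' hinner_V)
  qed (use V V' in auto)
  have "T z = V' (P.diag A (V z))" if z: "z \<in> carrier H" for z
    using T z V V' P.diag_closed[of A, OF A(1)]
    by (intro vec_eqI) (auto simp: hinner_V' hinner_V compress P.coord_diag[OF A(1)])
  then have "hinner P.K (cfc P.K f (P.diag A) (V x)) (V x) - hinner H (cfc H f T x) x \<in> \<real>\<^sub>\<ge>\<^sub>0"
    by (intro Jensen_isometry[OF convex J P.self_adjoint_diag[OF A(1)] P.form_bounded_diag[OF A] T _ x])
  moreover have "cfc P.K f (P.diag A) \<in> carrier (bounded_ops P.K)"
    by (rule K.cfc_closed[OF P.self_adjoint_diag P.form_bounded_diag f]) (use A in auto)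
  ultimately show ?thesis
    using x V P.coord_cfc_diag[OF A f] by (simp add: hinner_V)
qed

section \<open>Form bounds inside \<open>J\<close>, and the inequality with weights\<close>

context hilbert_space
begin

text \<open>A lower bound \<open>c\<close> for \<open>r - T\<close> survives as
  \<open>c - \<bar>s - r\<bar>\<close> for \<open>s - T\<close>, so the complement of the spectrum
  is open.\<close>

lemma closed_real_spectrum:
  assumes T: "self_adjoint H T"
  shows "closed {r. complex_of_real r \<in> op_spectrum H T}"
  unfolding closed_def open_dist
proof
  fix r assume "r \<in> - {r. complex_of_real r \<in> op_spectrum H T}"
  then have "complex_of_real r \<odot>\<^bsub>L\<^esub> \<one>\<^bsub>L\<^esub> \<ominus>\<^bsub>L\<^esub> T \<in> Units L"
    by (simp add: op_spectrum_def)
  then obtain c where c: "c > 0"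
    "\<And>x. x \<in> carrier H \<Longrightarrow> c * hnorm H x \<le> hnorm H ((complex_of_real r \<odot>\<^bsub>L\<^esub> \<one>\<^bsub>L\<^esub> \<ominus>\<^bsub>L\<^esub> T) x)"
    using Units_bounded_below by metis
  have "complex_of_real s \<notin> op_spectrum H T" if s: "dist s r < c" for s
  proof (rule not_in_spectrumI[OF T, of "c - dist s r"])
    fix x assume x: "x \<in> carrier H"
    have "(complex_of_real r \<odot> x \<ominus> T x) \<ominus> (complex_of_real s \<odot> x \<ominus> T x) = complex_of_real (r - s) \<odot> x"
      using x T by (intro vec_eqI) (auto simp: hinner_simps algebra_simps)
    then have "hnorm H ((complex_of_real r \<odot> x \<ominus> T x) \<ominus> (complex_of_real s \<odot> x \<ominus> T x)) = dist s r * hnorm H x"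
      using x by (simp add: hnorm_smult dist_real_def abs_minus_commute del: of_real_diff)
    then show "(c - dist s r) * hnorm H x \<le> hnorm H (complex_of_real s \<odot> x \<ominus> T x)"
      using hnorm_triangle_sub[of "complex_of_real r \<odot> x \<ominus> T x" "complex_of_real s \<odot> x \<ominus> T x"] c(2)[OF x] x T
      by (simp add: left_diff_distrib)
  qed (use s in simp)
  then show "\<exists>e>0. \<forall>y. dist y r < e \<longrightarrow> y \<in> - {r. complex_of_real r \<in> op_spectrum H T}"
    using c(1) by auto
qed

lemma form_bounded_op_norm:
  assumes T: "T \<in> carrier L"
  shows "form_bounded (- op_norm H T) (op_norm H T) T"
  unfolding form_bounded_def
proof
  fix x assume x: "x \<in> carrier H"
  have "\<bar>Re (hinner H (T x) x)\<bar> \<le> hnorm H (T x) * hnorm H x"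
    using Cauchy_Schwarz[of "T x" x] abs_Re_le_cmod[of "hinner H (T x) x"] x T by simp
  also have "\<dots> \<le> op_norm H T * hnorm H x * hnorm H x"
    using op_norm_le[OF T x] x by (intro mult_right_mono) auto
  finally show "- op_norm H T * (hnorm H x)\<^sup>2 \<le> Re (hinner H (T x) x) \<and>
      Re (hinner H (T x) x) \<le> op_norm H T * (hnorm H x)\<^sup>2"
    by (simp add: power2_eq_square abs_le_iff mult.assoc)
qed

lemma form_bounded_mono:
  assumes "form_bounded a b T" "a' \<le> a" "b \<le> b'"
  shows "form_bounded a' b' T"
  using assms unfolding form_bounded_def
  by (meson mult_right_mono order_trans zero_le_power2)

text \<open>The endpoints are the infimum and supremum of the real spectrum. Being closed, bounded
  and nonempty, it contains both, so they lie in \<open>J\<close> even if \<open>J\<close> is not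
  closed.\<close>

lemma spectral_form_bounds:
  assumes T: "self_adjoint H T" and sub: "op_spectrum H T \<subseteq> complex_of_real ` J"
    and x: "x \<in> carrier H" "x \<noteq> \<zero>"
  shows "\<exists>a b. a \<in> J \<and> b \<in> J \<and> a \<le> b \<and> form_bounded a b T"
proof -
  define S where "S = {r. complex_of_real r \<in> op_spectrum H T}"
  have "S \<subseteq> {- op_norm H T..op_norm H T}"
    using form_bounded_spectrum[OF T form_bounded_op_norm] T unfolding S_def by auto
  then have bdd: "bdd_above S" "bdd_below S"
    by (meson bdd_above_Icc bdd_below_Icc bdd_above_mono bdd_below_mono)+
  have "S \<noteq> {}"
    using spectrum_nonempty[OF T x] unfolding S_def by blast
  then have in_S: "Inf S \<in> S" "Sup S \<in> S"
    using closed_real_spectrum[OF T] bdd unfolding S_def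
    by (intro closed_contains_Inf closed_contains_Sup; simp)+
  have S_J: "r \<in> J" if "r \<in> S" for r
    using that sub unfolding S_def by auto
  have "form_bounded (Inf S) (Sup S) T"
  proof (rule spectrum_form_bounded[OF T])
    show "r \<in> {Inf S..Sup S}" if "complex_of_real r \<in> op_spectrum H T" for r
      using that bdd by (auto simp: S_def intro: cInf_lower cSup_upper)
    show "Inf S \<le> Sup S"
      using in_S bdd by (meson cInf_lower)
  qed
  then show ?thesis
    using in_S S_J bdd by (meson cInf_lower)
qed

lemma common_form_bounds:
  assumes "finite I" "I \<noteq> {}" and J: "is_interval J"
    and A: "\<And>i. i \<in> I \<Longrightarrow> self_adjoint H (A i)" "\<And>i. i \<in> I \<Longrightarrow> op_spectrum H (A i) \<subseteq> complex_of_real ` J"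
  shows "\<exists>a b. {a..b} \<subseteq> J \<and> (\<forall>i\<in>I. form_bounded a b (A i))"
proof (cases "\<exists>x\<in>carrier H. x \<noteq> \<zero>")
  case False
  \<comment> \<open>On the trivial space all form bounds hold, and the empty interval
    \<open>{1..0}\<close> fits into any \<open>J\<close>.\<close>
  then have "form_bounded 1 0 (A i)" if "i \<in> I" for i
    using A(1)[OF that] op_zero[of "A i"] by (auto simp: form_bounded_def)
  then show ?thesis
    by (intro exI[of _ 1] exI[of _ 0]) auto
next
  case True
  then obtain x where x: "x \<in> carrier H" "x \<noteq> \<zero>" by blast
  \<comment> \<open>The induction keeps the endpoints themselves in \<open>J\<close>, where minima
    and maxima stay; the interval property then supplies all of \<open>{a..b}\<close>.\<close>
  have "\<exists>a b. a \<in> J \<and> b \<in> J \<and> a \<le> b \<and> (\<forall>i\<in>I. form_bounded a b (A i))"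
    using assms(1,2) A
  proof (induction I rule: finite_ne_induct)
    case (singleton i)
    then show ?case using spectral_form_bounds[OF _ _ x, of "A i" J] by simp
  next
    case (insert i I)
    obtain a b where ab: "a \<in> J" "b \<in> J" "a \<le> b" "\<forall>i\<in>I. form_bounded a b (A i)"
      using insert.IH insert.prems by (metis insertI2)
    obtain a' b' where ab': "a' \<in> J" "b' \<in> J" "a' \<le> b'" "form_bounded a' b' (A i)"
      using spectral_form_bounds[OF insert.prems(1,2) x, of i] by blast
    have "form_bounded (min a a') (max b b') (A j)" if "j \<in> insert i I" for j
      using that ab(4) ab'(4) by (auto intro: form_bounded_mono)
    moreover have "min a a' \<in> J" "max b b' \<in> J" "min a a' \<le> max b b'"
      using ab(1-3) ab'(1-3) by (auto simp: min_def max_def)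
    ultimately show ?case by (intro exI[of _ "min a a'"] exI[of _ "max b b'"] conjI ballI)
  qed
  then obtain a b where ab: "a \<in> J" "b \<in> J" "\<forall>i\<in>I. form_bounded a b (A i)" by blast
  moreover have "{a..b} \<subseteq> J"
    using mem_is_interval_1_I[OF J ab(1,2)] by auto
  ultimately show ?thesis by blast
qed

lemma loewner_leI:
  assumes "S \<in> carrier L" "T \<in> carrier L"
    and "\<And>x. x \<in> carrier H \<Longrightarrow> hinner H (T x) x - hinner H (S x) x \<in> \<real>\<^sub>\<ge>\<^sub>0"
  shows "loewner_le H S T"
  using assms by (simp add: loewner_le_def hinner_diff_left)

lemma weighted_Jensen:
  fixes A C :: "'i \<Rightarrow> 'a \<Rightarrow> 'a"
  assumes convex: "operator_convex TYPE('a) J f" and J: "is_interval J" and fin: "finite I"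
    and C: "\<And>i. i \<in> I \<Longrightarrow> C i \<in> carrier L" and B: "self_adjoint H B"
    and A: "\<And>i. i \<in> I \<Longrightarrow> self_adjoint H (A i)"
    and specB: "op_spectrum H (B \<ominus>\<^bsub>L\<^esub> (\<Oplus>\<^bsub>L\<^esub>i\<in>I. adj H (C i) \<otimes>\<^bsub>L\<^esub> A i \<otimes>\<^bsub>L\<^esub> C i)) \<subseteq> complex_of_real ` J"
    and specA: "\<And>i. i \<in> I \<Longrightarrow> op_spectrum H (A i) \<subseteq> complex_of_real ` J"
    and D_def: "D = cfc H (\<lambda>x. x powr (-1/2)) (\<one>\<^bsub>L\<^esub> \<oplus>\<^bsub>L\<^esub> (\<Oplus>\<^bsub>L\<^esub>i\<in>I. adj H (C i) \<otimes>\<^bsub>L\<^esub> C i))"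
  shows "loewner_le H
    (inv\<^bsub>L\<^esub> D \<otimes>\<^bsub>L\<^esub> cfc H f (D \<otimes>\<^bsub>L\<^esub> B \<otimes>\<^bsub>L\<^esub> D) \<otimes>\<^bsub>L\<^esub> inv\<^bsub>L\<^esub> D)
    (cfc H f (B \<ominus>\<^bsub>L\<^esub> (\<Oplus>\<^bsub>L\<^esub>i\<in>I. adj H (C i) \<otimes>\<^bsub>L\<^esub> A i \<otimes>\<^bsub>L\<^esub> C i)) \<oplus>\<^bsub>L\<^esub>
      (\<Oplus>\<^bsub>L\<^esub>i\<in>I. adj H (C i) \<otimes>\<^bsub>L\<^esub> cfc H f (A i) \<otimes>\<^bsub>L\<^esub> C i))"
proof -
  have AL: "A i \<in> carrier L" if "i \<in> I" for i using A[OF that] by simp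
  have BL: "B \<in> carrier L" using B by simp
  have sum_closed: "(\<Oplus>\<^bsub>L\<^esub>i\<in>I. adj H (C i) \<otimes>\<^bsub>L\<^esub> G i \<otimes>\<^bsub>L\<^esub> C i) \<in> carrier L"
    if "\<And>i. i \<in> I \<Longrightarrow> G i \<in> carrier L" for G
    using that C by (intro Ops.finsum_closed) (auto simp: L_closed)
  have hinner_sum: "hinner H ((\<Oplus>\<^bsub>L\<^esub>i\<in>I. adj H (C i) \<otimes>\<^bsub>L\<^esub> G i \<otimes>\<^bsub>L\<^esub> C i) x) y
      = (\<Sum>i\<in>I. hinner H (G i (C i x)) (C i y))"
    if "\<And>i. i \<in> I \<Longrightarrow> G i \<in> carrier L" "x \<in> carrier H" "y \<in> carrier H" for G x y
    using that C fin by (subst hinner_L_finsum) (auto simp: L_closed hinner_adj_left)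
  define A\<^sub>0 where "A\<^sub>0 = B \<ominus>\<^bsub>L\<^esub> (\<Oplus>\<^bsub>L\<^esub>i\<in>I. adj H (C i) \<otimes>\<^bsub>L\<^esub> A i \<otimes>\<^bsub>L\<^esub> C i)"
  have A0L: "A\<^sub>0 \<in> carrier L"
    using sum_closed[of A] AL BL by (simp add: A\<^sub>0_def)
  have hinner_A0: "hinner H (A\<^sub>0 x) y = hinner H (B x) y - (\<Sum>i\<in>I. hinner H (A i (C i x)) (C i y))"
    if "x \<in> carrier H" "y \<in> carrier H" for x y
    using that sum_closed[of A] AL BL by (simp add: A\<^sub>0_def hinner_diff_left hinner_sum)
  have A0: "self_adjoint H A\<^sub>0"
    unfolding self_adjoint_iff
  proof (intro conjI ballI A0L)
    fix x y assume xy: "x \<in> carrier H" "y \<in> carrier H"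
    have "hinner H x (A\<^sub>0 y) = cnj (hinner H (A\<^sub>0 y) x)"
      using xy A0L hinner_commute[of x "A\<^sub>0 y"] by simp
    also have "\<dots> = cnj (hinner H (B y) x) - (\<Sum>i\<in>I. cnj (hinner H (A i (C i y)) (C i x)))"
      using xy by (simp add: hinner_A0)
    also have "cnj (hinner H (B y) x) = hinner H (B x) y"
      using hinner_commute[of x "B y"] self_adjointD[OF B xy] xy BL by simp
    also have "(\<Sum>i\<in>I. cnj (hinner H (A i (C i y)) (C i x))) = (\<Sum>i\<in>I. hinner H (A i (C i x)) (C i y))"
    proof (intro sum.cong refl)
      fix i assume i: "i \<in> I"
      show "cnj (hinner H (A i (C i y)) (C i x)) = hinner H (A i (C i x)) (C i y)"
        using hinner_commute[of "C i x" "A i (C i y)"] self_adjointD[OF A[OF i], of "C i x" "C i y"]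
          xy C[OF i] AL[OF i] by simp
    qed
    finally show "hinner H (A\<^sub>0 x) y = hinner H x (A\<^sub>0 y)"
      using hinner_A0[OF xy] by simp
  qed

  define S where "S = \<one>\<^bsub>L\<^esub> \<oplus>\<^bsub>L\<^esub> (\<Oplus>\<^bsub>L\<^esub>i\<in>I. adj H (C i) \<otimes>\<^bsub>L\<^esub> C i)"
  have SL: "S \<in> carrier L"
    unfolding S_def using C by (intro L_closed Ops.finsum_closed) (auto simp: L_closed)
  have hinner_S: "hinner H (S x) y = hinner H x y + (\<Sum>i\<in>I. hinner H (C i x) (C i y))"
    if "x \<in> carrier H" "y \<in> carrier H" for x y
  proof -
    have "(\<Oplus>\<^bsub>L\<^esub>i\<in>I. adj H (C i) \<otimes>\<^bsub>L\<^esub> C i) \<in> carrier L"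
      using C by (intro Ops.finsum_closed) (auto simp: L_closed)
    then show ?thesis
      using that C fin by (simp add: S_def hinner_add_left hinner_L_finsum L_closed hinner_adj_left)
  qed
  have S: "self_adjoint H S"
    unfolding self_adjoint_iff
  proof (intro conjI ballI SL)
    fix x y assume xy: "x \<in> carrier H" "y \<in> carrier H"
    have "hinner H x (S y) = cnj (hinner H (S y) x)"
      using xy SL hinner_commute[of x "S y"] by simp
    also have "\<dots> = cnj (hinner H y x) + (\<Sum>i\<in>I. cnj (hinner H (C i y) (C i x)))"
      using xy by (simp add: hinner_S)
    also have "\<dots> = hinner H x y + (\<Sum>i\<in>I. hinner H (C i x) (C i y))"
      using xy C hinner_commute by (intro arg_cong2[where f = plus] sum.cong refl) (metis op_closed)+
    finally show "hinner H (S x) y = hinner H x (S y)"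
      using hinner_S[OF xy] by simp
  qed
  \<comment> \<open>\<open>S\<close> is the identity plus a positive operator, so its lower bound
    \<open>1\<close> stays away from \<open>0\<close>, as \<open>cfc_inverse_sqrt\<close>
    requires.\<close>
  have Sfb: "form_bounded 1 (op_norm H S) S"
    unfolding form_bounded_def
  proof (intro ballI conjI)
    fix x assume x: "x \<in> carrier H"
    have "0 \<le> (\<Sum>i\<in>I. Re (hinner H (C i x) (C i x)))"
      using hinner_nonneg C x by (intro sum_nonneg) (auto simp: complex_nonneg_Reals_iff)
    then show "1 * (hnorm H x)\<^sup>2 \<le> Re (hinner H (S x) x)"
      using hinner_S[OF x x] x by (simp add: hnorm_power2)
    show "Re (hinner H (S x) x) \<le> op_norm H S * (hnorm H x)\<^sup>2"
      using form_bounded_op_norm[OF SL] x by (simp add: form_bounded_def)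
  qed
  \<comment> \<open>\<open>cfc_inverse_sqrt\<close> speaks about a vector \<open>x\<close>; the zero
    vector is at hand to extract the self-adjointness of \<open>D\<close>.\<close>
  have D: "self_adjoint H D" and DDS: "\<And>x. x \<in> carrier H \<Longrightarrow> D (D (S x)) = x"
    and SD: "\<And>x. x \<in> carrier H \<Longrightarrow> S (D x) = D (S x)"
    using cfc_inverse_sqrt[OF S Sfb] M.zero_closed unfolding D_def S_def by auto
  have DL: "D \<in> carrier L" using D by simp
  \<comment> \<open>The inverse of \<open>D\<close>: from \<open>D D S = 1\<close> and
    \<open>S D = D S\<close> it follows that \<open>S D\<close> inverts \<open>D\<close> on both
    sides.\<close>
  define R where "R = S \<otimes>\<^bsub>L\<^esub> D"
  have RL: "R \<in> carrier L" using SL DL by (simp add: R_def L_closed)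
  have R: "R x = S (D x)" if "x \<in> carrier H" for x
    using that by (simp add: R_def)
  have DR: "D (R x) = x" if "x \<in> carrier H" for x
    using that SD DDS DL SL by (simp add: R)
  have RD: "R (D x) = x" if "x \<in> carrier H" for x
    using that SD DDS DL SL by (simp add: R)
  have inv_D: "inv\<^bsub>L\<^esub> D = R"
    using DL RL by (intro Ops.inv_char op_eqI) (auto simp: L_closed DR RD)
  have R_sym: "hinner H (R x) y = hinner H x (R y)" if "x \<in> carrier H" "y \<in> carrier H" for x y
    using that SL DL SD by (simp add: R self_adjointD[OF S] self_adjointD[OF D])

  \<comment> \<open>The index \<open>None\<close> stands for the index \<open>0\<close> of \<open>A\<^sub>0\<close> and \<open>C\<^sub>0 = 1\<close>.\<close>
  define A' where "A' = case_option A\<^sub>0 A"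
  define C' where "C' = case_option \<one>\<^bsub>L\<^esub> C"
  define I' where "I' = insert None (Some ` I)"
  define W where "W i = C' i \<otimes>\<^bsub>L\<^esub> D" for i
  have sum_I': "sum g I' = g None + (\<Sum>i\<in>I. g (Some i))" for g :: "'i option \<Rightarrow> complex"
    using fin by (simp add: I'_def sum.reindex)
  have fin': "finite I'" "I' \<noteq> {}" using fin by (auto simp: I'_def)
  have A': "self_adjoint H (A' i)" "op_spectrum H (A' i) \<subseteq> complex_of_real ` J" if "i \<in> I'" for i
    using that A A0 specA specB[folded A\<^sub>0_def]
    by (cases i; simp add: A'_def I'_def image_iff)+
  obtain a b where ab: "{a..b} \<subseteq> J" "\<And>i. i \<in> I' \<Longrightarrow> form_bounded a b (A' i)"
    using common_form_bounds[OF fin' J, of A'] A' by blast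
  have f: "continuous_on {a..b} f"
    using convex ab(1) continuous_on_subset by (auto simp: operator_convex_def)
  have W: "W i \<in> carrier L" if "i \<in> I'" for i
    using that C DL by (auto simp: W_def C'_def I'_def L_closed)
  have TL: "D \<otimes>\<^bsub>L\<^esub> B \<otimes>\<^bsub>L\<^esub> D \<in> carrier L"
    using DL BL by (simp add: L_closed)
  have isometric: "(\<Sum>i\<in>I'. hinner H (W i x) (W i y)) = hinner H x y"
    if xy: "x \<in> carrier H" "y \<in> carrier H" for x y
  proof -
    have "(\<Sum>i\<in>I'. hinner H (W i x) (W i y)) = hinner H (S (D x)) (D y)"
      using xy DL by (simp add: sum_I' W_def C'_def hinner_S)
    also have "\<dots> = hinner H (D (S (D x))) y"
      using xy DL SL by (simp add: self_adjointD[OF D])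
    also have "D (S (D x)) = x"
      using xy DL SL SD DDS by simp
    finally show ?thesis .
  qed
  \<comment> \<open>By the choice of \<open>A\<^sub>0\<close> the terms over \<open>I\<close>
    cancel, which leaves only \<open>B\<close> between the two copies of \<open>D\<close>.\<close>
  have compress: "hinner H ((D \<otimes>\<^bsub>L\<^esub> B \<otimes>\<^bsub>L\<^esub> D) x) y = (\<Sum>i\<in>I'. hinner H (A' i (W i x)) (W i y))"
    if xy: "x \<in> carrier H" "y \<in> carrier H" for x y
    using xy DL BL by (simp add: sum_I' W_def C'_def A'_def hinner_A0 self_adjointD[OF D])
  have Jensen: "(\<Sum>i\<in>I'. hinner H (cfc H f (A' i) (W i x)) (W i x)) -
      hinner H (cfc H f (D \<otimes>\<^bsub>L\<^esub> B \<otimes>\<^bsub>L\<^esub> D) x) x \<in> \<real>\<^sub>\<ge>\<^sub>0" if "x \<in> carrier H" for x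
    by (rule operator_Jensen[OF convex ab(1) fin'(1) A'(1) ab(2) W TL isometric compress that])
  have fA: "cfc H f (A i) \<in> carrier L" if "i \<in> I" for i
    using cfc_closed[OF A'(1) ab(2) f, of "Some i"] that by (simp add: A'_def I'_def)
  have fA0: "cfc H f A\<^sub>0 \<in> carrier L"
    using cfc_closed[OF A'(1) ab(2) f, of None] by (simp add: A'_def I'_def)
  have fT: "cfc H f (D \<otimes>\<^bsub>L\<^esub> B \<otimes>\<^bsub>L\<^esub> D) \<in> carrier L"
    by (rule cfc_closed[OF compression_form_bounded[OF A'(1) ab(2) W TL isometric compress] f])
  show ?thesis
    unfolding inv_D A\<^sub>0_def[symmetric]
  proof (rule loewner_leI)
    fix x assume x: "x \<in> carrier H"
    have Rx: "R x \<in> carrier H" using RL x by simp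
    \<comment> \<open>Jensen's inequality is evaluated at \<open>R x\<close>, where
      \<open>W i (R x)\<close> is \<open>C' i x\<close> because \<open>D (R x) = x\<close>. This
      carries out the conjugation by the inverse of \<open>D\<close>.\<close>
    have "(\<Sum>i\<in>I'. hinner H (cfc H f (A' i) (W i (R x))) (W i (R x)))
        = hinner H (cfc H f A\<^sub>0 x) x + (\<Sum>i\<in>I. hinner H (cfc H f (A i) (C i x)) (C i x))"
      using x Rx by (simp add: sum_I' W_def C'_def A'_def DR)
    moreover have "hinner H ((R \<otimes>\<^bsub>L\<^esub> cfc H f (D \<otimes>\<^bsub>L\<^esub> B \<otimes>\<^bsub>L\<^esub> D) \<otimes>\<^bsub>L\<^esub> R) x) x
        = hinner H (cfc H f (D \<otimes>\<^bsub>L\<^esub> B \<otimes>\<^bsub>L\<^esub> D) (R x)) (R x)"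
      using x Rx fT RL by (simp add: R_sym)
    ultimately show "hinner H ((cfc H f A\<^sub>0 \<oplus>\<^bsub>L\<^esub> (\<Oplus>\<^bsub>L\<^esub>i\<in>I. adj H (C i) \<otimes>\<^bsub>L\<^esub> cfc H f (A i) \<otimes>\<^bsub>L\<^esub> C i)) x) x -
        hinner H ((R \<otimes>\<^bsub>L\<^esub> cfc H f (D \<otimes>\<^bsub>L\<^esub> B \<otimes>\<^bsub>L\<^esub> D) \<otimes>\<^bsub>L\<^esub> R) x) x \<in> \<real>\<^sub>\<ge>\<^sub>0"
      using Jensen[OF Rx] x fA fA0 sum_closed[of "\<lambda>i. cfc H f (A i)"]
      by (simp add: hinner_add_left hinner_sum)
  qed (use fA fA0 fT RL sum_closed in \<open>auto simp: L_closed\<close>)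
qed

end

theorem theorem5p1:
  fixes H :: "'a inner_product_space"
    and L :: "(complex, 'a \<Rightarrow> 'a) module" (structure)
    and J :: "real set" and f :: "real \<Rightarrow> real" and n :: nat
    and A C :: "nat \<Rightarrow> 'a \<Rightarrow> 'a" and B D :: "'a \<Rightarrow> 'a"
  defines "L \<equiv> bounded_ops H"
  assumes "hilbert_space H"
    and "is_interval J"
    and "operator_convex TYPE('a) J f"
    and "\<And>i. i \<in> {1..n} \<Longrightarrow> C i \<in> carrier L"
    and "self_adjoint H B"
    and "\<And>i. i \<in> {1..n} \<Longrightarrow> self_adjoint H (A i)"
    and "op_spectrum H (B \<ominus> (\<Oplus>i\<in>{1..n}. adj H (C i) \<otimes> A i \<otimes> C i)) \<subseteq> complex_of_real ` J"
    and "\<And>i. i \<in> {1..n} \<Longrightarrow> op_spectrum H (A i) \<subseteq> complex_of_real ` J"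
    and D_def: "D = cfc H (\<lambda>x. x powr (-1/2)) (\<one> \<oplus> (\<Oplus>i\<in>{1..n}. adj H (C i) \<otimes> C i))"
  shows "loewner_le H
           (inv D \<otimes> cfc H f (D \<otimes> B \<otimes> D) \<otimes> inv D)
           (cfc H f (B \<ominus> (\<Oplus>i\<in>{1..n}. adj H (C i) \<otimes> A i \<otimes> C i)) \<oplus>
            (\<Oplus>i\<in>{1..n}. adj H (C i) \<otimes> cfc H f (A i) \<otimes> C i))"
  unfolding L_def
proof (rule hilbert_space.weighted_Jensen)
qed (use assms in \<open>simp_all add: L_def\<close>)

end
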